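(* Let $n,q\in\mathbb{N}$ and let $(\Gamma_j)_{j=0}^n$ be a $q\times q$ Carathéodory sequence. Then the Riesz–Herglotz measure $\mu$ of the central Carathéodory function corresponding to $(\Gamma_j)_{j=0}^n$ admits, for all Borel subsets $B$ of $\mathbb{T}$, the representation $$\mu(B)=\frac1{2\pi}\int_B\operatorname{Re}\Lambda_n(\zeta)\,\lambda(d\zeta)+\sum_{v\in\mathcal{N}_n}X_{n,v}\,\delta_v(B),$$ where $\mathcal{N}_n$, $X_{n,v}$ and $\Lambda_n$ are built from $(\Gamma_j)_{j=0}^n$ as described in the context.
   Context: $\mathbb{D}$ is the open unit disk, $\mathbb{T}$ the unit circle; $\operatorname{Re}A=\frac12(A+A^* )$, $\operatorname{Im}A=\frac1{2i}(A-A^* )$; $A^\dagger$ is the Moore–Penrose inverse; $A^\sharp$ the classical adjugate; $\lambda$ the linear Lebesgue (arc length, total mass $2\pi$) measure on the Borel sets of $\mathbb{T}$; $\delta_v$ the Dirac measure at $v$. Empty sums are zero matrices. **Riesz–Herglotz measure.** A $q\times q$ Carathéodory function is a holomorphic $\Phi:\mathbb{D}\to\mathbb{C}^{q\times q}$ with $\operatorname{Re}\Phi(z)$ non-negative Hermitian for all $z\in\mathbb{D}$. Its Riesz–Herglotz measure is the unique non-negative Hermitian $q\times q$ measure $\mu$ on $\mathbb{T}$ (countably additive map from the Borel sets of $\mathbb{T}$ into the non-negative Hermitian $q\times q$ matrices) with $\Phi(z)-i\operatorname{Im}\Phi(0)=\int_{\mathbb{T}}\frac{\zeta+z}{\zeta-z}\mu(d\zeta)$,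 $z\in\mathbb{D}$. **Carathéodory sequence.** For complex $q\times q$ matrices $\Gamma_0,\Gamma_1,\dots$ let $S_m$ be the lower triangular block Toeplitz matrix $S_m=[\Gamma_{j-k}]_{j,k=0}^m$ with $\Gamma_{l}:=0$ for $l<0$. $(\Gamma_j)_{j=0}^n$ is a $q\times q$ Carathéodory sequence if $\operatorname{Re}S_m$ is non-negative Hermitian for $m=0,\dots,n$. **Central continuation.** Put $C_0:=\operatorname{Re}\Gamma_0$, $C_j:=\frac12\Gamma_j$ for $1\le j\le n$. For $j\ge n+1$ define recursively $C_j:=M_j$, where $M_{m+1}:=Z_mT_{m-1}^\dagger Y_m$ for $m\ge1$, with $C_{-j}:=C_j^*$, $T_m:=[C_{j-k}]_{j,k=0}^m$, $Y_m$ the block column with blocks $C_1,\dots,C_m$ (top to bottom), and $Z_m:=[C_m,C_{m-1},\dots,C_1]$. Put $\Gamma_j:=2C_j$ for $j\ge n+1$. Then $\Phi(z)=\sum_{j=0}^\infty z^j\Gamma_j$ defines a $q\times q$ Carathéodory function, called the central Carathéodory function corresponding to $(\Gamma_j)_{j=0}^n$. **The objects in the formula.** Let $e_m(z):=[z^0I_q,z^1I_q,\dots,z^mI_q]$ and $$a_n(z):=\Gamma_0+z\,e_{n-1}(z)S_{n-1}^*T_{n-1}^\dagger Y_n,\qquad b_n(z):=I_q-z\,e_{n-1}(z)T_{n-1}^\dagger Y_n .$$ ($\det b_n$ does not vanish identically since $b_n(0)=I_q$.) Let $\mathcal{N}_n:=\{v\in\mathbb{T}:\det b_n(v)=0\}$,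 a finite set; for $v\in\mathcal{N}_n$ let $m_v$ be the multiplicity of $v$ as a zero of $\det b_n$ and $$X_{n,v}:=\frac{-m_v}{2v(\det b_n)^{(m_v)}(v)}\,(a_nb_n^\sharp)^{(m_v-1)}(v).$$ Let $\Delta_n(z):=\sum_{v\in\mathcal{N}_n}\frac{v+z}{v-z}X_{n,v}$ for $z\in\mathbb{C}\setminus\mathcal{N}_n$ and $\Lambda_n:=a_nb_n^{-1}-\Delta_n$, a rational matrix function (removable singularities removed). *)

theory Defs
  imports
    "HOL-Complex_Analysis.Complex_Analysis"
    "HOL-Probability.Probability"
    "Jordan_Normal_Form.Schur_Decomposition"
    "Jordan_Normal_Form.Gauss_Jordan_Elimination"
begin

text \<open>
  Matrices are those of Jordan_Normal_Form, since the sizes of the block matrices vary with an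
  index. The names shared with HOL-Analysis are hidden in favour of that entry.
\<close>

hide_const (open) Determinants.det Finite_Cartesian_Product.mat Finite_Cartesian_Product.vec

section \<open>Matrices\<close>

definition re_mat :: "complex mat \<Rightarrow> complex mat" where
  "re_mat A = (1 / 2) \<cdot>\<^sub>m (A + mat_adjoint A)"

definition im_mat :: "complex mat \<Rightarrow> complex mat" where
  "im_mat A = (1 / (2 * \<i>)) \<cdot>\<^sub>m (A - mat_adjoint A)"

text \<open>
  The order on the complex numbers is that of \<^theory>\<open>HOL-Library.Complex_Order\<close>:
  \<open>0 \<le> w\<close> says that \<open>w\<close> is real and non-negative.
\<close>

definition nonneg_hermitian :: "nat \<Rightarrow> complex mat \<Rightarrow> bool" where
  "nonneg_hermitian r A \<longleftrightarrow> A \<in> carrier_mat r r \<and> mat_adjoint A = A \<and>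
     (\<forall>x\<in>carrier_vec r. 0 \<le> (A *\<^sub>v x) \<bullet>c x)"

definition moore_penrose :: "complex mat \<Rightarrow> complex mat" where
  "moore_penrose A = (THE X. X \<in> carrier_mat (dim_col A) (dim_row A) \<and>
     A * X * A = A \<and> X * A * X = X \<and>
     mat_adjoint (A * X) = A * X \<and> mat_adjoint (X * A) = X * A)"

section \<open>Non-negative Hermitian measures on the unit circle\<close>

abbreviation unit_circle :: "complex set" where
  "unit_circle \<equiv> sphere 0 1"

abbreviation circle_borel :: "complex measure" where
  "circle_borel \<equiv> restrict_space borel unit_circle"

definition arc_length :: "complex measure" where
  "arc_length = distr (restrict_space lborel {0..<2 * pi}) circle_borel cis"

text \<open>
  As for \<^const>\<open>emeasure\<close>, the value on non-measurable sets is fixed to be zero. This makes a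
  measure on the Borel sets of the circle a unique total function.
\<close>

definition nonneg_hermitian_measure :: "nat \<Rightarrow> (complex set \<Rightarrow> complex mat) \<Rightarrow> bool" where
  "nonneg_hermitian_measure q \<mu> \<longleftrightarrow>
     (\<forall>B\<in>sets circle_borel. nonneg_hermitian q (\<mu> B)) \<and>
     (\<forall>A::nat \<Rightarrow> complex set. range A \<subseteq> sets circle_borel \<longrightarrow> disjoint_family A \<longrightarrow>
        (\<forall>i<q. \<forall>k<q. (\<lambda>j. \<mu> (A j) $$ (i, k)) sums \<mu> (\<Union>j. A j) $$ (i, k))) \<and>
     (\<forall>B. B \<notin> sets circle_borel \<longrightarrow> \<mu> B = 0\<^sub>m q q)"

definition trace_measure :: "nat \<Rightarrow> (complex set \<Rightarrow> complex mat) \<Rightarrow> complex measure" where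
  "trace_measure q \<mu> = measure_of unit_circle (sets circle_borel)
     (\<lambda>B. ennreal (Re (\<Sum>i<q. \<mu> B $$ (i, i))))"

text \<open>
  Integration with respect to a non-negative Hermitian measure goes, as usual, through a
  Radon--Nikodym density \<open>D\<close> with respect to the trace measure, which dominates all entries
  of \<open>\<mu>\<close>. The value does not depend on the choice of \<open>D\<close>.
\<close>

definition trace_density ::
  "nat \<Rightarrow> (complex set \<Rightarrow> complex mat) \<Rightarrow> (complex \<Rightarrow> complex mat) \<Rightarrow> bool" where
  "trace_density q \<mu> D \<longleftrightarrow>
     (\<forall>i<q. \<forall>k<q. integrable (trace_measure q \<mu>) (\<lambda>\<zeta>. D \<zeta> $$ (i, k)) \<and>
        (\<forall>B\<in>sets circle_borel. \<mu> B $$ (i, k) = (LINT \<zeta>:B|trace_measure q \<mu>. D \<zeta> $$ (i, k))))"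

definition has_matrix_integral ::
  "nat \<Rightarrow> (complex set \<Rightarrow> complex mat) \<Rightarrow> (complex \<Rightarrow> complex) \<Rightarrow> complex mat \<Rightarrow> bool" where
  "has_matrix_integral q \<mu> f J \<longleftrightarrow> J \<in> carrier_mat q q \<and>
     (\<exists>D. trace_density q \<mu> D \<and>
        (\<forall>i<q. \<forall>k<q. integrable (trace_measure q \<mu>) (\<lambda>\<zeta>. f \<zeta> * D \<zeta> $$ (i, k)) \<and>
           J $$ (i, k) = (LINT \<zeta>|trace_measure q \<mu>. f \<zeta> * D \<zeta> $$ (i, k))))"

definition riesz_herglotz_measure ::
  "nat \<Rightarrow> (complex \<Rightarrow> complex mat) \<Rightarrow> complex set \<Rightarrow> complex mat" where
  "riesz_herglotz_measure q \<Phi> = (THE \<mu>. nonneg_hermitian_measure q \<mu> \<and>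
     (\<forall>z\<in>ball 0 1. has_matrix_integral q \<mu> (\<lambda>\<zeta>. (\<zeta> + z) / (\<zeta> - z)) (\<Phi> z - \<i> \<cdot>\<^sub>m im_mat (\<Phi> 0))))"

section \<open>Block matrices\<close>

text \<open>
  Entry \<open>(r, s)\<close> of a matrix with \<open>q \<times> q\<close> blocks is entry \<open>(r mod q, s mod q)\<close> of the block
  with index \<open>(r div q, s div q)\<close>.
\<close>

definition block_toeplitz :: "nat \<Rightarrow> nat \<Rightarrow> (int \<Rightarrow> complex mat) \<Rightarrow> complex mat" where
  "block_toeplitz q m F = mat ((m + 1) * q) ((m + 1) * q)
     (\<lambda>(r, s). F (int (r div q) - int (s div q)) $$ (r mod q, s mod q))"

definition S_mat :: "nat \<Rightarrow> (nat \<Rightarrow> complex mat) \<Rightarrow> nat \<Rightarrow> complex mat" where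
  "S_mat q \<Gamma> m = block_toeplitz q m (\<lambda>l. if l < 0 then 0\<^sub>m q q else \<Gamma> (nat l))"

definition T_mat :: "nat \<Rightarrow> (nat \<Rightarrow> complex mat) \<Rightarrow> nat \<Rightarrow> complex mat" where
  "T_mat q C m = block_toeplitz q m
     (\<lambda>l. if l < 0 then mat_adjoint (C (nat (- l))) else C (nat l))"

definition Y_mat :: "nat \<Rightarrow> (nat \<Rightarrow> complex mat) \<Rightarrow> nat \<Rightarrow> complex mat" where
  "Y_mat q C m = mat (m * q) q (\<lambda>(r, k). C (r div q + 1) $$ (r mod q, k))"

definition Z_mat :: "nat \<Rightarrow> (nat \<Rightarrow> complex mat) \<Rightarrow> nat \<Rightarrow> complex mat" where
  "Z_mat q C m = mat q (m * q) (\<lambda>(i, s). C (m - s div q) $$ (i, s mod q))"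

definition e_mat :: "nat \<Rightarrow> nat \<Rightarrow> complex \<Rightarrow> complex mat" where
  "e_mat q m z = mat q ((m + 1) * q) (\<lambda>(i, s). if i = s mod q then z ^ (s div q) else 0)"

section \<open>Caratheodory sequences and the central continuation\<close>

definition caratheodory_sequence :: "nat \<Rightarrow> nat \<Rightarrow> (nat \<Rightarrow> complex mat) \<Rightarrow> bool" where
  "caratheodory_sequence q n \<Gamma> \<longleftrightarrow> (\<forall>j\<le>n. \<Gamma> j \<in> carrier_mat q q) \<and>
     (\<forall>m\<le>n. nonneg_hermitian ((m + 1) * q) (re_mat (S_mat q \<Gamma> m)))"

text \<open>\<open>central_step q C m\<close> is the matrix $M_{m+1}$, which only involves \<open>C 0, \<dots>, C m\<close>.\<close>

definition central_step :: "nat \<Rightarrow> (nat \<Rightarrow> complex mat) \<Rightarrow> nat \<Rightarrow> complex mat" where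
  "central_step q C m = Z_mat q C m * moore_penrose (T_mat q C (m - 1)) * Y_mat q C m"

text \<open>The inner \<open>if\<close> only serves to make the course-of-values recursion well-founded.\<close>

function central_C :: "nat \<Rightarrow> nat \<Rightarrow> (nat \<Rightarrow> complex mat) \<Rightarrow> nat \<Rightarrow> complex mat" where
  "central_C q n \<Gamma> j =
     (if j = 0 then re_mat (\<Gamma> 0)
      else if j \<le> n then (1 / 2) \<cdot>\<^sub>m \<Gamma> j
      else central_step q (\<lambda>i. if i < j then central_C q n \<Gamma> i else 0\<^sub>m q q) (j - 1))"
  by auto
termination by (relation "Wellfounded.measure (\<lambda>(q, n, \<Gamma>, j). j)") auto

declare central_C.simps [simp del]

definition central_continuation ::
  "nat \<Rightarrow> nat \<Rightarrow> (nat \<Rightarrow> complex mat) \<Rightarrow> nat \<Rightarrow> complex mat" where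
  "central_continuation q n \<Gamma> j = (if j \<le> n then \<Gamma> j else 2 \<cdot>\<^sub>m central_C q n \<Gamma> j)"

definition central_caratheodory_function ::
  "nat \<Rightarrow> nat \<Rightarrow> (nat \<Rightarrow> complex mat) \<Rightarrow> complex \<Rightarrow> complex mat" where
  "central_caratheodory_function q n \<Gamma> z =
     mat q q (\<lambda>(i, k). \<Sum>j. z ^ j * central_continuation q n \<Gamma> j $$ (i, k))"

section \<open>The objects in the formula\<close>

definition a_fun :: "nat \<Rightarrow> nat \<Rightarrow> (nat \<Rightarrow> complex mat) \<Rightarrow> complex \<Rightarrow> complex mat" where
  "a_fun q n \<Gamma> z = \<Gamma> 0 + z \<cdot>\<^sub>m
     (e_mat q (n - 1) z * mat_adjoint (S_mat q \<Gamma> (n - 1)) *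
      moore_penrose (T_mat q (central_C q n \<Gamma>) (n - 1)) * Y_mat q (central_C q n \<Gamma>) n)"

definition b_fun :: "nat \<Rightarrow> nat \<Rightarrow> (nat \<Rightarrow> complex mat) \<Rightarrow> complex \<Rightarrow> complex mat" where
  "b_fun q n \<Gamma> z = 1\<^sub>m q - z \<cdot>\<^sub>m
     (e_mat q (n - 1) z *
      moore_penrose (T_mat q (central_C q n \<Gamma>) (n - 1)) * Y_mat q (central_C q n \<Gamma>) n)"

definition N_set :: "nat \<Rightarrow> nat \<Rightarrow> (nat \<Rightarrow> complex mat) \<Rightarrow> complex set" where
  "N_set q n \<Gamma> = {v \<in> unit_circle. det (b_fun q n \<Gamma> v) = 0}"

definition zero_mult :: "nat \<Rightarrow> nat \<Rightarrow> (nat \<Rightarrow> complex mat) \<Rightarrow> complex \<Rightarrow> nat" where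
  "zero_mult q n \<Gamma> v = nat (zorder (\<lambda>z. det (b_fun q n \<Gamma> z)) v)"

definition X_mat :: "nat \<Rightarrow> nat \<Rightarrow> (nat \<Rightarrow> complex mat) \<Rightarrow> complex \<Rightarrow> complex mat" where
  "X_mat q n \<Gamma> v = (let m = zero_mult q n \<Gamma> v in
     (- of_nat m / (2 * v * (deriv ^^ m) (\<lambda>z. det (b_fun q n \<Gamma> z)) v)) \<cdot>\<^sub>m
     mat q q (\<lambda>(i, k).
       (deriv ^^ (m - 1)) (\<lambda>z. (a_fun q n \<Gamma> z * adj_mat (b_fun q n \<Gamma> z)) $$ (i, k)) v))"

definition Delta_fun :: "nat \<Rightarrow> nat \<Rightarrow> (nat \<Rightarrow> complex mat) \<Rightarrow> complex \<Rightarrow> complex mat" where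
  "Delta_fun q n \<Gamma> z =
     mat q q (\<lambda>(i, k). \<Sum>v\<in>N_set q n \<Gamma>. (v + z) / (v - z) * X_mat q n \<Gamma> v $$ (i, k))"

text \<open>
  The value of the inverse at the finitely many zeros of \<open>det b\<^sub>n\<close> is irrelevant, because
  \<^const>\<open>remove_sings\<close> only depends on punctured neighbourhoods.
\<close>

definition Lambda_fun :: "nat \<Rightarrow> nat \<Rightarrow> (nat \<Rightarrow> complex mat) \<Rightarrow> complex \<Rightarrow> complex mat" where
  "Lambda_fun q n \<Gamma> z = mat q q (\<lambda>(i, k).
     remove_sings (\<lambda>w.
       (a_fun q n \<Gamma> w * the (mat_inverse (b_fun q n \<Gamma> w)) - Delta_fun q n \<Gamma> w) $$ (i, k)) z)"

end

theory Submission
  imports Defs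
begin

text \<open>
  Write \<open>W\<close> for \<open>T\<^bsub>n-1\<^esub>\<^sup>\<dagger> Y\<^sub>n\<close>. Since \<open>T\<^sub>n\<close> is non-negative, \<open>T\<^bsub>n-1\<^esub> W = Y\<^sub>n\<close>, and the choice
  of the central step is precisely the linear recurrence \<open>C\<^sub>m = \<Sum>\<^sub>l C\<^bsub>m-1-l\<^esub> W\<^sub>l\<close>, which keeps all block Toeplitz
  matrices non-negative. Hence the coefficients are bounded, \<open>\<Phi>\<close> has non-negative real part, and
  comparing coefficients gives \<open>\<Phi> b\<^sub>n = a\<^sub>n\<close>, so \<open>\<Phi>\<close> is rational. Boundedness of the coefficients
  gives \<open>\<Phi>(z) = O(1 / (1 - |z|))\<close>, so that the poles of \<open>\<Phi>\<close> on the circle are simple; their residues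
  \<open>- 2 v X\<^sub>v\<close> have \<open>X\<^sub>v\<close> non-negative Hermitian because \<open>Re \<Phi> \<ge> 0\<close>. Subtracting the polar parts leaves a
  function \<open>\<Lambda>\<close> that is analytic on the closed disk, with \<open>Re \<Lambda> = Re \<Phi> \<ge> 0\<close> on the circle outside the poles, and the
  Schwarz integral formula for \<open>\<Lambda>\<close> exhibits the right-hand side as a Riesz--Herglotz measure of \<open>\<Phi>\<close>.
  Such a measure is unique because it is determined by its trigonometric moments.
\<close>

section \<open>Non-negative Hermitian kernels\<close>

text \<open>Toeplitz matrices may be singular, so nothing can be inverted, and each step of the
  continuation involves the pseudoinverse of another, possibly degenerate matrix. The substitute for
  invertibility is \<open>psd_on_kernel_extend\<close>: a vector annihilated by a principal
  submatrix of a non-negative kernel is annihilated by all further rows. It makes the system for W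
  solvable and the next coefficient independent of the solution chosen; this is how the
  pseudoinverses of all later stages are traded for the one of stage \<open>n\<close>. Subtracting
  the polar parts leaves the real part on the circle unchanged because (v + \<zeta>) / (v - \<zeta>)
  is purely imaginary there and X_v is Hermitian. On the measure side, the absolutely continuous and
  the discrete part are merged into one density with respect to arc length plus counting measure on
  the zeros. Arc length does not see the zeros, so the density may take the values X_v there, and
  positivity, countable additivity and the trace measure need only one argument each.\<close>

definition sform :: "('a \<Rightarrow> 'a \<Rightarrow> complex) \<Rightarrow> 'a set \<Rightarrow> ('a \<Rightarrow> complex) \<Rightarrow> ('a \<Rightarrow> complex) \<Rightarrow> complex" where
  "sform K I x y = (\<Sum>r\<in>I. cnj (x r) * (\<Sum>s\<in>I. K r s * y s))"

text \<open>Index sets are arbitrary finite sets, so that principal submatrices, shifted blocks and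
  pairs (block, position in the block) share one theory. Only the real part of the form is
  constrained; the symmetry conjunct is what makes the form real.\<close>

definition psd_on :: "('a \<Rightarrow> 'a \<Rightarrow> complex) \<Rightarrow> 'a set \<Rightarrow> bool" where
  "psd_on K I \<longleftrightarrow> finite I \<and> (\<forall>r\<in>I. \<forall>s\<in>I. K s r = cnj (K r s)) \<and> (\<forall>x. 0 \<le> Re (sform K I x x))"

lemma sform_add_left: "sform K I (\<lambda>r. x r + y r) z = sform K I x z + sform K I y z"
  by (simp add: sform_def distrib_right sum.distrib)

lemma sform_add_right: "sform K I z (\<lambda>r. x r + y r) = sform K I z x + sform K I z y"
  by (simp add: sform_def distrib_left sum.distrib)

lemma sform_hermitian:
  assumes "\<And>r s. r \<in> I \<Longrightarrow> s \<in> I \<Longrightarrow> K s r = cnj (K r s)"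
  shows "sform K I y x = cnj (sform K I x y)"
proof -
  have "sform K I y x = (\<Sum>r\<in>I. \<Sum>s\<in>I. cnj (y r) * K r s * x s)"
    by (simp add: sform_def sum_distrib_left mult.assoc)
  also have "\<dots> = (\<Sum>s\<in>I. \<Sum>r\<in>I. cnj (y r) * K r s * x s)"
    by (rule sum.swap)
  also have "\<dots> = (\<Sum>s\<in>I. \<Sum>r\<in>I. cnj (cnj (x s) * K s r * y r))"
    by (intro sum.cong refl) (simp add: assms[symmetric] mult_ac)
  also have "\<dots> = cnj (sform K I x y)"
    by (simp add: sform_def sum_distrib_left mult.assoc)
  finally show ?thesis .
qed

lemma sform_eq_0:
  assumes "\<And>r. r \<in> I \<Longrightarrow> (\<Sum>s\<in>I. K r s * y s) = 0 \<or> x r = 0"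
  shows "sform K I x y = 0"
  unfolding sform_def using assms by (intro sum.neutral) auto

lemma sform_mono:
  assumes "finite J" "I \<subseteq> J" "\<And>r. r \<in> J - I \<Longrightarrow> x r = 0" "\<And>r. r \<in> J - I \<Longrightarrow> y r = 0"
  shows "sform K J x y = sform K I x y"
proof -
  have "sform K J x y = (\<Sum>r\<in>I. cnj (x r) * (\<Sum>s\<in>J. K r s * y s))"
    unfolding sform_def by (rule sum.mono_neutral_right) (use assms in auto)
  also have "\<dots> = (\<Sum>r\<in>I. cnj (x r) * (\<Sum>s\<in>I. K r s * y s))"
    by (intro sum.cong refl arg_cong2[of _ _ _ _ "(*)"] sum.mono_neutral_right)
      (use assms in auto)
  finally show ?thesis by (simp add: sform_def)
qed

lemma sform_cong:
  assumes "\<And>r. r \<in> I \<Longrightarrow> x r = x' r" "\<And>r. r \<in> I \<Longrightarrow> y r = y' r"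
    "\<And>r s. r \<in> I \<Longrightarrow> s \<in> I \<Longrightarrow> K r s = K' r s"
  shows "sform K I x y = sform K' I x' y'"
  unfolding sform_def using assms by (intro sum.cong refl arg_cong2[of _ _ _ _ "(*)"]) auto

lemma sform_reindex:
  assumes "inj_on f I"
  shows "sform K (f ` I) x y = sform (\<lambda>r s. K (f r) (f s)) I (\<lambda>r. x (f r)) (\<lambda>r. y (f r))"
  unfolding sform_def by (simp only: sum.reindex[OF assms] comp_def)

lemma psd_on_hermitian: "psd_on K I \<Longrightarrow> r \<in> I \<Longrightarrow> s \<in> I \<Longrightarrow> K s r = cnj (K r s)"
  unfolding psd_on_def by blast

lemma psd_on_finite: "psd_on K I \<Longrightarrow> finite I"
  unfolding psd_on_def by blast

lemma psd_on_nonneg: "psd_on K I \<Longrightarrow> 0 \<le> Re (sform K I x x)"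
  unfolding psd_on_def by blast

lemma psd_on_Im: "psd_on K I \<Longrightarrow> Im (sform K I x x) = 0"
  using sform_hermitian[of I K x x] psd_on_hermitian[of K I] by (metis cnj.simps(2) equal_neg_zero)

lemma psd_on_subset:
  assumes "psd_on K J" "I \<subseteq> J"
  shows "psd_on K I"
  unfolding psd_on_def
proof (intro conjI ballI allI)
  show "finite I" using assms psd_on_finite finite_subset by blast
  show "K s r = cnj (K r s)" if "r \<in> I" "s \<in> I" for r s
    by (rule psd_on_hermitian[OF assms(1)]) (use assms(2) that in auto)
  fix x :: "'a \<Rightarrow> complex"
  have "sform K I x x = sform K I (\<lambda>r. if r \<in> I then x r else 0) (\<lambda>r. if r \<in> I then x r else 0)"
    by (rule sform_cong) auto
  also have "\<dots> = sform K J (\<lambda>r. if r \<in> I then x r else 0) (\<lambda>r. if r \<in> I then x r else 0)"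
    by (rule sform_mono[symmetric]) (use assms(2) psd_on_finite[OF assms(1)] in auto)
  finally show "0 \<le> Re (sform K I x x)" using psd_on_nonneg[OF assms(1)] by simp
qed

lemma psd_on_reindex:
  assumes "inj_on f I"
  shows "psd_on K (f ` I) \<longleftrightarrow> psd_on (\<lambda>r s. K (f r) (f s)) I"
proof -
  have "(\<forall>x. 0 \<le> Re (sform K (f ` I) x x)) \<longleftrightarrow>
      (\<forall>x. 0 \<le> Re (sform (\<lambda>r s. K (f r) (f s)) I x x))" (is "?L \<longleftrightarrow> ?R")
  proof
    assume ?L
    show ?R
    proof
      fix x
      have "sform (\<lambda>r s. K (f r) (f s)) I x x = sform K (f ` I) (x \<circ> inv_into I f) (x \<circ> inv_into I f)"
        unfolding sform_reindex[OF assms]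
        by (rule sform_cong) (use assms in auto)
      then show "0 \<le> Re (sform (\<lambda>r s. K (f r) (f s)) I x x)" using \<open>?L\<close> by simp
    qed
  qed (simp add: sform_reindex[OF assms])
  moreover have "(\<forall>r\<in>f ` I. \<forall>s\<in>f ` I. K s r = cnj (K r s)) \<longleftrightarrow>
      (\<forall>r\<in>I. \<forall>s\<in>I. K (f s) (f r) = cnj (K (f r) (f s)))"
    by blast
  ultimately show ?thesis by (simp only: psd_on_def finite_image_iff[OF assms])
qed

lemma psd_on_cong:
  assumes "\<And>r s. r \<in> I \<Longrightarrow> s \<in> I \<Longrightarrow> K r s = K' r s"
  shows "psd_on K I \<longleftrightarrow> psd_on K' I"
proof -
  have "sform K I x x = sform K' I x x" for x
    by (rule sform_cong) (use assms in auto)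
  moreover have "(\<forall>r\<in>I. \<forall>s\<in>I. K s r = cnj (K r s)) \<longleftrightarrow> (\<forall>r\<in>I. \<forall>s\<in>I. K' s r = cnj (K' r s))"
    using assms by (intro ball_cong refl) metis
  ultimately show ?thesis by (simp only: psd_on_def)
qed

lemma sform_single:
  assumes "finite I" "r \<in> I"
  shows "sform K I (\<lambda>s. if s = r then a else 0) y = cnj a * (\<Sum>s\<in>I. K r s * y s)"
    and "sform K I x (\<lambda>s. if s = r then a else 0) = (\<Sum>s\<in>I. cnj (x s) * K s r) * a"
proof -
  have "sform K I (\<lambda>s. if s = r then a else 0) y =
      (\<Sum>s\<in>I. if s = r then cnj a * (\<Sum>t\<in>I. K s t * y t) else 0)"
    unfolding sform_def by (intro sum.cong) auto
  then show "sform K I (\<lambda>s. if s = r then a else 0) y = cnj a * (\<Sum>s\<in>I. K r s * y s)"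
    using assms by simp
  have "(\<Sum>s\<in>I. K t s * (if s = r then a else 0)) = K t r * a" for t
  proof -
    have "(\<Sum>s\<in>I. K t s * (if s = r then a else 0)) = (\<Sum>s\<in>I. if s = r then K t s * a else 0)"
      by (intro sum.cong) auto
    then show ?thesis using assms by simp
  qed
  then show "sform K I x (\<lambda>s. if s = r then a else 0) = (\<Sum>s\<in>I. cnj (x s) * K s r) * a"
    by (simp add: sform_def sum_distrib_right mult.assoc)
qed

text \<open>If coordinate \<open>r\<close> of the image of \<open>x\<close> were d \<noteq> 0,
  moving \<open>x\<close> by -t d in that coordinate would change the form by -2 t |d|^2 + t^2 |d|^2
  \<open>K r r\<close>, which is negative for small t > 0.\<close>

lemma psd_on_zero:
  assumes psd: "psd_on K I" and zero: "Re (sform K I x x) \<le> 0" and r: "r \<in> I"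
  shows "(\<Sum>s\<in>I. K r s * x s) = 0"
proof (rule ccontr)
  define d where "d = (\<Sum>s\<in>I. K r s * x s)"
  define k where "k = Re (K r r)"
  assume "\<not> ?thesis"
  then have d: "d \<noteq> 0" by (simp add: d_def)
  have fin: "finite I" using psd by (rule psd_on_finite)
  \<comment> \<open>Small enough that t k < 1 whatever the sign of \<open>k\<close>; the final
    factor t k - 2 is then negative.\<close>
  define t where "t = 1 / (\<bar>k\<bar> + 1)"
  have t: "t > 0" "t * k < 1"
  proof -
    have "k < \<bar>k\<bar> + 1" by simp
    then show "t * k < 1" by (simp add: t_def pos_divide_less_eq)
  qed (simp add: t_def)
  define e where "e = (\<lambda>s. if s = r then - (of_real t * d) else 0)"
  have "sform K I x e = cnj (sform K I e x)"
    by (rule sform_hermitian) (rule psd_on_hermitian[OF psd])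
  then have "sform K I (\<lambda>s. x s + e s) (\<lambda>s. x s + e s) =
     sform K I x x + sform K I e x + cnj (sform K I e x) + sform K I e e"
    by (simp add: sform_add_left sform_add_right)
  moreover have dd: "cnj d * d = (of_real (cmod d))\<^sup>2"
    by (simp add: complex_norm_square[symmetric] mult.commute flip: of_real_power)
  then have "sform K I e x = - (of_real (t * (cmod d)\<^sup>2))"
    unfolding e_def sform_single(1)[OF fin r] d_def[symmetric]
    by (simp add: mult.assoc)
  moreover have "(\<Sum>s\<in>I. cnj (e s) * K s r) = (\<Sum>s\<in>I. if s = r then cnj (e r) * K r r else 0)"
    by (intro sum.cong) (auto simp: e_def)
  then have "sform K I e e = cnj (e r) * K r r * e r"
    using sform_single(2)[OF fin r, of K e "- (of_real t * d)"] fin r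
    by (simp add: e_def)
  then have "sform K I e e = of_real (t\<^sup>2 * (cmod d)\<^sup>2) * K r r"
  proof -
    have "cnj (e r) * K r r * e r = of_real (t\<^sup>2) * (cnj d * d) * K r r"
      by (simp add: e_def power2_eq_square mult_ac)
    then show ?thesis using \<open>sform K I e e = _\<close> by (simp add: dd)
  qed
  ultimately have "Re (sform K I (\<lambda>s. x s + e s) (\<lambda>s. x s + e s)) =
      Re (sform K I x x) - 2 * (t * (cmod d)\<^sup>2) + t\<^sup>2 * (cmod d)\<^sup>2 * k"
    by (simp add: k_def)
  also have "\<dots> \<le> t * (cmod d)\<^sup>2 * (t * k - 2)"
    using zero by (simp add: algebra_simps power2_eq_square)
  also have "\<dots> < 0"
    using t d by (intro mult_pos_neg) auto
  finally show False using psd_on_nonneg[OF psd] by (simp add: not_le[symmetric])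
qed

text \<open>Extended by zero to \<open>J\<close>, the vector has form value 0, and a vector of form
  value 0 lies in the kernel by \<open>psd_on_zero\<close>. This is used wherever an invertible
  Toeplitz matrix would allow a direct computation.\<close>

lemma psd_on_kernel_extend:
  assumes psd: "psd_on K J" and "I \<subseteq> J" and "\<And>r. r \<in> I \<Longrightarrow> (\<Sum>s\<in>I. K r s * x s) = 0" and r: "r \<in> J"
  shows "(\<Sum>s\<in>I. K r s * x s) = 0"
proof -
  have fin: "finite J" using psd by (rule psd_on_finite)
  define y where "y = (\<lambda>s. if s \<in> I then x s else 0)"
  have sum_y: "(\<Sum>s\<in>J. K r s * y s) = (\<Sum>s\<in>I. K r s * x s)" for r
  proof -
    have "(\<Sum>s\<in>J. K r s * y s) = (\<Sum>s\<in>I. K r s * y s)"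
      by (rule sum.mono_neutral_right) (use assms fin in \<open>auto simp: y_def\<close>)
    then show ?thesis by (simp add: y_def)
  qed
  have "sform K J y y = 0"
    by (rule sform_eq_0) (use assms(3) sum_y in \<open>auto simp: y_def\<close>)
  then have "(\<Sum>s\<in>J. K r s * y s) = 0"
    by (intro psd_on_zero[OF psd _ r]) simp
  then show ?thesis by (simp add: sum_y)
qed

text \<open>A two-by-two principal submatrix is tested on the vector (1, l) with l of modulus one.
  The bound is weaker than Cauchy-Schwarz, but linear in the diagonal, and it forces all entries to
  vanish when the diagonal does.\<close>

lemma psd_on_entry_bound:
  assumes psd: "psd_on K I" and r: "r \<in> I" and s: "s \<in> I"
  shows "cmod (K r s) \<le> Re (K r r) + Re (K s s)"
proof -
  have diag: "0 \<le> Re (K t t)" if "t \<in> I" for t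
  proof -
    have "psd_on K {t}" using psd that by (auto intro: psd_on_subset)
    then have "0 \<le> Re (sform K {t} (\<lambda>_. 1) (\<lambda>_. 1))" by (rule psd_on_nonneg)
    then show ?thesis by (simp add: sform_def)
  qed
  show ?thesis
  proof (cases "r = s")
    case True
    have "K r r = cnj (K r r)" using psd r by (rule psd_on_hermitian) fact
    then have "K r r = of_real (Re (K r r))" by (simp add: complex_eq_iff)
    then have "cmod (K r r) = \<bar>Re (K r r)\<bar>" by (metis norm_of_real)
    then show ?thesis using True diag[OF r] by simp
  next
    case False
    have p: "psd_on K {r, s}" using psd r s by (auto intro: psd_on_subset)
    \<comment> \<open>Chosen so that \<open>K r s * l\<close> is minus the modulus of
      \<open>K r s\<close>. If the entry is 0 then \<open>sgn\<close> gives \<open>l = 0\<close>,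
      and the same equation holds.\<close>
    define l where "l = - cnj (sgn (K r s))"
    have h: "K s r = cnj (K r s)" using psd r s by (rule psd_on_hermitian)
    have l2: "cnj l * l = (if K r s = 0 then 0 else 1)"
      by (auto simp: l_def sgn_eq complex_norm_square[symmetric] divide_simps power2_eq_square mult.commute[of "cnj _"])
    have kl: "K r s * l = - of_real (cmod (K r s))"
      by (auto simp: l_def sgn_eq complex_norm_square[symmetric] divide_simps power2_eq_square)
    have "0 \<le> Re (sform K {r, s} (\<lambda>t. if t = r then 1 else l) (\<lambda>t. if t = r then 1 else l))"
      using p by (rule psd_on_nonneg)
    also have "sform K {r, s} (\<lambda>t. if t = r then 1 else l) (\<lambda>t. if t = r then 1 else l) =
        K r r + K r s * l + cnj (K r s * l) + cnj l * l * K s s"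
      using False by (simp add: sform_def h algebra_simps)
    finally have "0 \<le> Re (K r r) - 2 * cmod (K r s) + Re (cnj l * l * K s s)"
      by (simp only: kl) simp
    also have "Re (cnj l * l * K s s) \<le> Re (K s s)"
      using diag[OF s] by (simp only: l2) auto
    finally show ?thesis using norm_ge_zero[of "K r s"] by linarith
  qed
qed

text \<open>
  The vectors \<open>u - W u\<close>, supported on \<open>A \<union> M\<close>, are mapped by the kernel into \<open>A\<close>. Hence they are
  orthogonal to the vectors supported on \<open>M \<union> B\<close>, and the form splits into two non-negative parts.
\<close>
lemma psd_on_schur_step:
  assumes AM: "psd_on K (A \<union> M)" and MB: "psd_on K (M \<union> B)"
    and disj: "A \<inter> M = {}" "A \<inter> B = {}" "M \<inter> B = {}"
    and herm: "\<And>r s. r \<in> A \<union> M \<union> B \<Longrightarrow> s \<in> A \<union> M \<union> B \<Longrightarrow> K s r = cnj (K r s)"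
    and W: "\<And>r a. r \<in> M \<union> B \<Longrightarrow> a \<in> A \<Longrightarrow> K r a = (\<Sum>s\<in>M. K r s * W s a)"
  shows "psd_on K (A \<union> M \<union> B)"
  unfolding psd_on_def
proof (intro conjI ballI allI)
  have finA: "finite A" and finM: "finite M" and finB: "finite B"
    using psd_on_finite[OF AM] psd_on_finite[OF MB] by auto
  show "finite (A \<union> M \<union> B)" using finA finM finB by simp
  show "K s r = cnj (K r s)" if "r \<in> A \<union> M \<union> B" "s \<in> A \<union> M \<union> B" for r s
    using herm that .
  fix x :: "'a \<Rightarrow> complex"
  let ?J = "A \<union> M \<union> B"
  define y where "y = (\<lambda>s. if s \<in> A then x s else if s \<in> M then - (\<Sum>a\<in>A. W s a * x a) else 0)"
  define z where "z = (\<lambda>s. x s - y s)"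
  have Ky: "(\<Sum>s\<in>?J. K r s * y s) = 0" if r: "r \<in> M \<union> B" for r
  proof -
    have "(\<Sum>s\<in>?J. K r s * y s) = (\<Sum>s\<in>A \<union> M. K r s * y s)"
      by (rule sum.mono_neutral_right) (use finA finM finB disj in \<open>auto simp: y_def\<close>)
    also have "\<dots> = (\<Sum>s\<in>A. K r s * y s) + (\<Sum>s\<in>M. K r s * y s)"
      by (rule sum.union_disjoint) (use finA finM disj in auto)
    also have "(\<Sum>s\<in>A. K r s * y s) = (\<Sum>a\<in>A. \<Sum>s\<in>M. K r s * W s a * x a)"
      by (intro sum.cong) (auto simp: y_def W[OF r] sum_distrib_right)
    also have "\<dots> = (\<Sum>s\<in>M. \<Sum>a\<in>A. K r s * W s a * x a)"
      by (rule sum.swap)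
    also have "(\<Sum>s\<in>M. K r s * y s) = (\<Sum>s\<in>M. - (\<Sum>a\<in>A. K r s * W s a * x a))"
      using disj by (intro sum.cong) (auto simp: y_def sum_distrib_left mult.assoc)
    finally show ?thesis by (simp add: sum_negf)
  qed
  have zy: "sform K ?J z y = 0"
    by (rule sform_eq_0) (use Ky in \<open>auto simp: z_def y_def\<close>)
  moreover have "sform K ?J y z = cnj (sform K ?J z y)"
    by (rule sform_hermitian) (rule herm)
  ultimately have yz: "sform K ?J y z = 0" by simp
  have "sform K ?J x x = sform K ?J (\<lambda>s. y s + z s) (\<lambda>s. y s + z s)"
    by (simp add: z_def)
  also have "\<dots> = sform K ?J y y + sform K ?J z z"
    by (simp add: sform_add_left sform_add_right zy yz)
  also have "sform K ?J y y = sform K (A \<union> M) y y"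
    by (rule sform_mono) (use finA finM finB disj in \<open>auto simp: y_def\<close>)
  also have "sform K ?J z z = sform K (M \<union> B) z z"
    by (rule sform_mono) (use finA finM finB disj in \<open>auto simp: y_def z_def\<close>)
  finally show "0 \<le> Re (sform K ?J x x)"
    using psd_on_nonneg[OF AM] psd_on_nonneg[OF MB] by simp
qed

text \<open>This Fredholm alternative is proved by eliminating one index at a time.\<close>
lemma psd_on_solve:
  assumes "psd_on K I"
    and "\<And>w. (\<And>r. r \<in> I \<Longrightarrow> (\<Sum>s\<in>I. K r s * w s) = 0) \<Longrightarrow> (\<Sum>r\<in>I. cnj (w r) * b r) = 0"
  shows "\<exists>u. \<forall>r\<in>I. (\<Sum>s\<in>I. K r s * u s) = b r"
proof -
  have "finite I" using assms(1) by (rule psd_on_finite)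
  then show ?thesis using assms
  proof (induction I arbitrary: b rule: finite_induct)
    case (insert j I)
    note psd = insert.prems(1)
    have psdI: "psd_on K I" using psd by (rule psd_on_subset) auto
    have ext: "(\<Sum>s\<in>I. K j s * w s) = 0" if "\<And>r. r \<in> I \<Longrightarrow> (\<Sum>s\<in>I. K r s * w s) = 0" for w
      by (rule psd_on_kernel_extend[OF psd]) (use that in auto)
    have hI: "K s r = cnj (K r s)" if "r \<in> insert j I" "s \<in> insert j I" for r s
      using psd_on_hermitian[OF psd that] .
    have "(\<Sum>r\<in>I. cnj (w r) * K r j) = 0" if "\<And>r. r \<in> I \<Longrightarrow> (\<Sum>s\<in>I. K r s * w s) = 0" for w
    proof -
      have "(\<Sum>r\<in>I. cnj (w r) * K r j) = (\<Sum>r\<in>I. cnj (K j r * w r))"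
        by (intro sum.cong refl) (simp add: hI[of j] mult.commute)
      also have "\<dots> = cnj (\<Sum>r\<in>I. K j r * w r)" by simp
      finally show ?thesis using ext[of w] that by simp
    qed
    then obtain W where W: "\<And>r. r \<in> I \<Longrightarrow> (\<Sum>s\<in>I. K r s * W s) = K r j"
      using insert.IH[OF psdI, of "\<lambda>r. K r j"] by blast
    have "(\<Sum>r\<in>I. cnj (w r) * b r) = 0" if w: "\<And>r. r \<in> I \<Longrightarrow> (\<Sum>s\<in>I. K r s * w s) = 0" for w
    proof -
      let ?w = "\<lambda>s. if s = j then 0 else w s"
      have "(\<Sum>s\<in>insert j I. K r s * ?w s) = (\<Sum>s\<in>I. K r s * w s)" for r
        using insert.hyps by (auto intro!: sum.cong)
      then have "(\<Sum>r\<in>insert j I. cnj (?w r) * b r) = 0"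
        using w ext[of w] by (intro insert.prems(2)) auto
      also have "(\<Sum>r\<in>insert j I. cnj (?w r) * b r) = (\<Sum>r\<in>I. cnj (w r) * b r)"
        using insert.hyps by (auto intro!: sum.cong)
      finally show ?thesis .
    qed
    then obtain u where u: "\<And>r. r \<in> I \<Longrightarrow> (\<Sum>s\<in>I. K r s * u s) = b r"
      using insert.IH[OF psdI, of b] by blast
    \<comment> \<open>The Schur complement of the block \<open>I\<close>. The vectors
      \<open>u - d W\<close> with entry \<open>d\<close> at \<open>j\<close> solve all rows of
      \<open>I\<close> for every \<open>d\<close>, and row \<open>j\<close> changes by \<sigma> d;
      for \<sigma> \<noteq> 0 the constant \<open>c\<close> corrects the remaining defect.\<close>
    define \<sigma> where "\<sigma> = K j j - (\<Sum>s\<in>I. K j s * W s)"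
    define c where "c = (b j - (\<Sum>s\<in>I. K j s * u s)) / \<sigma>"
    have expand: "(\<Sum>s\<in>insert j I. K r s * (if s = j then d else u s - d * W s)) =
        (\<Sum>s\<in>I. K r s * u s) + d * (K r j - (\<Sum>s\<in>I. K r s * W s))" for r d
    proof -
      have "(\<Sum>s\<in>insert j I. K r s * (if s = j then d else u s - d * W s)) =
          K r j * d + (\<Sum>s\<in>I. K r s * (u s - d * W s))"
        using insert.hyps by (auto intro!: sum.cong)
      also have "(\<Sum>s\<in>I. K r s * (u s - d * W s)) = (\<Sum>s\<in>I. K r s * u s) - d * (\<Sum>s\<in>I. K r s * W s)"
        by (simp add: right_diff_distrib sum_subtractf sum_distrib_left mult_ac)
      finally show ?thesis by (simp add: algebra_simps)
    qed
    have I_rows: "(\<Sum>s\<in>insert j I. K r s * (if s = j then d else u s - d * W s)) = b r"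
      if "r \<in> I" for r d
      using expand[of r d] W[OF that] u[OF that] by simp
    have witness: ?case
      if "(\<Sum>s\<in>insert j I. K j s * (if s = j then d else u s - d * W s)) = b j" for d
      using I_rows[of _ d] that
      by (intro exI[of _ "\<lambda>s. if s = j then d else u s - d * W s"] ballI, elim insertE) (simp only:)+
    show ?case
    proof (cases "\<sigma> = 0")
      case False
      have "(\<Sum>s\<in>insert j I. K j s * (if s = j then c else u s - c * W s)) = b j"
        unfolding expand using False by (simp add: c_def \<sigma>_def)
      then show ?thesis by (rule witness)
    next
      \<comment> \<open>Now (1, -W) lies in the kernel of the enlarged system, so the orthogonality
        hypothesis on \<open>b\<close> applies to it and says exactly that row \<open>j\<close>
        already holds for d = 0.\<close>
      case True
      let ?y = "\<lambda>s. if s = j then 1 else - W s"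
      have "(\<Sum>s\<in>insert j I. K r s * ?y s) = K r j - (\<Sum>s\<in>I. K r s * W s)" for r
      proof -
        have "(\<Sum>s\<in>insert j I. K r s * ?y s) = K r j + (\<Sum>s\<in>I. K r s * (- W s))"
          using insert.hyps by (auto intro!: sum.cong)
        then show ?thesis by (simp add: sum_negf)
      qed
      then have "(\<Sum>r\<in>insert j I. cnj (?y r) * b r) = 0"
        using W True by (intro insert.prems(2)) (auto simp: \<sigma>_def)
      also have "(\<Sum>r\<in>insert j I. cnj (?y r) * b r) = b j + (\<Sum>r\<in>I. cnj (- W r) * b r)"
        using insert.hyps by (auto intro!: sum.cong)
      also have "(\<Sum>r\<in>I. cnj (- W r) * b r) = - (\<Sum>r\<in>I. cnj (W r) * b r)"
        by (simp add: sum_negf)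
      finally have "b j = (\<Sum>r\<in>I. cnj (W r) * b r)" by simp
      also have "\<dots> = sform K I W u"
        unfolding sform_def using u by simp
      also have "\<dots> = cnj (sform K I u W)"
          by (rule sform_hermitian) (rule hI, auto)
      also have "\<dots> = (\<Sum>r\<in>I. u r * cnj (K r j))"
        unfolding sform_def using W by simp
      also have "\<dots> = (\<Sum>r\<in>I. K j r * u r)"
        by (intro sum.cong refl) (simp add: hI[of j] mult.commute)
      finally have "(\<Sum>s\<in>insert j I. K j s * (if s = j then 0 else u s - 0 * W s)) = b j"
        unfolding expand by simp
      then show ?thesis by (rule witness)
    qed
  qed simp
qed

section \<open>Moore--Penrose inverses\<close>

lemma mat_adjoint_dim [simp]:
  "dim_row (mat_adjoint A) = dim_col A" "dim_col (mat_adjoint A) = dim_row A"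
  by (auto simp: mat_adjoint_def)

lemma mat_adjoint_carrier [simp]: "A \<in> carrier_mat n m \<Longrightarrow> mat_adjoint A \<in> carrier_mat m n"
  by (intro carrier_matI) auto

lemma mat_adjoint_index [simp]:
  fixes A :: "complex mat"
  assumes "i < dim_col A" "j < dim_row A"
  shows "mat_adjoint A $$ (i, j) = cnj (A $$ (j, i))"
  using assms by (simp add: mat_adjoint_def mat_of_rows_index)

lemma mat_mult_index:
  assumes "A \<in> carrier_mat n m" "B \<in> carrier_mat m p" "i < n" "j < p"
  shows "(A * B) $$ (i, j) = (\<Sum>k<m. A $$ (i, k) * B $$ (k, j))"
  using assms by (auto simp: scalar_prod_def atLeast0LessThan intro!: sum.cong)

lemma mat_adjoint_mult:
  fixes A B :: "complex mat"
  assumes "A \<in> carrier_mat n m" "B \<in> carrier_mat m p"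
  shows "mat_adjoint (A * B) = mat_adjoint B * mat_adjoint A"
proof (rule eq_matI)
  show "dim_row (mat_adjoint (A * B)) = dim_row (mat_adjoint B * mat_adjoint A)"
    "dim_col (mat_adjoint (A * B)) = dim_col (mat_adjoint B * mat_adjoint A)"
    using assms by auto
  fix i j assume "i < dim_row (mat_adjoint B * mat_adjoint A)" "j < dim_col (mat_adjoint B * mat_adjoint A)"
  then have ij: "i < p" "j < n" using assms by auto
  have AB: "A * B \<in> carrier_mat n p" using assms by simp
  have "mat_adjoint (A * B) $$ (i, j) = cnj ((A * B) $$ (j, i))"
    using ij AB by (intro mat_adjoint_index) auto
  also have "\<dots> = (\<Sum>k<m. mat_adjoint B $$ (i, k) * mat_adjoint A $$ (k, j))"
    unfolding mat_mult_index[OF assms ij(2,1)] using assms ij by (auto simp: mult.commute intro!: sum.cong)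
  also have "\<dots> = (mat_adjoint B * mat_adjoint A) $$ (i, j)"
    using assms ij by (intro mat_mult_index[symmetric]) auto
  finally show "mat_adjoint (A * B) $$ (i, j) = (mat_adjoint B * mat_adjoint A) $$ (i, j)" .
qed

lemma quadratic_form_eq_sform:
  assumes "A \<in> carrier_mat N N" "x \<in> carrier_vec N"
  shows "(A *\<^sub>v x) \<bullet>c x = sform (\<lambda>r s. A $$ (r, s)) {..<N} (\<lambda>r. x $ r) (\<lambda>r. x $ r)"
  using assms
  by (auto simp: sform_def scalar_prod_def atLeast0LessThan mult.commute intro!: sum.cong)

lemma nonneg_hermitian_iff_psd_on:
  assumes A: "A \<in> carrier_mat N N"
  shows "nonneg_hermitian N A \<longleftrightarrow> psd_on (\<lambda>r s. A $$ (r, s)) {..<N}"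
proof -
  let ?K = "\<lambda>r s. A $$ (r, s)"
  have adj: "mat_adjoint A = A \<longleftrightarrow> (\<forall>r\<in>{..<N}. \<forall>s\<in>{..<N}. ?K s r = cnj (?K r s))" (is "_ \<longleftrightarrow> ?H")
  proof
    assume *: "mat_adjoint A = A"
    show ?H
    proof (intro ballI)
      fix r s assume "r \<in> {..<N}" "s \<in> {..<N}"
      then have "mat_adjoint A $$ (s, r) = cnj (A $$ (r, s))"
        using A by (intro mat_adjoint_index) auto
      then show "A $$ (s, r) = cnj (A $$ (r, s))" by (simp only: *)
    qed
  next
    assume *: ?H
    show "mat_adjoint A = A"
    proof (rule eq_matI)
      fix i j assume "i < dim_row A" "j < dim_col A"
      moreover from this have "A $$ (i, j) = cnj (A $$ (j, i))"
        using * A by blast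
      ultimately show "mat_adjoint A $$ (i, j) = A $$ (i, j)"
        using A by (subst mat_adjoint_index) auto
    qed (use A in auto)
  qed
  have "(\<forall>x\<in>carrier_vec N. 0 \<le> (A *\<^sub>v x) \<bullet>c x) \<longleftrightarrow> (\<forall>x. 0 \<le> Re (sform ?K {..<N} x x))" if ?H
  proof
    assume *: "\<forall>x\<in>carrier_vec N. 0 \<le> (A *\<^sub>v x) \<bullet>c x"
    show "\<forall>x. 0 \<le> Re (sform ?K {..<N} x x)"
    proof
      fix x
      have "sform ?K {..<N} x x = sform ?K {..<N} (\<lambda>r. vec N x $ r) (\<lambda>r. vec N x $ r)"
        by (rule sform_cong) auto
      also have "\<dots> = (A *\<^sub>v vec N x) \<bullet>c vec N x"
        by (rule quadratic_form_eq_sform[symmetric]) (use A in auto)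
      finally show "0 \<le> Re (sform ?K {..<N} x x)"
        using * by (simp add: less_eq_complex_def)
    qed
  next
    assume *: "\<forall>x. 0 \<le> Re (sform ?K {..<N} x x)"
    show "\<forall>x\<in>carrier_vec N. 0 \<le> (A *\<^sub>v x) \<bullet>c x"
    proof
      fix x :: "complex vec" assume x: "x \<in> carrier_vec N"
      let ?v = "sform ?K {..<N} (\<lambda>r. x $ r) (\<lambda>r. x $ r)"
      have "?v = cnj ?v"
        by (rule sform_hermitian) (use that in blast)
      then have "Im ?v = 0" by (simp add: complex_eq_iff)
      then show "0 \<le> (A *\<^sub>v x) \<bullet>c x"
        using * by (simp add: quadratic_form_eq_sform[OF A x] less_eq_complex_def)
    qed
  qed
  then show ?thesis
    unfolding nonneg_hermitian_def psd_on_def adj using A finite_lessThan[of N] by blast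
qed

definition is_moore_penrose :: "complex mat \<Rightarrow> complex mat \<Rightarrow> bool" where
  "is_moore_penrose A X \<longleftrightarrow> X \<in> carrier_mat (dim_col A) (dim_row A) \<and>
     A * X * A = A \<and> X * A * X = X \<and>
     mat_adjoint (A * X) = A * X \<and> mat_adjoint (X * A) = X * A"

text \<open>Both \<open>A * X\<close> and \<open>A * Y\<close> are the orthogonal projection onto
  the range of \<open>A\<close>: taking adjoints in A X = (A Y)(A X) reverses the factors and gives
  A X = A Y. The same works on the other side, and then X = X A X = Y A Y = Y.\<close>

lemma is_moore_penrose_unique:
  assumes "is_moore_penrose A X" "is_moore_penrose A Y"
  shows "X = Y"
proof -
  define n m where "n = dim_row A" and "m = dim_col A"
  have A: "A \<in> carrier_mat n m" by (simp add: n_def m_def)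
  have X: "X \<in> carrier_mat m n" and Y: "Y \<in> carrier_mat m n"
    using assms by (auto simp: is_moore_penrose_def n_def m_def)
  have AX: "A * X = A * Y"
  proof -
    have "A * X = (A * Y * A) * X" using assms by (simp add: is_moore_penrose_def)
    also have "\<dots> = (A * Y) * (A * X)"
      using A X Y by (intro assoc_mult_mat[of _ n n _ m _ n]) auto
    finally have "mat_adjoint (A * X) = mat_adjoint ((A * Y) * (A * X))" by simp
    also have "\<dots> = mat_adjoint (A * X) * mat_adjoint (A * Y)"
      by (rule mat_adjoint_mult[of _ n n _ n]) (use A X Y in auto)
    finally have "A * X = (A * X) * (A * Y)" using assms by (simp add: is_moore_penrose_def)
    also have "\<dots> = (A * X * A) * Y"
      using A X Y by (intro assoc_mult_mat[symmetric, of _ n n _ m _ n]) auto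
    finally show ?thesis using assms by (simp add: is_moore_penrose_def)
  qed
  have XA: "X * A = Y * A"
  proof -
    have "X * A = X * (A * Y * A)" using assms by (simp add: is_moore_penrose_def)
    also have "\<dots> = X * (A * (Y * A))"
      using A Y by (subst assoc_mult_mat[of A n m Y n A m]) auto
    also have "\<dots> = (X * A) * (Y * A)"
      using A X Y by (intro assoc_mult_mat[symmetric, of _ m n _ m _ m]) auto
    finally have "mat_adjoint (X * A) = mat_adjoint ((X * A) * (Y * A))" by simp
    also have "\<dots> = mat_adjoint (Y * A) * mat_adjoint (X * A)"
      by (rule mat_adjoint_mult[of _ m m _ m]) (use A X Y in auto)
    finally have "X * A = (Y * A) * (X * A)" using assms by (simp add: is_moore_penrose_def)
    also have "\<dots> = Y * (A * (X * A))"
      using A X Y by (intro assoc_mult_mat[of _ m n _ m _ m]) auto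
    also have "A * (X * A) = A * X * A"
      using A X by (intro assoc_mult_mat[symmetric, of _ n m _ n _ m]) auto
    finally show ?thesis using assms by (simp add: is_moore_penrose_def)
  qed
  have "X = X * A * X" using assms by (simp add: is_moore_penrose_def)
  also have "\<dots> = Y * A * X" by (simp only: XA)
  also have "\<dots> = Y * (A * X)" using A X Y by (intro assoc_mult_mat[of _ m n _ m _ n]) auto
  also have "\<dots> = Y * (A * Y)" by (simp only: AX)
  also have "\<dots> = Y * A * Y" using A Y by (intro assoc_mult_mat[symmetric, of _ m n _ m _ n]) auto
  also have "\<dots> = Y" using assms by (simp add: is_moore_penrose_def)
  finally show ?thesis .
qed

text \<open>
  The kernels of a Hermitian matrix \<open>T\<close> and of \<open>T\<^sup>2\<close> agree, so \<open>T\<^sup>2 U = T\<close> is solvable; then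
  \<open>E = T U\<close> is the orthogonal projection onto the range of \<open>T\<close> and \<open>E U E\<close> is the inverse.
\<close>
lemma is_moore_penrose_exists:
  assumes "nonneg_hermitian N T"
  shows "\<exists>X. is_moore_penrose T X"
proof -
  have T: "T \<in> carrier_mat N N" and adjT: "mat_adjoint T = T"
    using assms by (auto simp: nonneg_hermitian_def)
  let ?K = "\<lambda>r s. T $$ (r, s)"
  have psdT: "psd_on ?K {..<N}" using assms T by (simp add: nonneg_hermitian_iff_psd_on)
  have hT: "T $$ (s, r) = cnj (T $$ (r, s))" if "r < N" "s < N" for r s
    using psd_on_hermitian[OF psdT, of r s] that by simp
  define S where "S = T * T"
  have S: "S \<in> carrier_mat N N" using T by (simp add: S_def)
  let ?KS = "\<lambda>r s. S $$ (r, s)"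
  have KSx: "(\<Sum>s<N. S $$ (r, s) * x s) = (\<Sum>p<N. T $$ (r, p) * (\<Sum>s<N. T $$ (p, s) * x s))"
    if "r < N" for r x
  proof -
    have "(\<Sum>s<N. S $$ (r, s) * x s) = (\<Sum>s<N. \<Sum>p<N. T $$ (r, p) * (T $$ (p, s) * x s))"
      using that
      by (auto simp: S_def mat_mult_index[OF T T] sum_distrib_right mult.assoc intro!: sum.cong)
    also have "\<dots> = (\<Sum>p<N. \<Sum>s<N. T $$ (r, p) * (T $$ (p, s) * x s))"
      by (rule sum.swap)
    finally show ?thesis by (simp add: sum_distrib_left)
  qed
  \<comment> \<open>Since \<open>T\<close> is Hermitian, the form of its square at \<open>x\<close>
    is the squared norm of the image of \<open>x\<close> under \<open>T\<close>. So the square is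
    non-negative, and its kernel is annihilated by \<open>T\<close>, which is the solvability
    condition for the columns of \<open>T\<close>.\<close>
  have normsq: "sform ?KS {..<N} x x = of_real (\<Sum>p<N. (cmod (\<Sum>s<N. T $$ (p, s) * x s))\<^sup>2)" for x
  proof -
    have "sform ?KS {..<N} x x = (\<Sum>r<N. \<Sum>p<N. cnj (x r) * T $$ (r, p) * (\<Sum>s<N. T $$ (p, s) * x s))"
      unfolding sform_def by (intro sum.cong refl) (simp add: KSx sum_distrib_left mult.assoc)
    also have "\<dots> = (\<Sum>p<N. \<Sum>r<N. cnj (x r) * T $$ (r, p) * (\<Sum>s<N. T $$ (p, s) * x s))"
      by (rule sum.swap)
    also have "\<dots> = (\<Sum>p<N. cnj (\<Sum>r<N. T $$ (p, r) * x r) * (\<Sum>s<N. T $$ (p, s) * x s))"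
    proof (rule sum.cong[OF refl])
      fix p assume "p \<in> {..<N}"
      then have "cnj (x r) * T $$ (r, p) = cnj (T $$ (p, r) * x r)" if "r < N" for r
        by (simp only: complex_cnj_mult hT[OF that, of p] mult.commute complex_cnj_cnj \<open>p \<in> {..<N}\<close>[unfolded lessThan_iff])
      then have "(\<Sum>r<N. cnj (x r) * T $$ (r, p)) = cnj (\<Sum>r<N. T $$ (p, r) * x r)"
        unfolding cnj_sum by (intro sum.cong) auto
      then show "(\<Sum>r<N. cnj (x r) * T $$ (r, p) * (\<Sum>s<N. T $$ (p, s) * x s)) =
          cnj (\<Sum>r<N. T $$ (p, r) * x r) * (\<Sum>s<N. T $$ (p, s) * x s)"
        by (simp only: sum_distrib_right[symmetric])
    qed
    also have "\<dots> = (\<Sum>p<N. of_real ((cmod (\<Sum>s<N. T $$ (p, s) * x s))\<^sup>2))"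
      by (intro sum.cong refl) (simp only: complex_norm_square mult.commute)
    finally show ?thesis by simp
  qed
  have psdS: "psd_on ?KS {..<N}"
    unfolding psd_on_def
  proof (intro conjI ballI allI)
    fix r s assume rs: "r \<in> {..<N}" "s \<in> {..<N}"
    have "mat_adjoint S = S" unfolding S_def by (simp only: mat_adjoint_mult[OF T T] adjT)
    moreover have "mat_adjoint S $$ (s, r) = cnj (S $$ (r, s))"
      using rs S by (intro mat_adjoint_index) auto
    ultimately show "?KS s r = cnj (?KS r s)" by simp
  qed (simp_all add: normsq sum_nonneg)
  have "\<exists>u. \<forall>r\<in>{..<N}. (\<Sum>s<N. S $$ (r, s) * u s) = T $$ (r, i)" if i: "i < N" for i
  proof (rule psd_on_solve[OF psdS])
    fix w assume w: "\<And>r. r \<in> {..<N} \<Longrightarrow> (\<Sum>s<N. S $$ (r, s) * w s) = 0"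
    have "sform ?KS {..<N} w w = 0"
      by (rule sform_eq_0) (use w in blast)
    then have "(\<Sum>p<N. (cmod (\<Sum>s<N. T $$ (p, s) * w s))\<^sup>2) = 0"
      unfolding normsq of_real_eq_0_iff .
    then have "(cmod (\<Sum>s<N. T $$ (i, s) * w s))\<^sup>2 = 0"
      using i by (subst (asm) sum_nonneg_eq_0_iff) auto
    then have "0 = cnj (\<Sum>s<N. T $$ (i, s) * w s)" by simp
    also have "\<dots> = (\<Sum>r<N. cnj (w r) * T $$ (r, i))"
      unfolding cnj_sum by (intro sum.cong refl) (simp add: hT[OF i] mult.commute)
    finally show "(\<Sum>r<N. cnj (w r) * T $$ (r, i)) = 0" by simp
  qed
  then obtain u where u: "\<And>r i. r < N \<Longrightarrow> i < N \<Longrightarrow> (\<Sum>s<N. S $$ (r, s) * u i s) = T $$ (r, i)"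
    by (metis lessThan_iff)
  define U where "U = mat N N (\<lambda>(s, i). u i s)"
  have U: "U \<in> carrier_mat N N" by (simp add: U_def)
  have SU: "S * U = T"
  proof (rule eq_matI)
    fix i j assume "i < dim_row T" "j < dim_col T"
    then have ij: "i < N" "j < N" using T by auto
    have "(S * U) $$ (i, j) = (\<Sum>k<N. S $$ (i, k) * U $$ (k, j))"
      by (rule mat_mult_index[OF S U ij])
    also have "\<dots> = (\<Sum>k<N. S $$ (i, k) * u j k)"
      using ij by (intro sum.cong) (auto simp: U_def)
    finally show "(S * U) $$ (i, j) = T $$ (i, j)" using u ij by simp
  qed (use S U T in auto)
  note as = assoc_mult_mat[of _ N N _ N _ N]
  define V where "V = mat_adjoint U"
  have V: "V \<in> carrier_mat N N" using U by (simp add: V_def)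
  have TTU: "T * (T * U) = T" using SU T U by (simp add: S_def as)
  have VTT: "V * (T * T) = T"
  proof -
    have "T = mat_adjoint (S * U)" by (simp only: SU adjT)
    also have "\<dots> = V * mat_adjoint S" by (simp only: mat_adjoint_mult[OF S U] V_def)
    also have "mat_adjoint S = T * T" by (simp only: S_def mat_adjoint_mult[OF T T] adjT)
    finally show ?thesis by (rule sym)
  qed
  define E where "E = T * U"
  have E: "E \<in> carrier_mat N N" using T U by (simp add: E_def)
  have TE: "T * E = T" using TTU by (simp add: E_def)
  \<comment> \<open>With V the adjoint of U, the adjoint of T T U = T reads V T T = T. Hence V T = V
    T T U = T U, which says that \<open>E\<close> is self-adjoint.\<close>
  have VT: "V * T = E"
  proof -
    have "E = (V * (T * T)) * U" by (simp only: VTT E_def)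
    also have "\<dots> = V * (T * (T * U))" using V T U by (simp add: as)
    finally show ?thesis by (simp add: TTU)
  qed
  have adjE: "mat_adjoint E = E"
  proof -
    have "mat_adjoint (T * U) = mat_adjoint U * mat_adjoint T" by (rule mat_adjoint_mult[OF T U])
    then show ?thesis by (simp only: E_def[symmetric] V_def[symmetric] adjT VT)
  qed
  have ET: "E * T = T"
  proof -
    have "mat_adjoint (T * E) = mat_adjoint E * mat_adjoint T" by (rule mat_adjoint_mult[OF T E])
    then show ?thesis by (simp only: TE adjT adjE)
  qed
  have EE: "E * E = E"
  proof -
    have "E * (T * U) = (E * T) * U" using T U E by (simp add: as)
    then show ?thesis by (simp only: ET E_def[symmetric])
  qed
  have EUT: "E * (U * T) = E"
  proof -
    have "E * (U * T) = (V * T) * (U * T)" by (simp only: VT)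
    also have "\<dots> = V * ((T * U) * T)" using V T U by (simp add: as)
    also have "\<dots> = V * (E * T)" by (simp only: E_def)
    finally show ?thesis by (simp only: ET VT)
  qed
  define X where "X = E * (U * E)"
  have X: "X \<in> carrier_mat N N" using E U by (simp add: X_def)
  have TX: "T * X = E"
  proof -
    have "T * X = (T * E) * (U * E)" unfolding X_def using T E U by (simp add: as)
    also have "\<dots> = (T * U) * E" unfolding TE using T E U by (simp add: as)
    finally show ?thesis by (simp only: E_def[symmetric] EE)
  qed
  have XT: "X * T = E"
  proof -
    have "X * T = E * (U * (E * T))" unfolding X_def using T E U by (simp add: as)
    then show ?thesis by (simp only: ET EUT)
  qed
  have "E * X = (E * E) * (U * E)" unfolding X_def using E U by (simp add: as)
  then have EX: "E * X = X" by (simp only: EE X_def)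
  have "is_moore_penrose T X"
    unfolding is_moore_penrose_def TX XT using T X by (simp add: ET EX adjE)
  then show ?thesis ..
qed

lemma is_moore_penrose_moore_penrose:
  assumes "nonneg_hermitian N T"
  shows "is_moore_penrose T (moore_penrose T)"
proof -
  obtain X where X: "is_moore_penrose T X" using is_moore_penrose_exists[OF assms] by blast
  have "is_moore_penrose T (THE X. is_moore_penrose T X)"
    using X by (rule theI) (rule is_moore_penrose_unique[OF _ X])
  then show ?thesis by (simp add: moore_penrose_def is_moore_penrose_def)
qed

text \<open>\<open>T * moore_penrose T\<close> is the orthogonal projection onto the range of
  \<open>T\<close>, so it fixes \<open>Y\<close> as soon as the columns of \<open>Y\<close> are
  orthogonal to the kernel of \<open>T\<close>, which is hypothesis \<open>ker\<close>.\<close>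

lemma moore_penrose_solves:
  assumes nn: "nonneg_hermitian N T" and Y: "Y \<in> carrier_mat N p"
    and ker: "\<And>w a. (\<And>r. r < N \<Longrightarrow> (\<Sum>s<N. T $$ (r, s) * w s) = 0) \<Longrightarrow> a < p \<Longrightarrow>
      (\<Sum>s<N. cnj (Y $$ (s, a)) * w s) = 0"
  shows "moore_penrose T * Y \<in> carrier_mat N p" and "T * (moore_penrose T * Y) = Y"
proof -
  define X where "X = moore_penrose T"
  have T: "T \<in> carrier_mat N N" and adjT: "mat_adjoint T = T"
    using nn by (auto simp: nonneg_hermitian_def)
  have mp: "is_moore_penrose T X" using is_moore_penrose_moore_penrose[OF nn] by (simp add: X_def)
  then have X: "X \<in> carrier_mat N N" using T by (auto simp: is_moore_penrose_def)
  show "moore_penrose T * Y \<in> carrier_mat N p" using X Y by (simp flip: X_def)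
  define P where "P = T * X"
  have P: "P \<in> carrier_mat N N" using T X by (simp add: P_def)
  have adjP: "mat_adjoint P = P" and PT: "P * T = T"
    using mp by (auto simp: is_moore_penrose_def P_def)
  have hP: "P $$ (s, r) = cnj (P $$ (r, s))" if "r < N" "s < N" for r s
  proof -
    have "mat_adjoint P $$ (s, r) = cnj (P $$ (r, s))"
      using P that by (intro mat_adjoint_index) auto
    then show ?thesis by (simp only: adjP)
  qed
  have "mat_adjoint (P * T) = mat_adjoint T * mat_adjoint P" by (rule mat_adjoint_mult[OF P T])
  then have TP: "T * P = T" by (simp only: adjP adjT PT)
  have "P * Y = Y"
  proof (rule eq_matI)
    fix j a assume "j < dim_row Y" "a < dim_col Y"
    then have j: "j < N" and a: "a < p" using Y by auto
    \<comment> \<open>Column \<open>j\<close> of 1 - P. It is in the kernel of \<open>T\<close>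
      because T P = T, and orthogonality to it is row \<open>j\<close> of P Y = Y.\<close>
    define w where "w = (\<lambda>s. (if s = j then 1 else 0) - P $$ (s, j))"
    have "(\<Sum>s<N. T $$ (r, s) * w s) = 0" if r: "r < N" for r
    proof -
      have "(\<Sum>s<N. T $$ (r, s) * w s) =
          (\<Sum>s<N. if s = j then T $$ (r, s) else 0) - (\<Sum>s<N. T $$ (r, s) * P $$ (s, j))"
        unfolding w_def by (subst sum_subtractf[symmetric], intro sum.cong) (auto simp: algebra_simps)
      also have "\<dots> = T $$ (r, j) - (T * P) $$ (r, j)"
        using j r by (subst mat_mult_index[OF T P]) auto
      finally show ?thesis by (simp add: TP)
    qed
    then have "0 = cnj (\<Sum>s<N. cnj (Y $$ (s, a)) * w s)" using ker[of w a] a by simp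
    also have "\<dots> = (\<Sum>s<N. Y $$ (s, a) * cnj (w s))" by simp
    also have "\<dots> = (\<Sum>s<N. (if s = j then Y $$ (s, a) else 0) - P $$ (j, s) * Y $$ (s, a))"
      by (intro sum.cong refl) (simp add: w_def algebra_simps hP[OF j])
    also have "\<dots> = Y $$ (j, a) - (P * Y) $$ (j, a)"
      using j by (simp add: sum_subtractf mat_mult_index[OF P Y j a])
    finally show "(P * Y) $$ (j, a) = Y $$ (j, a)" by simp
  qed (use P Y in auto)
  moreover have "T * (X * Y) = P * Y" unfolding P_def using T X Y by simp
  ultimately show "T * (moore_penrose T * Y) = Y" by (simp add: X_def)
qed

section \<open>Block Toeplitz matrices and the central recursion\<close>

text \<open>The infinite block Toeplitz kernel with the convention that C_{-j} is the adjoint of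
  C_j. Restricting this one kernel to \<open>I m\<close> gives the finite matrices, so passing from
  one size to the next only changes the index set.\<close>

definition blk :: "(nat \<Rightarrow> complex mat) \<Rightarrow> nat \<times> nat \<Rightarrow> nat \<times> nat \<Rightarrow> complex" where
  "blk C r s = (if fst s \<le> fst r then C (fst r - fst s) $$ (snd r, snd s)
     else cnj (C (fst s - fst r) $$ (snd s, snd r)))"

lemma blk_Suc: "blk C (map_prod Suc id r) (map_prod Suc id s) = blk C r s"
  by (cases r; cases s) (simp add: blk_def)

lemma mult_add_less: "l < m \<Longrightarrow> k < q \<Longrightarrow> l * q + k < m * (q::nat)"
  using mult_le_mono1[of "Suc l" m q] by simp

lemma bij_betw_div_mod:
  assumes "0 < (q::nat)"
  shows "bij_betw (\<lambda>r. (r div q, r mod q)) {..<m * q} ({..<m} \<times> {..<q})"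
proof (rule bij_betwI[where g = "\<lambda>(l, k). l * q + k"])
  show "(\<lambda>(l, k). l * q + k) \<in> {..<m} \<times> {..<q} \<rightarrow> {..<m * q}"
    by (auto intro: mult_add_less)
qed (use assms in \<open>auto simp: less_mult_imp_div_less\<close>)

lemma sum_div_mod:
  assumes "0 < (q::nat)"
  shows "(\<Sum>r<m * q. g (r div q, r mod q)) = (\<Sum>p\<in>{..<m} \<times> {..<q}. g p)"
  using sum.reindex_bij_betw[OF bij_betw_div_mod[OF assms], of g m] by simp

lemma psd_on_div_mod:
  assumes "0 < (q::nat)"
  shows "psd_on (\<lambda>r s. K (r div q, r mod q) (s div q, s mod q)) {..<m * q} \<longleftrightarrow>
    psd_on K ({..<m} \<times> {..<q})"
  using psd_on_reindex[OF bij_betw_imp_inj_on[OF bij_betw_div_mod[OF assms, of m]], of K]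
    bij_betw_imp_surj_on[OF bij_betw_div_mod[OF assms, of m]] by simp

lemma T_mat_carrier: "T_mat q C m \<in> carrier_mat ((m + 1) * q) ((m + 1) * q)"
  by (simp add: T_mat_def block_toeplitz_def)

lemma T_mat_index:
  assumes "\<And>j. j \<le> m \<Longrightarrow> C j \<in> carrier_mat q q" "r < (m + 1) * q" "s < (m + 1) * q"
  shows "T_mat q C m $$ (r, s) = blk C (r div q, r mod q) (s div q, s mod q)"
proof -
  have q: "0 < q" using assms(2) by (cases q) auto
  have d: "r div q < m + 1" "s div q < m + 1"
    using assms(2,3) by (simp_all only: less_mult_imp_div_less)
  show ?thesis
  proof (cases "s div q \<le> r div q")
    case True
    then show ?thesis using assms d
      by (simp add: T_mat_def block_toeplitz_def blk_def nat_diff_distrib)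
  next
    case False
    then have "nat (int (s div q) - int (r div q)) = s div q - r div q" by simp
    moreover have "C (s div q - r div q) \<in> carrier_mat q q" using d by (intro assms(1)) auto
    then have "mat_adjoint (C (s div q - r div q)) $$ (r mod q, s mod q) =
        cnj (C (s div q - r div q) $$ (s mod q, r mod q))"
      using q by (intro mat_adjoint_index) auto
    ultimately show ?thesis using assms(2,3) False
      by (simp add: T_mat_def block_toeplitz_def blk_def)
  qed
qed

lemma S_mat_carrier: "S_mat q C m \<in> carrier_mat ((m + 1) * q) ((m + 1) * q)"
  by (simp add: S_mat_def block_toeplitz_def)

lemma S_mat_index:
  assumes "r < (m + 1) * q" "s < (m + 1) * q"
  shows "S_mat q C m $$ (r, s) =
    (if s div q \<le> r div q then C (r div q - s div q) $$ (r mod q, s mod q) else 0)"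
proof -
  have q: "0 < q" using assms by (cases q) auto
  show ?thesis using assms q
    by (auto simp: S_mat_def block_toeplitz_def nat_diff_distrib)
qed

lemma re_mat_carrier [simp]: "A \<in> carrier_mat m m \<Longrightarrow> re_mat A \<in> carrier_mat m m"
  by (simp add: re_mat_def)

lemma re_mat_index:
  assumes "A \<in> carrier_mat m m" "i < m" "j < m"
  shows "re_mat A $$ (i, j) = (A $$ (i, j) + cnj (A $$ (j, i))) / 2"
  using assms by (simp add: re_mat_def)

lemma central_step_cong:
  assumes m: "1 \<le> m" and CC': "\<And>j. j \<le> m \<Longrightarrow> C j = C' j"
  shows "central_step q C m = central_step q C' m"
proof -
  have "T_mat q C (m - 1) = T_mat q C' (m - 1)"
  proof (rule eq_matI)
    fix r s assume "r < dim_row (T_mat q C' (m - 1))" "s < dim_col (T_mat q C' (m - 1))"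
    then have rs: "r < (m - 1 + 1) * q" "s < (m - 1 + 1) * q"
      by (auto simp: T_mat_def block_toeplitz_def)
    have d: "r div q < m - 1 + 1" "s div q < m - 1 + 1"
      using rs by (simp_all only: less_mult_imp_div_less)
    have "C (nat (int (r div q) - int (s div q))) = C' (nat (int (r div q) - int (s div q)))"
      "C (nat (- (int (r div q) - int (s div q)))) = C' (nat (- (int (r div q) - int (s div q))))"
      using d m by (intro CC'; simp)+
    then show "T_mat q C (m - 1) $$ (r, s) = T_mat q C' (m - 1) $$ (r, s)"
      using rs by (simp add: T_mat_def block_toeplitz_def)
  qed (auto simp: T_mat_def block_toeplitz_def)
  moreover have "Y_mat q C m = Y_mat q C' m"
  proof (rule eq_matI)
    fix r s assume "r < dim_row (Y_mat q C' m)" "s < dim_col (Y_mat q C' m)"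
    then have rs: "r < m * q" "s < q" by (auto simp: Y_mat_def)
    then have "r div q < m" by (simp only: less_mult_imp_div_less)
    then have "C (r div q + 1) = C' (r div q + 1)" by (intro CC') simp
    then show "Y_mat q C m $$ (r, s) = Y_mat q C' m $$ (r, s)" using rs by (simp add: Y_mat_def)
  qed (auto simp: Y_mat_def)
  moreover have "Z_mat q C m = Z_mat q C' m"
    by (rule eq_matI) (auto simp: Z_mat_def CC')
  ultimately show ?thesis by (simp only: central_step_def)
qed

definition W_mat :: "nat \<Rightarrow> (nat \<Rightarrow> complex mat) \<Rightarrow> nat \<Rightarrow> complex mat" where
  "W_mat q C m = moore_penrose (T_mat q C (m - 1)) * Y_mat q C m"

locale block_sequence =
  fixes q :: nat and C :: "nat \<Rightarrow> complex mat"
  assumes q_pos: "0 < q" and C_carrier: "\<And>j. C j \<in> carrier_mat q q"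
begin

abbreviation I :: "nat \<Rightarrow> (nat \<times> nat) set" where
  "I m \<equiv> {..<m} \<times> {..<q}"

definition w :: "nat \<Rightarrow> nat \<times> nat \<Rightarrow> nat \<Rightarrow> complex" where
  "w m p a = W_mat q C m $$ (fst p * q + snd p, a)"

lemma w_div_mod: "w m (s div q, s mod q) a = W_mat q C m $$ (s, a)"
  by (simp add: w_def)

lemma nonneg_hermitian_T_mat_iff:
  "nonneg_hermitian ((m + 1) * q) (T_mat q C m) \<longleftrightarrow> psd_on (blk C) (I (m + 1))"
proof -
  have "nonneg_hermitian ((m + 1) * q) (T_mat q C m) \<longleftrightarrow>
      psd_on (\<lambda>r s. T_mat q C m $$ (r, s)) {..<(m + 1) * q}"
    by (rule nonneg_hermitian_iff_psd_on) (rule T_mat_carrier)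
  also have "\<dots> \<longleftrightarrow> psd_on (\<lambda>r s. blk C (r div q, r mod q) (s div q, s mod q)) {..<(m + 1) * q}"
    by (rule psd_on_cong, rule T_mat_index) (use C_carrier in auto)
  also have "\<dots> \<longleftrightarrow> psd_on (blk C) (I (m + 1))"
    by (rule psd_on_div_mod[OF q_pos])
  finally show ?thesis .
qed

lemma T_mat_pred:
  assumes m: "1 \<le> m" and psd: "psd_on (blk C) (I m)"
  shows "T_mat q C (m - 1) \<in> carrier_mat (m * q) (m * q)"
    and "nonneg_hermitian (m * q) (T_mat q C (m - 1))"
    and "moore_penrose (T_mat q C (m - 1)) \<in> carrier_mat (m * q) (m * q)"
proof -
  have mm: "m - 1 + 1 = m" using m by simp
  show T: "T_mat q C (m - 1) \<in> carrier_mat (m * q) (m * q)"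
    using T_mat_carrier[of q C "m - 1"] by (simp only: mm)
  show nn: "nonneg_hermitian (m * q) (T_mat q C (m - 1))"
    using nonneg_hermitian_T_mat_iff[of "m - 1"] psd by (simp only: mm)
  show "moore_penrose (T_mat q C (m - 1)) \<in> carrier_mat (m * q) (m * q)"
    using is_moore_penrose_moore_penrose[OF nn] T by (auto simp: is_moore_penrose_def)
qed

lemma image_I_shift: "map_prod Suc id ` I m = {1..m} \<times> {..<q}"
  by (auto simp: map_prod_def image_iff lessThan_Suc_eq_insert_0 Bex_def)
     (metis Suc_le_D Suc_le_lessD)

lemma sum_I_shift:
  "(\<Sum>s\<in>{1..m} \<times> {..<q}. g s) = (\<Sum>s\<in>I m. g (map_prod Suc id s))"
  by (rule sum.reindex_bij_betw[symmetric]) (simp add: bij_betw_def map_prod_inj_on image_I_shift)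

lemma psd_on_shift:
  assumes "psd_on (blk C) (I m)"
  shows "psd_on (blk C) ({1..m} \<times> {..<q})"
  unfolding image_I_shift[symmetric]
  by (subst psd_on_reindex) (use assms in \<open>simp_all add: map_prod_inj_on blk_Suc\<close>)

text \<open>Solvability needs \<open>Y_mat\<close> to be orthogonal to the kernel of the smaller
  Toeplitz matrix. By Toeplitz invariance a kernel vector may be moved to the blocks 1 to
  \<open>m\<close> of the larger matrix; by \<open>psd_on_kernel_extend\<close> it is then
  annihilated by block row 0 too, and that row is the adjoint of \<open>Y_mat\<close>.\<close>

lemma W_mat_solves:
  assumes m: "1 \<le> m" and psd: "psd_on (blk C) (I (m + 1))"
  shows "W_mat q C m \<in> carrier_mat (m * q) q"
    and "j < m \<Longrightarrow> i < q \<Longrightarrow> a < q \<Longrightarrow> C (Suc j) $$ (i, a) = (\<Sum>p\<in>I m. blk C (j, i) p * w m p a)"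
proof -
  have mm: "m - 1 + 1 = m" using m by simp
  let ?T = "T_mat q C (m - 1)" and ?Y = "Y_mat q C m"
  have Y: "?Y \<in> carrier_mat (m * q) q" by (simp add: Y_mat_def)
  have "psd_on (blk C) (I m)" by (rule psd_on_subset[OF psd]) auto
  note T = T_mat_pred(1)[OF m this] and nn = T_mat_pred(2)[OF m this]
  have Tx: "(\<Sum>s<m * q. ?T $$ (r, s) * x (s div q, s mod q)) =
      (\<Sum>p\<in>I m. blk C (r div q, r mod q) p * x p)" if r: "r < m * q" for r x
  proof -
    have "(\<Sum>s<m * q. ?T $$ (r, s) * x (s div q, s mod q)) =
        (\<Sum>s<m * q. blk C (r div q, r mod q) (s div q, s mod q) * x (s div q, s mod q))"
      by (intro sum.cong refl arg_cong2[of _ _ _ _ "(*)"] T_mat_index C_carrier)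
         (use r mm in auto)
    then show ?thesis
      using sum_div_mod[OF q_pos, of "\<lambda>p. blk C (r div q, r mod q) p * x p" m] by simp
  qed
  have ker: "(\<Sum>s<m * q. cnj (?Y $$ (s, a)) * v s) = 0"
    if v: "\<And>r. r < m * q \<Longrightarrow> (\<Sum>s<m * q. ?T $$ (r, s) * v s) = 0" and a: "a < q" for v a
  proof -
    define x where "x p = v (fst p * q + snd p)" for p
    have xv: "x (s div q, s mod q) = v s" for s by (simp add: x_def)
    \<comment> \<open>The vector \<open>x\<close> moved one block down. The value that truncated
      subtraction assigns to block 0 is never summed.\<close>
    define y where "y p = x (fst p - 1, snd p)" for p :: "nat \<times> nat"
    have yx: "y (map_prod Suc id p) = x p" for p by (cases p) (simp add: y_def)
    have 0: "(\<Sum>p\<in>I m. blk C r p * x p) = 0" if "r \<in> I m" for r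
    proof -
      obtain j i where r: "r = (j, i)" "j < m" "i < q" using \<open>r \<in> I m\<close> by auto
      then have "j * q + i < m * q" by (intro mult_add_less)
      from Tx[OF this, of x] v[OF this] show ?thesis using r by (simp add: xv)
    qed
    have "(\<Sum>s\<in>{1..m} \<times> {..<q}. blk C (0, a) s * y s) = 0"
    proof (rule psd_on_kernel_extend[OF psd])
      fix r assume "r \<in> {1..m} \<times> {..<q}"
      then obtain j i where r: "r = map_prod Suc id (j, i)" "(j, i) \<in> I m"
        by (cases r, cases "fst r") auto
      show "(\<Sum>s\<in>{1..m} \<times> {..<q}. blk C r s * y s) = 0"
        using 0[OF r(2)] unfolding sum_I_shift r(1) blk_Suc yx .
    qed (use a in auto)
    also have "(\<Sum>s\<in>{1..m} \<times> {..<q}. blk C (0, a) s * y s) =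
        (\<Sum>p\<in>I m. cnj (C (Suc (fst p)) $$ (snd p, a)) * x p)"
      unfolding sum_I_shift yx by (simp add: blk_def)
    also have "\<dots> = (\<Sum>s<m * q. cnj (C (Suc (s div q)) $$ (s mod q, a)) * v s)"
      using sum_div_mod[OF q_pos, of "\<lambda>p. cnj (C (Suc (fst p)) $$ (snd p, a)) * x p" m]
      by (simp add: xv)
    also have "\<dots> = (\<Sum>s<m * q. cnj (?Y $$ (s, a)) * v s)"
      by (intro sum.cong refl) (use a in \<open>simp add: Y_mat_def\<close>)
    finally show ?thesis .
  qed
  show W: "W_mat q C m \<in> carrier_mat (m * q) q"
    unfolding W_mat_def by (rule moore_penrose_solves(1)[OF nn Y ker])
  have TW: "?T * W_mat q C m = ?Y"
    unfolding W_mat_def by (rule moore_penrose_solves(2)[OF nn Y ker])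
  show "C (Suc j) $$ (i, a) = (\<Sum>p\<in>I m. blk C (j, i) p * w m p a)" if "j < m" "i < q" "a < q"
  proof -
    have r: "j * q + i < m * q" using that by (intro mult_add_less)
    have "C (Suc j) $$ (i, a) = (?T * W_mat q C m) $$ (j * q + i, a)"
      unfolding TW using that r by (simp add: Y_mat_def)
    also have "\<dots> = (\<Sum>s<m * q. ?T $$ (j * q + i, s) * w m (s div q, s mod q) a)"
      unfolding w_div_mod by (rule mat_mult_index[OF T W r \<open>a < q\<close>])
    also have "\<dots> = (\<Sum>p\<in>I m. blk C (j, i) p * w m p a)"
      using Tx[OF r, of "\<lambda>p. w m p a"] that by simp
    finally show ?thesis .
  qed
qed

text \<open>\<open>Z_mat\<close> is block row \<open>m\<close> of the kernel restricted to the
  blocks 0 to \<open>m - 1\<close>. The central choice therefore prolongs the equations of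
  \<open>W_mat_solves\<close> by one further row, j = m.\<close>

lemma central_step_index:
  assumes m: "1 \<le> m" and psd: "psd_on (blk C) (I (m + 1))" and "i < q" "a < q"
  shows "central_step q C m $$ (i, a) = (\<Sum>p\<in>I m. blk C (m, i) p * w m p a)"
proof -
  note W = W_mat_solves(1)[OF m psd]
  have "psd_on (blk C) (I m)" by (rule psd_on_subset[OF psd]) auto
  note mp = T_mat_pred(3)[OF m this]
  have Z: "Z_mat q C m \<in> carrier_mat q (m * q)" by (simp add: Z_mat_def)
  have Y: "Y_mat q C m \<in> carrier_mat (m * q) q" by (simp add: Y_mat_def)
  have "central_step q C m = Z_mat q C m * W_mat q C m"
    unfolding central_step_def W_mat_def by (rule assoc_mult_mat[OF Z mp Y])
  then have "central_step q C m $$ (i, a) =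
      (\<Sum>s<m * q. Z_mat q C m $$ (i, s) * W_mat q C m $$ (s, a))"
    using mat_mult_index[OF Z W \<open>i < q\<close> \<open>a < q\<close>] by simp
  also have "\<dots> = (\<Sum>s<m * q. blk C (m, i) (s div q, s mod q) * w m (s div q, s mod q) a)"
  proof (intro sum.cong refl arg_cong2[of _ _ _ _ "(*)"])
    fix s assume "s \<in> {..<m * q}"
    then have s: "s < m * q" by simp
    then have "s div q < m" by (simp only: less_mult_imp_div_less)
    then show "Z_mat q C m $$ (i, s) = blk C (m, i) (s div q, s mod q)"
      using s \<open>i < q\<close> by (simp add: Z_mat_def blk_def)
  qed (simp add: w_div_mod)
  also have "\<dots> = (\<Sum>p\<in>I m. blk C (m, i) p * w m p a)"
    using sum_div_mod[OF q_pos, of "\<lambda>p. blk C (m, i) p * w m p a" m] by simp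
  finally show ?thesis .
qed

lemma blk_hermitian:
  assumes "\<And>i k. i < q \<Longrightarrow> k < q \<Longrightarrow> C 0 $$ (k, i) = cnj (C 0 $$ (i, k))" "r \<in> I m" "s \<in> I m"
  shows "blk C s r = cnj (blk C r s)"
proof (cases "fst r" "fst s" rule: linorder_cases)
  case equal
  then show ?thesis using assms(1)[of "snd r" "snd s"] assms(2,3) by (auto simp: blk_def)
qed (auto simp: blk_def)

text \<open>\<open>psd_on_schur_step\<close> is applied with the first block as A, the last one as B
  and the overlap as M. A and M form the previous matrix, M and B its shift by one block. The
  equations for \<open>w m\<close>, prolonged by the central step, express the first block column
  below the diagonal through the columns of M.\<close>

lemma psd_on_step:
  assumes m: "1 \<le> m" and psd: "psd_on (blk C) (I (m + 1))"
    and step: "C (Suc m) = central_step q C m"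
  shows "psd_on (blk C) (I (m + 2))"
proof -
  let ?A = "{0::nat} \<times> {..<q}" and ?M = "{1..m} \<times> {..<q}" and ?B = "{Suc m} \<times> {..<q}"
  have AM: "?A \<union> ?M = I (m + 1)" and MB: "?M \<union> ?B = {1..m + 1} \<times> {..<q}"
    and AMB: "?A \<union> ?M \<union> ?B = I (m + 2)" by auto
  have C0: "C 0 $$ (k, i) = cnj (C 0 $$ (i, k))" if "i < q" "k < q" for i k
    using psd_on_hermitian[OF psd, of "(0, i)" "(0, k)"] that by (simp add: blk_def)
  have "psd_on (blk C) (?A \<union> ?M \<union> ?B)"
  proof (rule psd_on_schur_step[where W = "\<lambda>s t. w m (fst s - 1, snd s) (snd t)"])
    show "psd_on (blk C) (?A \<union> ?M)" using psd by (simp only: AM)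
    show "psd_on (blk C) (?M \<union> ?B)" using psd_on_shift[OF psd] by (simp only: MB)
    show "blk C s r = cnj (blk C r s)" if "r \<in> ?A \<union> ?M \<union> ?B" "s \<in> ?A \<union> ?M \<union> ?B" for r s
      by (rule blk_hermitian[OF C0, of r "m + 2" s]) (use that in \<open>simp_all only: AMB\<close>)
    fix r t assume r: "r \<in> ?M \<union> ?B" and t: "t \<in> ?A"
    obtain j i where ji: "r = map_prod Suc id (j, i)" "j \<le> m" "i < q"
      using r by (cases r, cases "fst r") auto
    obtain a where a: "t = (0, a)" "a < q" using t by auto
    have "blk C r t = C (Suc j) $$ (i, a)" by (simp add: ji a blk_def)
    also have "\<dots> = (\<Sum>p\<in>I m. blk C (j, i) p * w m p a)"
    proof (cases "j = m")
      case True
      then show ?thesis using central_step_index[OF m psd ji(3) a(2)] by (simp add: step)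
    next
      case False
      then show ?thesis using W_mat_solves(2)[OF m psd _ ji(3) a(2), of j] ji by simp
    qed
    also have "\<dots> = (\<Sum>s\<in>?M. blk C r s * w m (fst s - 1, snd s) (snd t))"
      unfolding sum_I_shift by (simp add: ji a blk_Suc del: map_prod_simp) 
    finally show "blk C r t = (\<Sum>s\<in>?M. blk C r s * w m (fst s - 1, snd s) (snd t))" .
  qed auto
  then show ?thesis by (simp only: AMB)
qed

text \<open>
  By induction \<open>w n\<close>, extended by zero, solves the same linear system as \<open>w m\<close>. The difference lies in the
  kernel of \<open>T\<^bsub>m-1\<^esub>\<close> and hence, by non-negativity of \<open>T\<^sub>m\<close>, does not contribute to \<open>C\<^bsub>m+1\<^esub>\<close>.
\<close>
lemma recurrence:
  assumes n: "1 \<le> n" and psd: "\<And>m. psd_on (blk C) (I m)"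
    and step: "\<And>m. n \<le> m \<Longrightarrow> C (Suc m) = central_step q C m"
    and "i < q" "a < q"
  shows "C (Suc m) $$ (i, a) = (\<Sum>p\<in>I n. blk C (m, i) p * w n p a)"
  using \<open>i < q\<close>
proof (induction m arbitrary: i rule: less_induct)
  case (less m)
  consider "m < n" | "m = n" | "n < m" by linarith
  then show ?case
  proof cases
    case 1
    then show ?thesis by (intro W_mat_solves(2) n psd less.prems \<open>a < q\<close>)
  next
    case 2
    then show ?thesis
      using central_step_index[OF n psd less.prems \<open>a < q\<close>] by (simp add: step)
  next
    case 3
    then have m: "1 \<le> m" using n by simp
    define x where "x p = w m p a - (if p \<in> I n then w n p a else 0)" for p
    have x: "(\<Sum>p\<in>I m. blk C r p * x p) =
        (\<Sum>p\<in>I m. blk C r p * w m p a) - (\<Sum>p\<in>I n. blk C r p * w n p a)" for r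
    proof -
      have "(\<Sum>p\<in>I n. blk C r p * w n p a) = (\<Sum>p\<in>I m. if p \<in> I n then blk C r p * w n p a else 0)"
        by (rule sum.mono_neutral_cong_left) (use 3 in auto)
      then show ?thesis
        by (simp only: x_def sum_subtractf[symmetric]) (intro sum.cong refl; simp add: algebra_simps)
    qed
    have "(\<Sum>p\<in>I m. blk C (m, i) p * x p) = 0"
    proof (rule psd_on_kernel_extend[OF psd[of "m + 1"]])
      fix r assume "r \<in> I m"
      then obtain j k where r: "r = (j, k)" "j < m" "k < q" by auto
      show "(\<Sum>p\<in>I m. blk C r p * x p) = 0"
        using W_mat_solves(2)[OF m psd r(2,3) \<open>a < q\<close>] less.IH[OF r(2,3)] unfolding x r(1) by simp
    qed (use less.prems in auto)
    then show ?thesis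
      using central_step_index[OF m psd less.prems \<open>a < q\<close>] 3 unfolding x by (simp add: step)
  qed
qed

end

section \<open>Functions with non-negative real part on the disk\<close>

text \<open>Testing the Toeplitz form on the conjugate powers of \<open>z\<close> gives numbers A_m
  \<ge> 0 with A_{m+1} = |z|^2 A_m + (Re c_0 + 2 Re P_m), where P_m is a partial sum of the series.
  If the limit S of the bracket were negative, A_m would eventually drop by at least |S| / 2 in
  every step.\<close>

lemma scalar_caratheodory:
  fixes c :: "nat \<Rightarrow> complex"
  assumes psd: "\<And>m. psd_on (\<lambda>j l. if l \<le> j then c (j - l) else cnj (c (l - j))) {..<m}"
    and z: "cmod z < 1" and t: "(\<lambda>j. c (Suc j) * z ^ Suc j) sums t"
  shows "0 \<le> Re (c 0) + 2 * Re t"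
proof (rule ccontr)
  define K where "K = (\<lambda>j l. if l \<le> j then c (j - l) else cnj (c (l - j)))"
  define A where "A m = Re (sform K {..<m} (\<lambda>l. cnj z ^ l) (\<lambda>l. cnj z ^ l))" for m
  define P where "P m = (\<Sum>j<m. c (Suc j) * z ^ Suc j)" for m
  define S where "S = Re (c 0) + 2 * Re t"
  assume "\<not> ?thesis"
  then have S: "S < 0" by (simp add: S_def)
  have A_nonneg: "0 \<le> A m" for m
    unfolding A_def by (rule psd_on_nonneg) (use psd in \<open>simp add: K_def\<close>)
  have rec: "A (Suc m) = (cmod z)\<^sup>2 * A m + (Re (c 0) + 2 * Re (P m))" for m
  proof -
    have "sform K {..<Suc m} (\<lambda>l. cnj z ^ l) (\<lambda>l. cnj z ^ l) =
        (\<Sum>j<Suc m. \<Sum>l<Suc m. z ^ j * K j l * cnj z ^ l)"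
      by (simp only: sform_def sum_distrib_left complex_cnj_power complex_cnj_cnj mult.assoc)
    also have "\<dots> = K 0 0 + (\<Sum>l<m. K 0 (Suc l) * cnj z ^ Suc l) + (\<Sum>j<m. z ^ Suc j * K (Suc j) 0)
        + (\<Sum>j<m. \<Sum>l<m. z ^ Suc j * K (Suc j) (Suc l) * cnj z ^ Suc l)"
      by (simp add: sum.lessThan_Suc_shift sum.distrib del: sum.lessThan_Suc)
    also have "(\<Sum>l<m. K 0 (Suc l) * cnj z ^ Suc l) = cnj (P m)"
      by (simp add: P_def K_def)
    also have "(\<Sum>j<m. z ^ Suc j * K (Suc j) 0) = P m"
      by (simp add: P_def K_def mult_ac)
    also have "(\<Sum>j<m. \<Sum>l<m. z ^ Suc j * K (Suc j) (Suc l) * cnj z ^ Suc l) =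
        (z * cnj z) * sform K {..<m} (\<lambda>l. cnj z ^ l) (\<lambda>l. cnj z ^ l)"
      unfolding sform_def sum_distrib_left
      by (intro sum.cong refl) (simp add: K_def mult_ac)
    finally have "sform K {..<Suc m} (\<lambda>l. cnj z ^ l) (\<lambda>l. cnj z ^ l) =
        K 0 0 + cnj (P m) + P m + of_real ((cmod z)\<^sup>2) * sform K {..<m} (\<lambda>l. cnj z ^ l) (\<lambda>l. cnj z ^ l)"
      by (simp only: complex_norm_square)
    then show ?thesis by (simp add: A_def K_def)
  qed
  have "(\<lambda>m. Re (c 0) + 2 * Re (P m)) \<longlonglongrightarrow> S"
    using t unfolding sums_def P_def S_def by (intro tendsto_intros)
  then have "eventually (\<lambda>m. Re (c 0) + 2 * Re (P m) < S / 2) sequentially"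
    using S by (intro order_tendstoD) auto
  then obtain N where N: "\<And>m. m \<ge> N \<Longrightarrow> Re (c 0) + 2 * Re (P m) < S / 2"
    by (auto simp: eventually_sequentially)
  have dec: "A (N + k) \<le> A N + real k * (S / 2)" for k
  proof (induction k)
    case (Suc k)
    have "(cmod z)\<^sup>2 * A (N + k) \<le> 1 * A (N + k)"
      using z A_nonneg[of "N + k"] by (intro mult_right_mono) (auto simp: power_le_one)
    then have "A (N + Suc k) \<le> A (N + k) + S / 2"
      using rec[of "N + k"] N[of "N + k"] by simp
    then show ?case using Suc by (simp add: algebra_simps add_divide_distrib)
  qed simp
  obtain k where "A N < real k * (- S / 2)"
    using reals_Archimedean3[of "- S / 2"] S by auto
  then show False using dec[of k] A_nonneg[of "N + k"] by simp
qed

text \<open>Polarization: a form that is real on all vectors e_r + a e_s, with a = 1 and a = \<i>,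
  has a Hermitian kernel.\<close>

lemma psd_onI_sform:
  assumes fin: "finite I" and real: "\<And>x. Im (sform K I x x) = 0" and nonneg: "\<And>x. 0 \<le> Re (sform K I x x)"
  shows "psd_on K I"
  unfolding psd_on_def
proof (intro conjI ballI allI fin nonneg)
  fix r s assume r: "r \<in> I" and s: "s \<in> I"
  define e where "e = (\<lambda>t. if t = r then 1 else 0 :: complex)"
  define f where "f a = (\<lambda>t. if t = s then a else 0 :: complex)" for a
  have ef: "sform K I e (f a) = K r s * a" and fe: "sform K I (f a) e = cnj a * K s r" for a
  proof -
    have "(\<Sum>t\<in>I. cnj (e t) * K t s) = (\<Sum>t\<in>I. if t = r then K r s else 0)"
      by (intro sum.cong) (auto simp: e_def)
    then show "sform K I e (f a) = K r s * a"
      using fin r by (simp add: f_def sform_single(2)[OF fin s])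
    have "(\<Sum>t\<in>I. K s t * e t) = (\<Sum>t\<in>I. if t = r then K s r else 0)"
      by (intro sum.cong) (auto simp: e_def)
    then show "sform K I (f a) e = cnj a * K s r"
      using fin r by (simp add: f_def sform_single(1)[OF fin s])
  qed
  have "Im (K r s * a + cnj a * K s r) = 0" for a
    using real[of "\<lambda>t. e t + f a t"] real[of e] real[of "f a"]
    by (simp add: sform_add_left sform_add_right ef fe)
  from this[of 1] this[of \<i>] show "K s r = cnj (K r s)"
    by (simp add: complex_eq_iff)
qed

text \<open>In the Leibniz formula only the term that differentiates the power exactly
  \<open>m\<close> times survives at \<open>v\<close>. This converts the derivatives in the
  definition of \<open>X_mat\<close> into values of the cofactors.\<close>

lemma higher_deriv_shifted_power_mult:
  assumes "F holomorphic_on ball v r" "0 < r"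
    and f: "\<And>z. z \<in> ball v r \<Longrightarrow> f z = (z - v) ^ m * F z"
  shows "(deriv ^^ m) f v = fact m * F v"
proof -
  have "(deriv ^^ m) f v = (deriv ^^ m) (\<lambda>z. (z - v) ^ m * F z) v"
  proof (rule higher_deriv_cong_ev)
    show "eventually (\<lambda>z. f z = (z - v) ^ m * F z) (nhds v)"
      by (rule eventually_nhds_in_open[THEN eventually_mono, of "ball v r"]) (use assms in auto)
  qed simp
  also have "\<dots> = (\<Sum>i = 0..m. of_nat (m choose i) * (deriv ^^ i) (\<lambda>z. (z - v) ^ m) v * (deriv ^^ (m - i)) F v)"
    by (rule higher_deriv_mult[of _ "ball v r"]) (use assms in \<open>auto intro!: holomorphic_intros\<close>)
  also have "\<dots> = (\<Sum>i\<in>{m}. of_nat (m choose i) * (deriv ^^ i) (\<lambda>z. (z - v) ^ m) v * (deriv ^^ (m - i)) F v)"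
    by (rule sum.mono_neutral_right) (auto simp: higher_deriv_power)
  also have "\<dots> = fact m * F v"
    by (simp add: higher_deriv_power pochhammer_fact)
  finally show ?thesis .
qed

text \<open>
  The growth bound on \<open>\<phi>\<close> forces the pole of \<open>g / f\<close> at \<open>v\<close> to be simple; its residue is then
  read off from the lowest Taylor coefficients of \<open>g\<close> and \<open>f\<close>.
\<close>
lemma simple_pole_on_circle:
  fixes f g \<phi> :: "complex \<Rightarrow> complex"
  assumes f: "f holomorphic_on UNIV" "f 0 \<noteq> 0" and g: "g holomorphic_on UNIV"
    and v: "cmod v = 1" "f v = 0"
    and \<phi>: "\<And>z. cmod z < 1 \<Longrightarrow> \<phi> z * f z = g z" "\<And>z. cmod z < 1 \<Longrightarrow> cmod (\<phi> z) \<le> M / (1 - cmod z)"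
    and m: "m = nat (zorder f v)"
    and X: "X = - of_nat m / (2 * v * (deriv ^^ m) f v) * (deriv ^^ (m - 1)) g v"
  shows "\<exists>h. h analytic_on {v} \<and> (\<forall>\<^sub>F z in at v. f z \<noteq> 0 \<and> g z / f z = - 2 * v * X / (z - v) + h z)"
proof -
  have v0: "v \<noteq> 0" using v by auto
  define F where "F = zor_poly f v"
  have "\<exists>w\<in>UNIV. f w \<noteq> 0" using f(2) by blast
  note ex = zorder_exist_zero[OF f(1) open_UNIV connected_UNIV UNIV_I this, of v, folded F_def m]
  have m0: "0 < m" using ex v(2) by (simp add: m)
  obtain r where r: "0 < r" and F: "F holomorphic_on cball v r"
    and fF: "\<And>z. z \<in> cball v r \<Longrightarrow> f z = F z * (z - v) ^ m \<and> F z \<noteq> 0"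
    using ex by blast
  \<comment> \<open>Points on the radius through \<open>v\<close>: their distance to
    \<open>v\<close> equals their distance \<open>e\<close> to the circle, so the growth bound
    becomes M / e.\<close>
  have pts: "v - of_real e * v \<in> cball v r" "cmod (v - of_real e * v) = 1 - e"
    "cmod (v - of_real e * v) < 1" if "0 < e" "e < min 1 r" for e
  proof -
    have *: "v - of_real e * v = of_real (1 - e) * v" by (simp add: algebra_simps)
    show c: "cmod (v - of_real e * v) = 1 - e"
      unfolding * norm_mult norm_of_real using that v by simp
    show "cmod (v - of_real e * v) < 1" using c that by simp
    show "v - of_real e * v \<in> cball v r" using that v by (simp add: dist_norm norm_mult)
  qed
  have "\<exists>r' k. 0 < r' \<and> r' \<le> r \<and> k holomorphic_on ball v r' \<and> (\<forall>z\<in>ball v r'. g z = (z - v) ^ (m - 1) * k z)"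
  \<comment> \<open>A function vanishing identically has no order at \<open>v\<close>, hence the
    separate case.\<close>
  proof (cases "\<forall>z. g z = 0")
    case True
    then show ?thesis using r by (intro exI[of _ r] exI[of _ "\<lambda>_. 0"]) auto
  next
    case False
    define p where "p = nat (zorder g v)"
    define G where "G = zor_poly g v"
    have "\<exists>w\<in>UNIV. g w \<noteq> 0" using False by blast
    note ex' = zorder_exist_zero[OF g open_UNIV connected_UNIV UNIV_I this, of v, folded G_def p_def]
    obtain s where s: "0 < s" and G: "G holomorphic_on cball v s"
      and gG: "\<And>z. z \<in> cball v s \<Longrightarrow> g z = G z * (z - v) ^ p \<and> G z \<noteq> 0"
      using ex' by blast
    \<comment> \<open>On the radius the growth bound reads |G| e^p \<le> M |F| e^(m-1). If p < m -
      1, dividing by e^p and letting e tend to 0 would give G(v) = 0.\<close>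
    have "m - 1 \<le> p"
    proof (rule ccontr)
      assume "\<not> m - 1 \<le> p"
      then have mp: "m = Suc p + (m - p - 1)" "m - p - 1 \<noteq> 0" by auto
      have lim: "((\<lambda>e. v - of_real e * v) \<longlongrightarrow> v - of_real 0 * v) (at_right 0)"
        by (intro tendsto_intros)
      have GF: "((\<lambda>e. cmod (G (v - of_real e * v))) \<longlongrightarrow> cmod (G v)) (at_right 0)"
        "((\<lambda>e. M * cmod (F (v - of_real e * v)) * e ^ (m - p - 1)) \<longlongrightarrow> M * cmod (F v) * 0 ^ (m - p - 1)) (at_right 0)"
      proof -
        have "isCont G v"
          by (rule continuous_on_interior[OF holomorphic_on_imp_continuous_on[OF G]]) (use s in simp)
        moreover have "isCont F v"
          by (rule continuous_on_interior[OF holomorphic_on_imp_continuous_on[OF F]]) (use r in simp)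
        ultimately have "isCont G (v - of_real 0 * v)" "isCont F (v - of_real 0 * v)" by simp_all
        from isCont_tendsto_compose[OF this(1) lim] isCont_tendsto_compose[OF this(2) lim]
        show "((\<lambda>e. cmod (G (v - of_real e * v))) \<longlongrightarrow> cmod (G v)) (at_right 0)"
          "((\<lambda>e. M * cmod (F (v - of_real e * v)) * e ^ (m - p - 1)) \<longlongrightarrow> M * cmod (F v) * 0 ^ (m - p - 1)) (at_right 0)"
          by (auto intro!: tendsto_intros)
      qed
      have "cmod (G v) \<le> M * cmod (F v) * 0 ^ (m - p - 1)"
      proof (rule tendsto_le[OF _ GF(2,1)])
        have "eventually (\<lambda>e. e \<in> {0<..<min (min 1 r) s}) (at_right 0)"
          using r s by (intro eventually_at_right_real) auto
        then show "\<forall>\<^sub>F e in at_right 0. cmod (G (v - of_real e * v)) \<le> M * cmod (F (v - of_real e * v)) * e ^ (m - p - 1)"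
        proof eventually_elim
          case (elim e)
          define z where "z = v - of_real e * v"
          have e: "0 < e" "e < min 1 r" "e < s" using elim by auto
          have z: "z \<in> cball v r" "z \<in> cball v s" "cmod z = 1 - e" "cmod z < 1" and zv: "cmod (z - v) = e"
            using pts[OF e(1,2)] e v by (simp_all add: z_def dist_norm norm_mult)
          have "cmod (G z) * e ^ p = cmod (g z)"
            using gG[OF z(2)] by (simp add: norm_mult norm_power zv)
          also have "\<dots> = cmod (\<phi> z) * (cmod (F z) * e ^ m)"
            using \<phi>(1)[OF z(4)] fF[OF z(1)] by (metis norm_mult norm_power zv)
          also have "\<dots> \<le> M / e * (cmod (F z) * e ^ m)"
            using \<phi>(2)[OF z(4)] e z(3) by (intro mult_right_mono) auto
          also have "\<dots> = (M * cmod (F z) * e ^ (m - p - 1)) * e ^ p"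
          proof -
            have "e ^ m = e * e ^ p * e ^ (m - p - 1)"
              using mp(1) by (metis power_Suc power_add)
            then show ?thesis using e by simp
          qed
          finally show ?case using e unfolding z_def[symmetric] by (simp add: mult_le_cancel_right)
        qed
      qed simp
      then have "G v = 0" using mp(2) by (simp add: power_0_left)
      then show False using gG[of v] s by simp
    qed
    then have "g z = (z - v) ^ (m - 1) * (G z * (z - v) ^ (p - (m - 1)))" if "z \<in> cball v s" for z
      using gG[OF that] by (simp add: mult_ac flip: power_add)
    moreover have "(\<lambda>z. G z * (z - v) ^ (p - (m - 1))) holomorphic_on ball v (min r s)"
      by (intro holomorphic_intros holomorphic_on_subset[OF G]) auto
    ultimately show ?thesis using r s
      by (intro exI[of _ "min r s"] exI[of _ "\<lambda>z. G z * (z - v) ^ (p - (m - 1))"]) auto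
  qed
  then obtain r' k where r': "0 < r'" "r' \<le> r" and k: "k holomorphic_on ball v r'"
    and gk: "\<And>z. z \<in> ball v r' \<Longrightarrow> g z = (z - v) ^ (m - 1) * k z" by blast
  have F': "F holomorphic_on ball v r'" using F by (rule holomorphic_on_subset) (use r' in auto)
  have fF': "f z = (z - v) ^ m * F z" "F z \<noteq> 0" if "z \<in> ball v r'" for z
    using fF[of z] that r' by (auto simp: mult.commute)
  define \<kappa> where "\<kappa> z = k z / F z" for z
  have \<kappa>: "\<kappa> holomorphic_on ball v r'"
    unfolding \<kappa>_def using fF' by (intro holomorphic_intros k F') auto
  have df: "(deriv ^^ m) f v = fact m * F v"
    by (rule higher_deriv_shifted_power_mult[OF F' r'(1) fF'(1)])
  have dg: "(deriv ^^ (m - 1)) g v = fact (m - 1) * k v"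
    by (rule higher_deriv_shifted_power_mult[OF k r'(1) gk])
  \<comment> \<open>The factorials cancel: X = -m (m-1)! k(v) / (2 v m! F(v)) = -k(v) / (2 v F(v)),
    so -2 v X is the residue of the quotient at \<open>v\<close>.\<close>
  have "fact m = (of_nat m * fact (m - 1) :: complex)"
    using m0 by (simp add: fact_reduce)
  then have X': "- 2 * v * X = \<kappa> v"
    unfolding X df dg \<kappa>_def using m0 v0 fF'(2)[of v] r' by (simp add: field_simps)
  define h where "h = (\<lambda>z. if z = v then deriv \<kappa> v else (\<kappa> z - \<kappa> v) / (z - v))"
  have "h holomorphic_on ball v r'"
    unfolding h_def by (rule pole_lemma_open[OF \<kappa>]) simp
  then have "h analytic_on {v}"
    using r' by (intro holomorphic_on_imp_analytic_at[of _ "ball v r'"]) auto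
  moreover have "\<forall>\<^sub>F z in at v. f z \<noteq> 0 \<and> g z / f z = - 2 * v * X / (z - v) + h z"
  proof -
    have "\<forall>\<^sub>F z in at v. z \<in> ball v r' - {v}"
      using r' by (intro eventually_at_in_open) auto
    then show ?thesis
    proof eventually_elim
      case (elim z)
      then have z: "z \<in> ball v r'" "z - v \<noteq> 0" by auto
      have "(z - v) ^ m = (z - v) * (z - v) ^ (m - 1)" using m0 by (cases m) auto
      then have "g z / f z = \<kappa> z / (z - v)"
        using z fF'[OF z(1)] gk[OF z(1)] by (simp add: \<kappa>_def)
      also have "\<dots> = \<kappa> v / (z - v) + h z"
        using z by (simp add: h_def diff_divide_distrib)
      finally show ?case using z fF'[OF z(1)] by (simp only: X') simp
    qed
  qed
  ultimately show ?thesis by blast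
qed

text \<open>Approaching \<open>v\<close> along v - e u v with u = 1 / s stays in the disk for small
  e when Re u > 0. Multiplied by e, the values of \<phi> tend to 2 \<xi> s, so Re (\<xi> s) \<ge> 0
  for every s in the right half-plane. Only non-negative reals \<xi> have this property.\<close>

lemma residue_nonneg:
  fixes \<phi> :: "complex \<Rightarrow> complex"
  assumes v: "cmod v = 1" and pos: "\<And>z. cmod z < 1 \<Longrightarrow> 0 \<le> Re (\<phi> z)"
    and h: "isCont h v"
    and eq: "\<forall>\<^sub>F z in at v. cmod z < 1 \<longrightarrow> \<phi> z = - 2 * v * \<xi> / (z - v) + h z"
  shows "0 \<le> Re \<xi>" "Im \<xi> = 0"
proof -
  have v0: "v \<noteq> 0" using v by auto
  have s: "0 \<le> Re (\<xi> * s)" if s: "0 < Re s" for s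
  proof -
    define u where "u = 1 / s"
    have s0: "s \<noteq> 0" using s by auto
    have u: "u \<noteq> 0" "0 < Re u" using s s0 by (auto simp: u_def Re_divide sum_power2_gt_zero_iff power2_eq_square[symmetric] intro!: divide_pos_pos)
    define Z where "Z e = v - of_real e * u * v" for e
    have lim: "(Z \<longlongrightarrow> v) (at_right 0)"
    proof -
      have "((\<lambda>e. v - of_real e * u * v) \<longlongrightarrow> v - of_real 0 * u * v) (at_right 0)"
        by (intro tendsto_intros)
      then show ?thesis by (simp add: Z_def[abs_def])
    qed
    have ne: "\<forall>\<^sub>F e in at_right 0. Z e \<noteq> v"
      using eventually_at_right_less[of 0] by eventually_elim (use u v0 in \<open>auto simp: Z_def\<close>)
    have limat: "filterlim Z (at v) (at_right 0)"
      using lim ne by (simp add: filterlim_at)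
    have ev1: "\<forall>\<^sub>F e in at_right 0. cmod (Z e) < 1 \<longrightarrow> \<phi> (Z e) = - 2 * v * \<xi> / (Z e - v) + h (Z e)"
      using filterlim_iff[THEN iffD1, OF limat] eq by blast
    \<comment> \<open>From |1 - e u|^2 = 1 - 2 e Re u + e^2 |u|^2: this range of \<open>e\<close>
      keeps the points inside the disk.\<close>
    have "\<forall>\<^sub>F e in at_right 0. e \<in> {0<..<Re u / (cmod u)\<^sup>2}"
      using u by (intro eventually_at_right_real) auto
    then have ev2: "\<forall>\<^sub>F e in at_right 0. 0 < e \<and> cmod (Z e) < 1"
    proof eventually_elim
      case (elim e)
      then have e: "0 < e" "e * (cmod u)\<^sup>2 < Re u" using u by (auto simp: pos_less_divide_eq)
      have "Z e = (1 - of_real e * u) * v" by (simp add: Z_def algebra_simps)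
      then have "cmod (Z e) = cmod (1 - of_real e * u)" using v by (simp add: norm_mult)
      moreover have "(cmod (1 - of_real e * u))\<^sup>2 = 1 - 2 * e * Re u + e * (e * (cmod u)\<^sup>2)"
        unfolding cmod_power2 by (simp add: power2_eq_square algebra_simps)
      moreover have "e * (e * (cmod u)\<^sup>2) < e * Re u" using e by simp
      moreover have "0 < e * Re u" using e u by simp
      ultimately have "(cmod (Z e))\<^sup>2 < 1\<^sup>2" by simp
      then show ?case using e(1) by (metis norm_ge_zero power_less_imp_less_base zero_le_one)
    qed
    have ev: "\<forall>\<^sub>F e in at_right 0. 0 \<le> Re (2 * \<xi> * s + of_real e * h (Z e))"
      using ev1 ev2
    proof eventually_elim
      case (elim e)
      have "- 2 * v * \<xi> / (Z e - v) = 2 * \<xi> * s / of_real e"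
        using v0 s0 elim by (simp add: Z_def u_def field_simps)
      then have "2 * \<xi> * s + of_real e * h (Z e) = of_real e * \<phi> (Z e)"
        using elim by (simp add: algebra_simps)
      then show ?case using pos[of "Z e"] elim by simp
    qed
    have "((\<lambda>e. Re (2 * \<xi> * s + of_real e * h (Z e))) \<longlongrightarrow> Re (2 * \<xi> * s + of_real 0 * h v)) (at_right 0)"
      by (intro tendsto_intros isCont_tendsto_compose[OF h lim])
    from tendsto_lowerbound[OF this ev] show ?thesis by (simp add: mult.assoc)
  qed
  show Re: "0 \<le> Re \<xi>" using s[of 1] by simp
  show "Im \<xi> = 0"
  proof (rule ccontr)
    assume "Im \<xi> \<noteq> 0"
    \<comment> \<open>For this \<open>s\<close> the real part of \<xi> s is Re \<xi> - (Re \<xi> +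
      1) = -1.\<close>
    then show False using s[of "Complex 1 ((Re \<xi> + 1) / Im \<xi>)"] by simp
  qed
qed

section \<open>The central function\<close>

lemma sform_hermitian_part:
  "sform (\<lambda>r s. (K r s + cnj (K s r)) / 2) I x x = of_real (Re (sform K I x x))"
proof -
  have "(\<Sum>r\<in>I. \<Sum>s\<in>I. cnj (K s r) * (cnj (x r) * x s)) = (\<Sum>s\<in>I. \<Sum>r\<in>I. cnj (K s r) * (cnj (x r) * x s))"
    by (rule sum.swap)
  also have "\<dots> = cnj (sform K I x x)"
    by (simp add: sform_def sum_distrib_left mult_ac)
  finally have *: "(\<Sum>r\<in>I. \<Sum>s\<in>I. cnj (K s r) * (cnj (x r) * x s)) = cnj (sform K I x x)" .
  have "sform (\<lambda>r s. (K r s + cnj (K s r)) / 2) I x x =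
      (\<Sum>r\<in>I. \<Sum>s\<in>I. K r s * (cnj (x r) * x s) / 2 + cnj (K s r) * (cnj (x r) * x s) / 2)"
    unfolding sform_def sum_distrib_left by (intro sum.cong refl) (simp add: field_simps)
  also have "\<dots> = (\<Sum>r\<in>I. \<Sum>s\<in>I. K r s * (cnj (x r) * x s)) / 2
      + (\<Sum>r\<in>I. \<Sum>s\<in>I. cnj (K s r) * (cnj (x r) * x s)) / 2"
    by (simp only: sum.distrib sum_divide_distrib)
  also have "(\<Sum>r\<in>I. \<Sum>s\<in>I. K r s * (cnj (x r) * x s)) = sform K I x x"
    by (simp add: sform_def sum_distrib_left mult_ac)
  also have "sform K I x x / 2 + (\<Sum>r\<in>I. \<Sum>s\<in>I. cnj (K s r) * (cnj (x r) * x s)) / 2 =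
      (sform K I x x + cnj (sform K I x x)) / 2"
    by (simp only: * add_divide_distrib)
  also have "\<dots> = of_real (Re (sform K I x x))"
    by (simp only: complex_add_cnj) simp
  finally show ?thesis .
qed

lemma holomorphic_on_det:
  assumes "\<And>z. B z \<in> carrier_mat m m" "\<And>i j. i < m \<Longrightarrow> j < m \<Longrightarrow> (\<lambda>z. B z $$ (i, j)) holomorphic_on S"
  shows "(\<lambda>z. det (B z :: complex mat)) holomorphic_on S"
proof -
  have "(\<lambda>z. \<Sum>p | p permutes {0..<m}. of_int (sign p) * (\<Prod>i = 0..<m. B z $$ (i, p i))) holomorphic_on S"
  proof (intro holomorphic_intros assms(2))
    fix p i assume "p \<in> {p. p permutes {0..<m}}" "i \<in> {0..<m}"
    then show "i < m" "p i < m" using permutes_in_image[of p "{0..<m}" i] by auto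
  qed
  then show ?thesis by (simp add: det_def'[OF assms(1)])
qed

lemma holomorphic_on_adj_mat:
  assumes B: "\<And>z. B z \<in> carrier_mat m m" "\<And>i j. i < m \<Longrightarrow> j < m \<Longrightarrow> (\<lambda>z. B z $$ (i, j)) holomorphic_on S"
    and ij: "i < m" "j < m"
  shows "(\<lambda>z. adj_mat (B z :: complex mat) $$ (i, j)) holomorphic_on S"
proof -
  have c: "mat_delete (B z) j i \<in> carrier_mat (m - 1) (m - 1)" for z
    using B(1)[of z] by (simp add: mat_delete_def)
  have "(\<lambda>z. det (mat_delete (B z) j i)) holomorphic_on S"
  proof (rule holomorphic_on_det[OF c])
    fix k l assume kl: "k < m - 1" "l < m - 1"
    have "(\<lambda>z. B z $$ (if k < j then k else Suc k, if l < i then l else Suc l)) holomorphic_on S"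
      by (rule B(2)) (use kl in auto)
    moreover have "dim_row (B z) = m" "dim_col (B z) = m" for z using B(1)[of z] by auto
    ultimately show "(\<lambda>z. mat_delete (B z) j i $$ (k, l)) holomorphic_on S"
      using kl by (simp add: mat_delete_def)
  qed
  then have "(\<lambda>z. (-1) ^ (j + i) * det (mat_delete (B z) j i)) holomorphic_on S"
    by (intro holomorphic_intros)
  moreover have "dim_row (B z) = m" "dim_col (B z) = m" for z using B(1)[of z] by auto
  ultimately show ?thesis using ij by (simp add: adj_mat_def cofactor_def)
qed

lemma sums_shift_right:
  fixes f :: "nat \<Rightarrow> 'a::real_normed_vector"
  assumes "f sums s"
  shows "(\<lambda>m. if k \<le> m then f (m - k) else 0) sums s"
proof -
  have "(\<lambda>m. if k \<le> m + k then f (m + k - k) else 0) sums s" using assms by simp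
  then show ?thesis
    by (subst (asm) sums_zero_iff_shift) auto
qed

locale central =
  fixes n q :: nat and \<Gamma> :: "nat \<Rightarrow> complex mat"
  assumes n: "1 \<le> n" and q: "1 \<le> q" and carath: "caratheodory_sequence q n \<Gamma>"
begin

section \<open>Non-negativity of the continued block Toeplitz matrices\<close>

abbreviation C :: "nat \<Rightarrow> complex mat" where
  "C \<equiv> central_C q n \<Gamma>"

abbreviation G :: "nat \<Rightarrow> complex mat" where
  "G \<equiv> central_continuation q n \<Gamma>"

lemma \<Gamma>_carrier: "j \<le> n \<Longrightarrow> \<Gamma> j \<in> carrier_mat q q"
  using carath by (simp add: caratheodory_sequence_def)

lemma C_0: "C 0 = re_mat (\<Gamma> 0)"
  by (simp add: central_C.simps)

lemma C_le: "1 \<le> j \<Longrightarrow> j \<le> n \<Longrightarrow> C j = (1 / 2) \<cdot>\<^sub>m \<Gamma> j"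
  by (simp add: central_C.simps)

lemma C_step:
  assumes "n \<le> m"
  shows "C (Suc m) = central_step q C m"
proof -
  have "C (Suc m) = central_step q (\<lambda>i. if i < Suc m then C i else 0\<^sub>m q q) m"
    by (subst central_C.simps) (use assms in auto)
  also have "\<dots> = central_step q C m"
    by (rule central_step_cong) (use assms n in auto)
  finally show ?thesis .
qed

lemma C_carrier: "C j \<in> carrier_mat q q"
proof -
  consider "j = 0" | "1 \<le> j" "j \<le> n" | m where "j = Suc m" "n \<le> m"
    using not_less_eq_eq by (cases j) (simp, force)
  then show ?thesis
  proof cases
    case 1
    then show ?thesis by (simp add: C_0 \<Gamma>_carrier)
  next
    case 2
    then show ?thesis by (simp add: C_le \<Gamma>_carrier)
  next
    case 3
    then show ?thesis
      by (intro carrier_matI) (simp_all add: C_step central_step_def Z_mat_def Y_mat_def)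
  qed
qed

sublocale block_sequence q C
  by unfold_locales (use q C_carrier in auto)

text \<open>Index 0 is exceptional: \<open>C 0\<close> is only the Hermitian part of
  \<open>\<Gamma> 0\<close>. The skew part is invisible to the Toeplitz matrices and reappears as
  the term with \<open>im_mat\<close> in the Riesz-Herglotz formula.\<close>

lemma G_eq:
  assumes "i < q" "k < q"
  shows "G j $$ (i, k) = (if j = 0 then \<Gamma> 0 $$ (i, k) else 2 * C j $$ (i, k))"
  using assms C_carrier[of j] \<Gamma>_carrier[of j]
  by (auto simp: central_continuation_def C_le)

lemma C_index:
  assumes "1 \<le> j" "j \<le> n" "i < q" "k < q"
  shows "\<Gamma> j $$ (i, k) = 2 * C j $$ (i, k)"
  using assms \<Gamma>_carrier[of j] by (simp add: C_le)

lemma C_0_index: "i < q \<Longrightarrow> k < q \<Longrightarrow> C 0 $$ (i, k) = (\<Gamma> 0 $$ (i, k) + cnj (\<Gamma> 0 $$ (k, i))) / 2"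
  by (simp add: C_0 re_mat_index[OF \<Gamma>_carrier])

text \<open>The Hermitian part of \<open>S_mat\<close> is the Toeplitz matrix of the C_j: off the
  diagonal a block is half of one \<Gamma>_j or of its adjoint, and on the diagonal it is the
  Hermitian part of \<open>\<Gamma> 0\<close>.\<close>

lemma psd_initial:
  assumes "m \<le> n"
  shows "psd_on (blk C) (I (m + 1))"
proof -
  let ?S = "S_mat q \<Gamma> m"
  have "nonneg_hermitian ((m + 1) * q) (re_mat ?S)"
    using carath assms by (simp add: caratheodory_sequence_def)
  then have "psd_on (\<lambda>r s. re_mat ?S $$ (r, s)) {..<(m + 1) * q}"
    using nonneg_hermitian_iff_psd_on[OF re_mat_carrier[OF S_mat_carrier[of q \<Gamma> m]]] by blast
  also have "psd_on (\<lambda>r s. re_mat ?S $$ (r, s)) {..<(m + 1) * q} \<longleftrightarrow>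
      psd_on (\<lambda>r s. blk C (r div q, r mod q) (s div q, s mod q)) {..<(m + 1) * q}"
  proof (rule psd_on_cong)
    fix r s assume "r \<in> {..<(m + 1) * q}" "s \<in> {..<(m + 1) * q}"
    then have rs: "r < (m + 1) * q" "s < (m + 1) * q" by auto
    then have d: "r div q \<le> m" "s div q \<le> m" "r mod q < q" "s mod q < q"
      using less_mult_imp_div_less[of r "m + 1" q] less_mult_imp_div_less[of s "m + 1" q] q_pos by simp_all
    have re: "re_mat ?S $$ (r, s) = (?S $$ (r, s) + cnj (?S $$ (s, r))) / 2"
      by (rule re_mat_index[OF S_mat_carrier rs])
    show "re_mat ?S $$ (r, s) = blk C (r div q, r mod q) (s div q, s mod q)"
    proof (cases "r div q" "s div q" rule: linorder_cases)
      case less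
      then have "\<Gamma> (s div q - r div q) $$ (s mod q, r mod q) = 2 * C (s div q - r div q) $$ (s mod q, r mod q)"
        by (intro C_index) (use d assms less in auto)
      then show ?thesis using less rs unfolding re by (simp add: S_mat_index blk_def)
    next
      case equal
      then show ?thesis using rs d unfolding re by (simp add: S_mat_index blk_def C_0_index)
    next
      case greater
      then have "\<Gamma> (r div q - s div q) $$ (r mod q, s mod q) = 2 * C (r div q - s div q) $$ (r mod q, s mod q)"
        by (intro C_index) (use d assms greater in auto)
      then show ?thesis using greater rs unfolding re by (simp add: S_mat_index blk_def)
    qed
  qed
  also have "\<dots> \<longleftrightarrow> psd_on (blk C) (I (m + 1))"
    by (rule psd_on_div_mod[OF q_pos])
  finally show ?thesis .
qed

lemma psd_all: "psd_on (blk C) (I m)"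
proof (induction m)
  case 0
  show ?case by (rule psd_on_subset[OF psd_initial[of 0]]) auto
next
  case (Suc m)
  show ?case
  proof (cases "m \<le> n")
    case True
    then show ?thesis using psd_initial[of m] by simp
  next
    case False
    then obtain k where k: "m = Suc k" "n \<le> k" by (cases m) auto
    have "psd_on (blk C) (I (k + 2))"
      by (rule psd_on_step[OF _ _ C_step]) (use k n Suc in auto)
    then show ?thesis using k by simp
  qed
qed

abbreviation W :: "nat \<times> nat \<Rightarrow> nat \<Rightarrow> complex" where
  "W \<equiv> w n"

lemma C_recurrence:
  "i < q \<Longrightarrow> a < q \<Longrightarrow> C (Suc m) $$ (i, a) = (\<Sum>p\<in>I n. blk C (m, i) p * W p a)"
  by (rule recurrence[OF n psd_all C_step])

lemma W_carrier: "W_mat q C n \<in> carrier_mat (n * q) q"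
  by (rule W_mat_solves(1)[OF n psd_all])

section \<open>The entries of \<open>a_fun\<close> and \<open>b_fun\<close> as polynomials\<close>

lemma sum_I_split: "(\<Sum>p\<in>I m. g p) = (\<Sum>l<m. \<Sum>k<q. g (l, k))"
  by (simp add: sum.cartesian_product)

lemma mp_carrier: "moore_penrose (T_mat q C (n - 1)) \<in> carrier_mat (n * q) (n * q)"
  and e_carrier: "e_mat q (n - 1) z \<in> carrier_mat q (n * q)"
  and Y_carrier: "Y_mat q C n \<in> carrier_mat (n * q) q"
  and S_carrier: "S_mat q \<Gamma> (n - 1) \<in> carrier_mat (n * q) (n * q)"
proof -
  have nn: "n - 1 + 1 = n" using n by simp
  show "moore_penrose (T_mat q C (n - 1)) \<in> carrier_mat (n * q) (n * q)"
    by (rule T_mat_pred(3)[OF n psd_all])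
  show "e_mat q (n - 1) z \<in> carrier_mat q (n * q)" unfolding e_mat_def nn by simp
  show "Y_mat q C n \<in> carrier_mat (n * q) q" by (simp add: Y_mat_def)
  show "S_mat q \<Gamma> (n - 1) \<in> carrier_mat (n * q) (n * q)"
    using S_mat_carrier[of q \<Gamma> "n - 1"] by (simp only: nn)
qed

lemma e_mult_index:
  assumes B: "B \<in> carrier_mat (n * q) m" and "i < q" "a < m"
  shows "(e_mat q (n - 1) z * B) $$ (i, a) = (\<Sum>l<n. z ^ l * B $$ (l * q + i, a))"
proof -
  have nn: "n - 1 + 1 = n" using n by simp
  have "(e_mat q (n - 1) z * B) $$ (i, a) = (\<Sum>s<n * q. e_mat q (n - 1) z $$ (i, s) * B $$ (s, a))"
    by (rule mat_mult_index[OF e_carrier B assms(2,3)])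
  also have "\<dots> = (\<Sum>s<n * q. (if i = s mod q then z ^ (s div q) else 0) * B $$ ((s div q) * q + s mod q, a))"
    by (intro sum.cong refl) (use assms nn in \<open>simp add: e_mat_def\<close>)
  also have "\<dots> = (\<Sum>p\<in>I n. (if i = snd p then z ^ fst p else 0) * B $$ (fst p * q + snd p, a))"
    using sum_div_mod[OF q_pos, of "\<lambda>p. (if i = snd p then z ^ fst p else 0) * B $$ (fst p * q + snd p, a)" n]
    by (simp only: fst_conv snd_conv)
  also have "\<dots> = (\<Sum>l<n. \<Sum>k<q. if i = k then z ^ l * B $$ (l * q + k, a) else 0)"
    unfolding sum_I_split by (intro sum.cong refl) simp
  also have "\<dots> = (\<Sum>l<n. z ^ l * B $$ (l * q + i, a))"
    using assms by simp
  finally show ?thesis .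
qed

lemma b_carrier: "b_fun q n \<Gamma> z \<in> carrier_mat q q"
  by (intro carrier_matI) (simp_all add: b_fun_def e_mat_def Y_mat_def)

lemma b_index:
  assumes "k < q" "a < q"
  shows "b_fun q n \<Gamma> z $$ (k, a) = (if k = a then 1 else 0) - (\<Sum>l<n. z ^ Suc l * W (l, k) a)"
proof -
  have "e_mat q (n - 1) z * moore_penrose (T_mat q C (n - 1)) * Y_mat q C n = e_mat q (n - 1) z * W_mat q C n"
    unfolding W_mat_def by (rule assoc_mult_mat[OF e_carrier mp_carrier Y_carrier])
  then have "b_fun q n \<Gamma> z $$ (k, a) = (if k = a then 1 else 0) - z * (e_mat q (n - 1) z * W_mat q C n) $$ (k, a)"
    using assms e_carrier[of z] W_carrier by (simp add: b_fun_def)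
  also have "(e_mat q (n - 1) z * W_mat q C n) $$ (k, a) = (\<Sum>l<n. z ^ l * W (l, k) a)"
    using e_mult_index[OF W_carrier assms] by (simp add: w_def)
  finally show ?thesis by (simp add: sum_distrib_left mult_ac)
qed

lemma a_carrier: "a_fun q n \<Gamma> z \<in> carrier_mat q q"
  by (intro carrier_matI) (simp_all add: a_fun_def e_mat_def Y_mat_def)

lemma a_index:
  assumes "i < q" "a < q"
  shows "a_fun q n \<Gamma> z $$ (i, a) = \<Gamma> 0 $$ (i, a) +
    (\<Sum>l<n. z ^ Suc l * (\<Sum>p\<in>I n. (if l \<le> fst p then cnj (\<Gamma> (fst p - l) $$ (snd p, i)) else 0) * W p a))"
proof -
  have nn: "n - 1 + 1 = n" using n by simp
  let ?S = "mat_adjoint (S_mat q \<Gamma> (n - 1))"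
  have S: "?S \<in> carrier_mat (n * q) (n * q)" using S_carrier by simp
  have "e_mat q (n - 1) z * ?S * moore_penrose (T_mat q C (n - 1)) * Y_mat q C n = e_mat q (n - 1) z * ?S * W_mat q C n"
    unfolding W_mat_def
    by (rule assoc_mult_mat[OF mult_carrier_mat[OF e_carrier S] mp_carrier Y_carrier])
  also have "\<dots> = e_mat q (n - 1) z * (?S * W_mat q C n)"
    by (rule assoc_mult_mat[OF e_carrier S W_carrier])
  finally have "a_fun q n \<Gamma> z $$ (i, a) = \<Gamma> 0 $$ (i, a) + z * (e_mat q (n - 1) z * (?S * W_mat q C n)) $$ (i, a)"
    using assms e_carrier[of z] W_carrier S \<Gamma>_carrier[of 0] by (simp add: a_fun_def)
  also have "(e_mat q (n - 1) z * (?S * W_mat q C n)) $$ (i, a) = (\<Sum>l<n. z ^ l * (?S * W_mat q C n) $$ (l * q + i, a))"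
    by (rule e_mult_index[OF mult_carrier_mat[OF S W_carrier] assms])
  also have "\<dots> = (\<Sum>l<n. z ^ l * (\<Sum>p\<in>I n. (if l \<le> fst p then cnj (\<Gamma> (fst p - l) $$ (snd p, i)) else 0) * W p a))"
  proof (intro sum.cong refl arg_cong2[of _ _ _ _ "(*)"])
    fix l assume l: "l \<in> {..<n}"
    then have r: "l * q + i < n * q" using assms by (intro mult_add_less) auto
    have "(?S * W_mat q C n) $$ (l * q + i, a) = (\<Sum>s<n * q. ?S $$ (l * q + i, s) * W_mat q C n $$ (s, a))"
      by (rule mat_mult_index[OF S W_carrier r assms(2)])
    also have "\<dots> = (\<Sum>s<n * q. (if l \<le> s div q then cnj (\<Gamma> (s div q - l) $$ (s mod q, i)) else 0) * W (s div q, s mod q) a)"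
    proof (intro sum.cong refl arg_cong2[of _ _ _ _ "(*)"])
      fix s assume "s \<in> {..<n * q}"
      then have s: "s < n * q" by simp
      have "?S $$ (l * q + i, s) = cnj (S_mat q \<Gamma> (n - 1) $$ (s, l * q + i))"
        by (rule mat_adjoint_index) (use S_carrier r s in auto)
      also have "S_mat q \<Gamma> (n - 1) $$ (s, l * q + i) = (if l \<le> s div q then \<Gamma> (s div q - l) $$ (s mod q, i) else 0)"
        using S_mat_index[of s "n - 1" q "l * q + i" \<Gamma>] r s assms q_pos by (simp only: nn) simp
      finally show "?S $$ (l * q + i, s) = (if l \<le> s div q then cnj (\<Gamma> (s div q - l) $$ (s mod q, i)) else 0)"
        by simp
    qed (simp add: w_div_mod)
    also have "\<dots> = (\<Sum>p\<in>I n. (if l \<le> fst p then cnj (\<Gamma> (fst p - l) $$ (snd p, i)) else 0) * W p a)"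
      using sum_div_mod[OF q_pos, of "\<lambda>p. (if l \<le> fst p then cnj (\<Gamma> (fst p - l) $$ (snd p, i)) else 0) * W p a" n]
      by (simp only: fst_conv snd_conv)
    finally show "(?S * W_mat q C n) $$ (l * q + i, a) =
        (\<Sum>p\<in>I n. (if l \<le> fst p then cnj (\<Gamma> (fst p - l) $$ (snd p, i)) else 0) * W p a)" .
  qed
  finally show ?thesis by (simp add: sum_distrib_left mult_ac)
qed

text \<open>Summing over all positions gives one constant valid for every entry and every index.
  What matters later is the growth rate 1 / (1 - |z|) that it yields.\<close>

definition bound :: real where
  "bound = (\<Sum>i<q. \<Sum>k<q. cmod (\<Gamma> 0 $$ (i, k)) + 2 * (Re (C 0 $$ (i, i)) + Re (C 0 $$ (k, k))))"

text \<open>An entry of \<open>C j\<close> couples block \<open>j\<close> with block 0 of the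
  kernel, and all diagonal blocks are equal to \<open>C 0\<close>.\<close>

lemma norm_C_le:
  assumes "i < q" "k < q"
  shows "cmod (C j $$ (i, k)) \<le> Re (C 0 $$ (i, i)) + Re (C 0 $$ (k, k))"
  using psd_on_entry_bound[OF psd_all[of "Suc j"], of "(j, i)" "(0, k)"] assms by (simp add: blk_def)

lemma norm_G_le:
  assumes ik: "i < q" "k < q"
  shows "cmod (G j $$ (i, k)) \<le> bound"
proof -
  have nn: "0 \<le> Re (C 0 $$ (i, i)) + Re (C 0 $$ (k, k))" if "i < q" "k < q" for i k
    using norm_C_le[OF that, of 0] norm_ge_zero order_trans by blast
  have nonneg: "0 \<le> cmod (\<Gamma> 0 $$ (i, k)) + 2 * (Re (C 0 $$ (i, i)) + Re (C 0 $$ (k, k)))"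
    if "i < q" "k < q" for i k
    using nn[OF that] by (intro add_nonneg_nonneg) auto
  have "cmod (G j $$ (i, k)) \<le> cmod (\<Gamma> 0 $$ (i, k)) + 2 * (Re (C 0 $$ (i, i)) + Re (C 0 $$ (k, k)))"
  proof (cases "j = 0")
    case False
    then have "cmod (G j $$ (i, k)) = 2 * cmod (C j $$ (i, k))"
      by (simp add: G_eq[OF ik] norm_mult)
    also have "\<dots> \<le> 2 * (Re (C 0 $$ (i, i)) + Re (C 0 $$ (k, k)))"
      using norm_C_le[OF ik, of j] by simp
    finally show ?thesis by (rule add_increasing[OF norm_ge_zero])
  qed (use nn[OF ik] in \<open>simp add: G_eq[OF ik]\<close>)
  also have "\<dots> \<le> (\<Sum>k<q. cmod (\<Gamma> 0 $$ (i, k)) + 2 * (Re (C 0 $$ (i, i)) + Re (C 0 $$ (k, k))))"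
    by (rule member_le_sum[where f = "\<lambda>k. cmod (\<Gamma> 0 $$ (i, k)) + 2 * (Re (C 0 $$ (i, i)) + Re (C 0 $$ (k, k)))"])
       (use ik in \<open>auto simp del: distrib_left_numeral intro!: nonneg\<close>)
  also have "\<dots> \<le> bound"
    unfolding bound_def
  proof (rule member_le_sum[of i "{..<q}" "\<lambda>i. \<Sum>k<q. cmod (\<Gamma> 0 $$ (i, k)) + 2 * (Re (C 0 $$ (i, i)) + Re (C 0 $$ (k, k)))"])
    fix j assume "j \<in> {..<q} - {i}"
    then show "0 \<le> (\<Sum>k<q. cmod (\<Gamma> 0 $$ (j, k)) + 2 * (Re (C 0 $$ (j, j)) + Re (C 0 $$ (k, k))))"
      by (intro sum_nonneg nonneg) auto
  qed (use ik in auto)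
  finally show ?thesis .
qed

section \<open>The central function: growth, real part and its equation with \<open>a_fun\<close>
  and \<open>b_fun\<close>\<close>

abbreviation \<Phi> :: "complex \<Rightarrow> complex mat" where
  "\<Phi> \<equiv> central_caratheodory_function q n \<Gamma>"

lemma \<Phi>_carrier: "\<Phi> z \<in> carrier_mat q q"
  by (simp add: central_caratheodory_function_def)

lemma \<Phi>_bounds:
  assumes ik: "i < q" "k < q" and z: "cmod z < 1"
  shows "(\<lambda>j. G j $$ (i, k) * z ^ j) sums \<Phi> z $$ (i, k)" and "cmod (\<Phi> z $$ (i, k)) \<le> bound / (1 - cmod z)"
proof -
  have geo: "(\<lambda>j. bound * cmod z ^ j) sums (bound * (1 / (1 - cmod z)))"
    using z by (intro sums_mult geometric_sums) simp
  have le: "norm (G j $$ (i, k) * z ^ j) \<le> bound * cmod z ^ j" for j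
    using norm_G_le[OF ik, of j] by (simp add: norm_mult norm_power mult_right_mono)
  have "summable (\<lambda>j. G j $$ (i, k) * z ^ j)"
    by (rule summable_comparison_test'[OF sums_summable[OF geo]]) (rule le)
  moreover have eq: "\<Phi> z $$ (i, k) = (\<Sum>j. G j $$ (i, k) * z ^ j)"
    using ik by (simp add: central_caratheodory_function_def mult.commute)
  ultimately show "(\<lambda>j. G j $$ (i, k) * z ^ j) sums \<Phi> z $$ (i, k)"
    by (simp add: summable_sums)
  have "norm (\<Sum>j. G j $$ (i, k) * z ^ j) \<le> (\<Sum>j. bound * cmod z ^ j)"
    by (rule norm_suminf_le[OF le sums_summable[OF geo]])
  then show "cmod (\<Phi> z $$ (i, k)) \<le> bound / (1 - cmod z)"
    using eq sums_unique[OF geo] by simp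
qed

lemma holomorphic_\<Phi>: "i < q \<Longrightarrow> k < q \<Longrightarrow> (\<lambda>z. \<Phi> z $$ (i, k)) holomorphic_on ball 0 1"
  by (rule power_series_holomorphic[where a = "\<lambda>j. G j $$ (i, k)"]) (use \<Phi>_bounds(1) in auto)

text \<open>For fixed \<open>x\<close> the scalars c_j, the forms of C_j at \<open>x\<close>, reduce
  the claim to \<open>scalar_caratheodory\<close>: their Toeplitz form at \<open>y\<close> is the
  block form at the tensor product of \<open>y\<close> and \<open>x\<close>.\<close>

lemma Re_\<Phi>_nonneg:
  assumes z: "cmod z < 1"
  shows "0 \<le> Re (sform (\<lambda>i k. \<Phi> z $$ (i, k)) {..<q} x x)"
proof -
  define c where "c j = sform (\<lambda>i k. C j $$ (i, k)) {..<q} x x" for j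
  have sform_eq: "sform K {..<q} x x = (\<Sum>i<q. \<Sum>k<q. K i k * (cnj (x i) * x k))" for K
    by (simp add: sform_def sum_distrib_left mult_ac)
  have sums: "(\<lambda>j. sform (\<lambda>i k. G j $$ (i, k)) {..<q} x x * z ^ j) sums sform (\<lambda>i k. \<Phi> z $$ (i, k)) {..<q} x x"
  proof -
    have "(\<lambda>j. \<Sum>i<q. \<Sum>k<q. (G j $$ (i, k) * z ^ j) * (cnj (x i) * x k)) sums
        (\<Sum>i<q. \<Sum>k<q. \<Phi> z $$ (i, k) * (cnj (x i) * x k))"
      by (intro sums_sum sums_mult2 \<Phi>_bounds(1) z) auto
    moreover have "(\<Sum>i<q. \<Sum>k<q. (G j $$ (i, k) * z ^ j) * (cnj (x i) * x k)) =
        sform (\<lambda>i k. G j $$ (i, k)) {..<q} x x * z ^ j" for j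
      by (simp add: sform_eq sum_distrib_left sum_distrib_right mult_ac)
    ultimately show ?thesis by (simp add: sform_eq)
  qed
  have cG: "sform (\<lambda>i k. G j $$ (i, k)) {..<q} x x = 2 * c j" if "0 < j" for j
    using that by (simp add: c_def sform_eq G_eq sum_distrib_left mult_ac)
  \<comment> \<open>The form of \<open>G 0\<close> is that of \<open>\<Gamma> 0\<close>, which need
    not be Hermitian; it shares with \<open>c 0\<close> its real part, which is all that
    enters.\<close>
  have c0: "Re (sform (\<lambda>i k. G 0 $$ (i, k)) {..<q} x x) = Re (c 0)"
  proof -
    let ?s = "sform (\<lambda>i k. \<Gamma> 0 $$ (i, k)) {..<q} x x"
    have "c 0 = sform (\<lambda>i k. (\<Gamma> 0 $$ (i, k) + cnj (\<Gamma> 0 $$ (k, i))) / 2) {..<q} x x"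
      unfolding c_def by (rule sform_cong) (auto simp: C_0_index)
    then have "Re (c 0) = Re ?s" by (simp add: sform_hermitian_part)
    moreover have "sform (\<lambda>i k. G 0 $$ (i, k)) {..<q} x x = ?s"
      by (rule sform_cong) (auto simp: G_eq)
    ultimately show ?thesis by simp
  qed
  have "(\<lambda>j. sform (\<lambda>i k. G (Suc j) $$ (i, k)) {..<q} x x * z ^ Suc j) sums
      (sform (\<lambda>i k. \<Phi> z $$ (i, k)) {..<q} x x - sform (\<lambda>i k. G 0 $$ (i, k)) {..<q} x x)"
    using sums by (subst sums_Suc_iff) simp
  then have "(\<lambda>j. 2 * (c (Suc j) * z ^ Suc j)) sums
      (sform (\<lambda>i k. \<Phi> z $$ (i, k)) {..<q} x x - sform (\<lambda>i k. G 0 $$ (i, k)) {..<q} x x)"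
    by (simp only: cG zero_less_Suc mult.assoc)
  from sums_divide[OF this, of 2]
  have t: "(\<lambda>j. c (Suc j) * z ^ Suc j) sums
      ((sform (\<lambda>i k. \<Phi> z $$ (i, k)) {..<q} x x - sform (\<lambda>i k. G 0 $$ (i, k)) {..<q} x x) / 2)" (is "_ sums ?t")
    by simp
  have "0 \<le> Re (c 0) + 2 * Re ?t"
  proof (rule scalar_caratheodory[OF _ z t])
    fix m
    let ?K = "\<lambda>j l. if l \<le> j then c (j - l) else cnj (c (l - j))"
    have K: "?K j l = (\<Sum>i<q. cnj (x i) * (\<Sum>k<q. blk C (j, i) (l, k) * x k))" for j l
    proof (cases "l \<le> j")
      case False
      have "cnj (c (l - j)) = (\<Sum>k<q. \<Sum>i<q. cnj (C (l - j) $$ (k, i)) * (x k * cnj (x i)))"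
        by (simp add: c_def sform_eq)
      also have "\<dots> = (\<Sum>i<q. \<Sum>k<q. cnj (C (l - j) $$ (k, i)) * (x k * cnj (x i)))"
        by (rule sum.swap)
      finally show ?thesis using False by (simp add: blk_def sum_distrib_left mult_ac)
    qed (simp add: c_def sform_def blk_def)
    have form: "sform ?K {..<m} y y = sform (blk C) (I m) (\<lambda>p. y (fst p) * x (snd p)) (\<lambda>p. y (fst p) * x (snd p))" for y
    proof -
      have "sform ?K {..<m} y y = (\<Sum>j<m. \<Sum>l<m. \<Sum>i<q. \<Sum>k<q. cnj (y j) * (cnj (x i) * (blk C (j, i) (l, k) * (y l * x k))))"
        unfolding sform_def K by (simp add: sum_distrib_left sum_distrib_right mult_ac)
      also have "\<dots> = (\<Sum>j<m. \<Sum>i<q. \<Sum>l<m. \<Sum>k<q. cnj (y j) * (cnj (x i) * (blk C (j, i) (l, k) * (y l * x k))))"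
        by (rule sum.cong[OF refl]) (rule sum.swap)
      also have "\<dots> = sform (blk C) (I m) (\<lambda>p. y (fst p) * x (snd p)) (\<lambda>p. y (fst p) * x (snd p))"
        unfolding sform_def sum_I_split by (simp add: sum_distrib_left mult_ac)
      finally show ?thesis .
    qed
    show "psd_on ?K {..<m}"
      by (intro psd_onI_sform) (simp_all add: form psd_on_Im[OF psd_all] psd_on_nonneg[OF psd_all])
  qed
  then show ?thesis using c0 by (simp add: diff_divide_distrib)
qed

text \<open>
  Beyond degree \<open>n\<close> the coefficients of the product vanish by the recurrence; up to degree \<open>n\<close> the
  part of \<open>C\<^sub>m = \<Sum>\<^sub>l C\<^bsub>m-1-l\<^esub> W\<^sub>l\<close> with negative indices \<open>C\<^bsub>-j\<^esub> = C\<^sub>j\<^sup>*\<close> produces \<open>a\<^sub>n\<close>.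
\<close>
lemma \<Phi>_mult_b:
  assumes z: "cmod z < 1"
  shows "\<Phi> z * b_fun q n \<Gamma> z = a_fun q n \<Gamma> z"
proof (rule eq_matI)
  fix i a assume "i < dim_row (a_fun q n \<Gamma> z)" "a < dim_col (a_fun q n \<Gamma> z)"
  then have ia: "i < q" "a < q" using a_carrier[of z] by auto
  define A where "A m = (if m = 0 then \<Gamma> 0 $$ (i, a) else if m \<le> n then
    (\<Sum>p\<in>I n. (if m - 1 \<le> fst p then cnj (\<Gamma> (fst p - (m - 1)) $$ (snd p, i)) else 0) * W p a) else 0)" for m
  have coeff: "G m $$ (i, a) - (\<Sum>p\<in>I n. (if Suc (fst p) \<le> m then G (m - Suc (fst p)) $$ (i, snd p) else 0) * W p a) = A m" for m
  proof (cases m)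
    case 0
    then show ?thesis using ia by (simp add: A_def G_eq)
  next
    case (Suc j)
    \<comment> \<open>For fst p < j only the first summand is present, for fst p > j only the
      second. For fst p = j both are, and together they are 2 C_0, that is, \<Gamma>_0 plus its
      adjoint.\<close>
    have split: "2 * blk C (j, i) p = (if fst p \<le> j then G (j - fst p) $$ (i, snd p) else 0)
        + (if j \<le> fst p then cnj (\<Gamma> (fst p - j) $$ (snd p, i)) else 0)" if p: "p \<in> I n" for p
    proof -
      obtain l k where lk: "p = (l, k)" "l < n" "k < q" using p by auto
      consider "l < j" | "l = j" | "j < l" by linarith
      then show ?thesis
      proof cases
        case 3
        then have "\<Gamma> (l - j) $$ (k, i) = 2 * C (l - j) $$ (k, i)"
          by (intro C_index) (use lk ia 3 in auto)
        then show ?thesis using 3 by (simp add: lk blk_def)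
      qed (use lk ia in \<open>auto simp: blk_def G_eq C_0_index\<close>)
    qed
    have "G m $$ (i, a) = (\<Sum>p\<in>I n. 2 * blk C (j, i) p * W p a)"
      using ia by (simp add: Suc G_eq C_recurrence sum_distrib_left mult.assoc)
    also have "\<dots> = (\<Sum>p\<in>I n. (if fst p \<le> j then G (j - fst p) $$ (i, snd p) else 0) * W p a)
        + (\<Sum>p\<in>I n. (if j \<le> fst p then cnj (\<Gamma> (fst p - j) $$ (snd p, i)) else 0) * W p a)"
      by (simp only: sum.distrib[symmetric] distrib_right[symmetric])
         (intro sum.cong refl arg_cong2[of _ _ _ _ "(*)"] split)
    also have "(\<Sum>p\<in>I n. (if j \<le> fst p then cnj (\<Gamma> (fst p - j) $$ (snd p, i)) else 0) * W p a) = A m"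
    proof (cases "m \<le> n")
      case False
      then have "(\<Sum>p\<in>I n. (if j \<le> fst p then cnj (\<Gamma> (fst p - j) $$ (snd p, i)) else 0) * W p a) = 0"
        using Suc by (intro sum.neutral) auto
      then show ?thesis using False by (simp add: A_def Suc)
    qed (simp add: A_def Suc cong: if_cong)
    finally show ?thesis by (simp add: Suc cong: if_cong)
  qed
  have "(\<lambda>m. G m $$ (i, a) * z ^ m - (\<Sum>p\<in>I n. (if Suc (fst p) \<le> m then G (m - Suc (fst p)) $$ (i, snd p) * z ^ (m - Suc (fst p)) else 0) * (z ^ Suc (fst p) * W p a)))
      sums (\<Phi> z $$ (i, a) - (\<Sum>p\<in>I n. \<Phi> z $$ (i, snd p) * (z ^ Suc (fst p) * W p a)))"
  proof (intro sums_diff sums_sum sums_mult2)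
    show "(\<lambda>m. G m $$ (i, a) * z ^ m) sums \<Phi> z $$ (i, a)" by (rule \<Phi>_bounds(1)[OF ia z])
    fix p assume "p \<in> I n"
    then have "snd p < q" by auto
    from sums_shift_right[OF \<Phi>_bounds(1)[OF ia(1) this z], of "Suc (fst p)"]
    show "(\<lambda>m. if Suc (fst p) \<le> m then G (m - Suc (fst p)) $$ (i, snd p) * z ^ (m - Suc (fst p)) else 0) sums \<Phi> z $$ (i, snd p)" .
  qed
  moreover have "G m $$ (i, a) * z ^ m - (\<Sum>p\<in>I n. (if Suc (fst p) \<le> m then G (m - Suc (fst p)) $$ (i, snd p) * z ^ (m - Suc (fst p)) else 0) * (z ^ Suc (fst p) * W p a)) = A m * z ^ m" for m
  proof -
    have "(if Suc (fst p) \<le> m then G (m - Suc (fst p)) $$ (i, snd p) * z ^ (m - Suc (fst p)) else 0) * (z ^ Suc (fst p) * W p a)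
        = (if Suc (fst p) \<le> m then G (m - Suc (fst p)) $$ (i, snd p) else 0) * W p a * z ^ m" for p
    proof (cases "Suc (fst p) \<le> m")
      case True
      then have "z ^ m = z ^ (m - Suc (fst p)) * z ^ Suc (fst p)" by (metis le_add_diff_inverse2 power_add)
      then show ?thesis using True by (simp only: if_True mult_ac)
    qed simp
    then show ?thesis by (simp only: coeff[symmetric] left_diff_distrib sum_distrib_right)
  qed
  ultimately have lhs: "(\<lambda>m. A m * z ^ m) sums (\<Phi> z $$ (i, a) - (\<Sum>p\<in>I n. \<Phi> z $$ (i, snd p) * (z ^ Suc (fst p) * W p a)))"
    by (simp only:)
  have "(\<lambda>m. A m * z ^ m) sums (\<Sum>m\<le>n. A m * z ^ m)"
    by (rule sums_finite) (auto simp: A_def)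
  then have eq: "\<Phi> z $$ (i, a) - (\<Sum>p\<in>I n. \<Phi> z $$ (i, snd p) * (z ^ Suc (fst p) * W p a)) = (\<Sum>m\<le>n. A m * z ^ m)"
    using lhs sums_unique2 by blast
  have "(\<Sum>m\<le>n. A m * z ^ m) = A 0 + (\<Sum>l<n. A (Suc l) * z ^ Suc l)"
    by (simp add: sum.atMost_shift)
  also have "\<dots> = a_fun q n \<Gamma> z $$ (i, a)"
    using ia by (simp add: a_index A_def mult.commute cong: if_cong)
  finally have rhs: "(\<Sum>m\<le>n. A m * z ^ m) = a_fun q n \<Gamma> z $$ (i, a)" .
  have "(\<Phi> z * b_fun q n \<Gamma> z) $$ (i, a) = (\<Sum>k<q. \<Phi> z $$ (i, k) * b_fun q n \<Gamma> z $$ (k, a))"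
    by (rule mat_mult_index[OF \<Phi>_carrier b_carrier ia])
  also have "\<dots> = (\<Sum>k<q. (if k = a then \<Phi> z $$ (i, k) else 0) - (\<Sum>l<n. \<Phi> z $$ (i, k) * (z ^ Suc l * W (l, k) a)))"
    by (intro sum.cong refl) (use ia in \<open>simp add: b_index right_diff_distrib sum_distrib_left\<close>)
  also have "\<dots> = \<Phi> z $$ (i, a) - (\<Sum>k<q. \<Sum>l<n. \<Phi> z $$ (i, k) * (z ^ Suc l * W (l, k) a))"
    using ia by (simp add: sum_subtractf)
  also have "(\<Sum>k<q. \<Sum>l<n. \<Phi> z $$ (i, k) * (z ^ Suc l * W (l, k) a)) = (\<Sum>p\<in>I n. \<Phi> z $$ (i, snd p) * (z ^ Suc (fst p) * W p a))"
    unfolding sum_I_split by (subst sum.swap) simp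
  finally show "(\<Phi> z * b_fun q n \<Gamma> z) $$ (i, a) = a_fun q n \<Gamma> z $$ (i, a)"
    by (simp only: eq rhs)
qed (use \<Phi>_carrier[of z] b_carrier[of z] a_carrier[of z] in auto)

end

section \<open>Matrix measures given by a density\<close>

lemma circle_mult_cnj: "\<zeta> \<in> unit_circle \<Longrightarrow> \<zeta> * cnj \<zeta> = 1"
  by (simp add: complex_norm_square[symmetric])

lemma cnj_circle: "\<zeta> \<in> unit_circle \<Longrightarrow> cnj \<zeta> = 1 / \<zeta>"
  using circle_mult_cnj[of \<zeta>] by (cases "\<zeta> = 0") (auto simp: eq_divide_eq mult.commute)

lemma integrable_bounded_mult:
  fixes u g :: "'a \<Rightarrow> complex"
  assumes g: "integrable M g" and u: "u \<in> borel_measurable M" and b: "\<And>x. x \<in> space M \<Longrightarrow> cmod (u x) \<le> b"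
  shows "integrable M (\<lambda>x. u x * g x)"
proof (rule Bochner_Integration.integrable_bound)
  show "integrable M (\<lambda>x. b * norm (g x))" using g by simp
  show "(\<lambda>x. u x * g x) \<in> borel_measurable M"
    using u borel_measurable_integrable[OF g] by (rule borel_measurable_times)
  show "AE x in M. norm (u x * g x) \<le> norm (b * norm (g x))"
    using b by (intro AE_I2) (force simp: norm_mult abs_mult intro!: mult_right_mono)
qed

text \<open>Serves to form arc length plus counting measure on the zeros, a single finite measure
  that dominates both parts of the matrix measure.\<close>

definition add_measure :: "'a measure \<Rightarrow> 'a measure \<Rightarrow> 'a measure" where
  "add_measure M1 M2 = measure_of (space M1) (sets M1) (\<lambda>A. emeasure M1 A + emeasure M2 A)"

lemma sets_add_measure [simp, measurable_cong]: "sets (add_measure M1 M2) = sets M1"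
  by (simp add: add_measure_def)

lemma space_add_measure [simp]: "space (add_measure M1 M2) = space M1"
  by (simp add: add_measure_def space_measure_of sets.space_closed)

lemma emeasure_add_measure:
  assumes "sets M2 = sets M1" "A \<in> sets M1"
  shows "emeasure (add_measure M1 M2) A = emeasure M1 A + emeasure M2 A"
proof (rule emeasure_measure_of[OF add_measure_def])
  show "countably_additive (sets (add_measure M1 M2)) (\<lambda>A. emeasure M1 A + emeasure M2 A)"
  proof (rule countably_additiveI)
    fix B :: "nat \<Rightarrow> 'a set"
    assume "range B \<subseteq> sets (add_measure M1 M2)" "disjoint_family B"
    then have "(\<Sum>i. emeasure M1 (B i)) = emeasure M1 (\<Union> (range B))"
      "(\<Sum>i. emeasure M2 (B i)) = emeasure M2 (\<Union> (range B))"
      by (auto intro!: suminf_emeasure simp: assms)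
    then show "(\<Sum>i. emeasure M1 (B i) + emeasure M2 (B i)) =
        emeasure M1 (\<Union> (range B)) + emeasure M2 (\<Union> (range B))"
      by (simp add: suminf_add[symmetric])
  qed
qed (use assms in \<open>auto simp: positive_def sets.space_closed\<close>)

lemma finite_measure_add_measure:
  assumes "finite_measure M1" "finite_measure M2" "sets M2 = sets M1"
  shows "finite_measure (add_measure M1 M2)"
proof
  have "space M2 = space M1" using assms(3) by (rule sets_eq_imp_space_eq)
  then show "emeasure (add_measure M1 M2) (space (add_measure M1 M2)) \<noteq> \<infinity>"
    using finite_measure.emeasure_finite[OF assms(1), of "space M1"]
      finite_measure.emeasure_finite[OF assms(2), of "space M1"]
    by (simp add: emeasure_add_measure[OF assms(3)])
qed

text \<open>Each summand is bounded by the sum, which gives integrability. The formula is checked on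
  indicators and carried to limits by dominated convergence; the factor 2 in the majorant is the
  bound on the approximants in \<open>integrable_induct\<close>.\<close>

lemma integral_add_measure:
  fixes f :: "'a \<Rightarrow> 'b::{banach, second_countable_topology}"
  assumes sets: "sets M2 = sets M1" and f: "integrable (add_measure M1 M2) f"
  shows "integrable M1 f" "integrable M2 f"
    and "integral\<^sup>L (add_measure M1 M2) f = integral\<^sup>L M1 f + integral\<^sup>L M2 f"
proof -
  let ?M = "add_measure M1 M2"
  have space: "space M2 = space M1" using sets by (rule sets_eq_imp_space_eq)
  have *: "integrable N g"
    if g: "integrable ?M g" and N: "sets N = sets M1" "\<And>A. A \<in> sets M1 \<Longrightarrow> emeasure N A \<le> emeasure ?M A"
    for g :: "'a \<Rightarrow> 'b" and N
  proof (rule integrableI_bounded)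
    have N': "sets N = sets ?M" using N(1) by simp
    have "N \<le> ?M" unfolding le_measure[OF N'] using N by simp
    then have "(\<integral>\<^sup>+ x. norm (g x) \<partial>N) \<le> (\<integral>\<^sup>+ x. norm (g x) \<partial>?M)"
      using N' by (intro nn_integral_mono_measure) auto
    also have "\<dots> < \<infinity>" using g by (simp add: integrable_iff_bounded)
    finally show "(\<integral>\<^sup>+ x. norm (g x) \<partial>N) < \<infinity>" .
    show "g \<in> borel_measurable N"
      using borel_measurable_integrable[OF g] by (simp add: measurable_cong_sets[OF N' refl])
  qed
  have int1: "integrable M1 g" and int2: "integrable M2 g" if "integrable ?M g" for g :: "'a \<Rightarrow> 'b"
    using that by (auto intro!: * simp: sets emeasure_add_measure[OF sets])
  show "integrable M1 f" "integrable M2 f" using f by (fact int1, fact int2)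
  show "integral\<^sup>L ?M f = integral\<^sup>L M1 f + integral\<^sup>L M2 f"
    using f
  proof (induction rule: integrable_induct)
    case (base A c)
    then have "emeasure M1 A < \<infinity>" "emeasure M2 A < \<infinity>" "A \<in> sets M1"
      by (auto simp: emeasure_add_measure[OF sets])
    then show ?case using base
      by (simp add: emeasure_add_measure[OF sets] measure_def enn2real_plus sets scaleR_left_distrib
          less_top[symmetric])
  next
    case (add f g)
    then show ?case by (simp add: int1 int2)
  next
    case (lim f s)
    have f2: "integrable ?M (\<lambda>x. norm (f x))" using lim by simp
    have "(\<lambda>i. integral\<^sup>L ?M (s i)) \<longlonglongrightarrow> integral\<^sup>L ?M f"
      by (rule integral_dominated_convergence[where w = "\<lambda>x. 2 * norm (f x)"])
         (use lim in \<open>auto intro!: borel_measurable_integrable\<close>)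
    moreover have "(\<lambda>i. integral\<^sup>L M1 (s i)) \<longlonglongrightarrow> integral\<^sup>L M1 f"
      by (rule integral_dominated_convergence[where w = "\<lambda>x. 2 * norm (f x)"])
         (use lim int1 in \<open>auto intro!: borel_measurable_integrable\<close>)
    moreover have "(\<lambda>i. integral\<^sup>L M2 (s i)) \<longlonglongrightarrow> integral\<^sup>L M2 f"
      by (rule integral_dominated_convergence[where w = "\<lambda>x. 2 * norm (f x)"])
         (use lim int2 in \<open>auto intro!: borel_measurable_integrable simp: space\<close>)
    ultimately have "(\<lambda>i. integral\<^sup>L M1 (s i) + integral\<^sup>L M2 (s i)) \<longlonglongrightarrow> integral\<^sup>L ?M f"
      "(\<lambda>i. integral\<^sup>L M1 (s i) + integral\<^sup>L M2 (s i)) \<longlonglongrightarrow> integral\<^sup>L M1 f + integral\<^sup>L M2 f"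
      by (auto simp: lim.IH intro: tendsto_add)
    then show ?case by (rule LIMSEQ_unique)
  qed
qed

text \<open>The push-forward along the identity replaces the discrete sigma-algebra by the Borel
  sets of the circle, so that the measure can be added to \<open>arc_length\<close>.\<close>

definition counting_on :: "complex set \<Rightarrow> complex measure" where
  "counting_on N = distr (count_space N) circle_borel (\<lambda>v. v)"

lemma sets_counting_on [simp, measurable_cong]: "sets (counting_on N) = sets circle_borel"
  by (simp add: counting_on_def)

lemma counting_on:
  assumes "finite N" "N \<subseteq> unit_circle"
  shows "finite_measure (counting_on N)"
    and "f \<in> borel_measurable circle_borel \<Longrightarrow> integral\<^sup>L (counting_on N) f = (\<Sum>v\<in>N. f v :: complex)"
proof -
  have m: "(\<lambda>v. v) \<in> count_space N \<rightarrow>\<^sub>M circle_borel"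
    using assms by (auto simp: space_restrict_space)
  show "finite_measure (counting_on N)"
    unfolding counting_on_def
    by (rule finite_measure.finite_measure_distr[OF finite_measure_count_space[OF assms(1)] m])
  show "integral\<^sup>L (counting_on N) f = (\<Sum>v\<in>N. f v)" if "f \<in> borel_measurable circle_borel"
    unfolding counting_on_def
    by (subst integral_distr[OF m that]) (simp add: lebesgue_integral_count_space_finite[OF assms(1)])
qed

section \<open>The trace measure and matrix measures of the form \<open>H\<close> times
  \<sigma>\<close>

lemma trace_measure_sets: "sets (trace_measure q \<mu>) = sets circle_borel"
proof -
  have "sets (trace_measure q \<mu>) = sigma_sets unit_circle (sets circle_borel)"
    unfolding trace_measure_def by (rule sets_measure_of) (auto simp: sets_restrict_space)
  also have "\<dots> = sets circle_borel"
    using sets.sigma_sets_eq[of circle_borel] by (simp add: space_restrict_space)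
  finally show ?thesis .
qed

text \<open>The total mass is either an \<open>ennreal\<close> of a real number or the default 0 of
  \<open>measure_of\<close>, so it is finite for an arbitrary set function
  \<open>\<mu>\<close>.\<close>

lemma finite_measure_trace_measure: "finite_measure (trace_measure q \<mu>)"
proof
  show "emeasure (trace_measure q \<mu>) (space (trace_measure q \<mu>)) \<noteq> \<infinity>"
    unfolding trace_measure_def emeasure_measure_of_conv by simp
qed

lemma borel_measurable_trace_measure:
  "borel_measurable (trace_measure q \<mu>) = borel_measurable circle_borel"
  by (rule measurable_cong_sets[OF trace_measure_sets refl])

text \<open>Isolates what is needed of a density for integrals in the sense of
  \<open>has_matrix_integral\<close> to become ordinary integrals: the trace measure is then
  \<open>tr\<close> times \<sigma>, and H / tr is a trace density.\<close>

locale psd_density = finite_measure \<sigma> for \<sigma> :: "complex measure" +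
  fixes q :: nat and H :: "complex \<Rightarrow> nat \<Rightarrow> nat \<Rightarrow> complex"
  assumes sets_\<sigma>: "sets \<sigma> = sets circle_borel"
    and integrable_H: "\<And>i k. i < q \<Longrightarrow> k < q \<Longrightarrow> integrable \<sigma> (\<lambda>\<zeta>. H \<zeta> i k)"
    and psd_H: "\<And>\<zeta>. \<zeta> \<in> unit_circle \<Longrightarrow> psd_on (H \<zeta>) {..<q}"
begin

definition \<mu> :: "complex set \<Rightarrow> complex mat" where
  "\<mu> B = (if B \<in> sets circle_borel then mat q q (\<lambda>(i, k). LINT \<zeta>:B|\<sigma>. H \<zeta> i k) else 0\<^sub>m q q)"

definition tr :: "complex \<Rightarrow> real" where
  "tr \<zeta> = (\<Sum>i<q. Re (H \<zeta> i i))"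

lemma space_\<sigma>: "space \<sigma> = unit_circle"
  using sets_eq_imp_space_eq[OF sets_\<sigma>] by (simp add: space_restrict_space)

lemma set_integrable_H:
  assumes "i < q" "k < q" "B \<in> sets circle_borel"
  shows "set_integrable \<sigma> B (\<lambda>\<zeta>. H \<zeta> i k)"
  using integrable_mult_indicator[of B \<sigma> "\<lambda>\<zeta>. H \<zeta> i k"] integrable_H assms
  by (simp add: set_integrable_def sets_\<sigma>)

lemma diag_nonneg: "\<zeta> \<in> unit_circle \<Longrightarrow> i < q \<Longrightarrow> 0 \<le> Re (H \<zeta> i i)"
  using order_trans[OF norm_ge_zero psd_on_entry_bound[OF psd_H, of \<zeta> i i]] by simp

lemma tr_nonneg: "\<zeta> \<in> unit_circle \<Longrightarrow> 0 \<le> tr \<zeta>"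
  unfolding tr_def by (intro sum_nonneg diag_nonneg) auto

lemma H_eq_0:
  assumes "\<zeta> \<in> unit_circle" "tr \<zeta> = 0" "i < q" "k < q"
  shows "H \<zeta> i k = 0"
proof -
  have "Re (H \<zeta> j j) = 0" if "j < q" for j
    using assms that sum_nonneg_eq_0_iff[of "{..<q}" "\<lambda>i. Re (H \<zeta> i i)"] diag_nonneg
    by (auto simp: tr_def)
  then have "cmod (H \<zeta> i k) \<le> 0"
    using psd_on_entry_bound[OF psd_H, of \<zeta> i k] assms by simp
  then show ?thesis by simp
qed

lemma \<mu>_index: "B \<in> sets circle_borel \<Longrightarrow> i < q \<Longrightarrow> k < q \<Longrightarrow> \<mu> B $$ (i, k) = (LINT \<zeta>:B|\<sigma>. H \<zeta> i k)"
  by (simp add: \<mu>_def)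

lemma \<mu>_carrier: "\<mu> B \<in> carrier_mat q q"
  by (simp add: \<mu>_def)

lemma nonneg_hermitian_\<mu>:
  assumes B: "B \<in> sets circle_borel"
  shows "nonneg_hermitian q (\<mu> B)"
  unfolding nonneg_hermitian_iff_psd_on[OF \<mu>_carrier] psd_on_def
proof (intro conjI ballI allI)
  fix r s assume rs: "r \<in> {..<q}" "s \<in> {..<q}"
  have "\<mu> B $$ (s, r) = (LINT \<zeta>|\<sigma>. indicator B \<zeta> *\<^sub>R H \<zeta> s r)"
    using rs B by (simp add: \<mu>_index set_lebesgue_integral_def)
  also have "\<dots> = (LINT \<zeta>|\<sigma>. cnj (indicator B \<zeta> *\<^sub>R H \<zeta> r s))"
  proof (rule Bochner_Integration.integral_cong[OF refl])
    fix \<zeta> assume "\<zeta> \<in> space \<sigma>"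
    then have "H \<zeta> s r = cnj (H \<zeta> r s)"
      using psd_on_hermitian[OF psd_H rs] by (simp add: space_\<sigma>)
    then show "indicator B \<zeta> *\<^sub>R H \<zeta> s r = cnj (indicator B \<zeta> *\<^sub>R H \<zeta> r s)"
      by (simp only: complex_cnj_scaleR)
  qed
  also have "\<dots> = cnj (LINT \<zeta>|\<sigma>. indicator B \<zeta> *\<^sub>R H \<zeta> r s)"
    by (rule Bochner_Integration.integral_cnj)
  also have "\<dots> = cnj (\<mu> B $$ (r, s))"
    using rs B by (simp add: \<mu>_index set_lebesgue_integral_def)
  finally show "\<mu> B $$ (s, r) = cnj (\<mu> B $$ (r, s))" .
next
  fix x
  have int: "set_integrable \<sigma> B (\<lambda>\<zeta>. H \<zeta> r s)" if "r \<in> {..<q}" "s \<in> {..<q}" for r s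
    using that B by (intro set_integrable_H) auto
  have i: "integrable \<sigma> (\<lambda>\<zeta>. (indicator B \<zeta> *\<^sub>R H \<zeta> r s) * (cnj (x r) * x s))"
    if "r \<in> {..<q}" "s \<in> {..<q}" for r s
    using int[OF that] unfolding set_integrable_def by (rule integrable_mult_left)
  have expand: "(\<lambda>\<zeta>. indicator B \<zeta> *\<^sub>R sform (H \<zeta>) {..<q} x x) =
      (\<lambda>\<zeta>. \<Sum>r<q. \<Sum>s<q. (indicator B \<zeta> *\<^sub>R H \<zeta> r s) * (cnj (x r) * x s))"
    by (simp add: sform_def scaleR_sum_right sum_distrib_left mult_ac)
  have "sform (\<lambda>r s. \<mu> B $$ (r, s)) {..<q} x x =
      (\<Sum>r<q. cnj (x r) * (\<Sum>s<q. (LINT \<zeta>:B|\<sigma>. H \<zeta> r s) * x s))"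
    unfolding sform_def using B by (intro sum.cong refl arg_cong2[of _ _ _ _ "(*)"]) (simp add: \<mu>_index)
  also have "\<dots> = (\<Sum>r<q. \<Sum>s<q. LINT \<zeta>|\<sigma>. (indicator B \<zeta> *\<^sub>R H \<zeta> r s) * (cnj (x r) * x s))"
    unfolding set_lebesgue_integral_def sum_distrib_left integral_mult_left_zero
    by (intro sum.cong refl) (simp only: mult_ac)
  also have "\<dots> = (LINT \<zeta>|\<sigma>. (\<Sum>r<q. \<Sum>s<q. (indicator B \<zeta> *\<^sub>R H \<zeta> r s) * (cnj (x r) * x s)))"
  proof -
    have "(LINT \<zeta>|\<sigma>. (\<Sum>r<q. \<Sum>s<q. (indicator B \<zeta> *\<^sub>R H \<zeta> r s) * (cnj (x r) * x s))) =
        (\<Sum>r<q. LINT \<zeta>|\<sigma>. (\<Sum>s<q. (indicator B \<zeta> *\<^sub>R H \<zeta> r s) * (cnj (x r) * x s)))"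
      by (intro Bochner_Integration.integral_sum Bochner_Integration.integrable_sum i)
    also have "\<dots> = (\<Sum>r<q. \<Sum>s<q. LINT \<zeta>|\<sigma>. (indicator B \<zeta> *\<^sub>R H \<zeta> r s) * (cnj (x r) * x s))"
      by (intro sum.cong refl Bochner_Integration.integral_sum i)
    finally show ?thesis by (rule sym)
  qed
  also have "\<dots> = (LINT \<zeta>:B|\<sigma>. sform (H \<zeta>) {..<q} x x)"
    unfolding set_lebesgue_integral_def expand ..
  finally have "Re (sform (\<lambda>r s. \<mu> B $$ (r, s)) {..<q} x x) =
      Re (LINT \<zeta>|\<sigma>. indicator B \<zeta> *\<^sub>R sform (H \<zeta>) {..<q} x x)"
    by (simp only: set_lebesgue_integral_def)
  also have "\<dots> = (LINT \<zeta>|\<sigma>. Re (indicator B \<zeta> *\<^sub>R sform (H \<zeta>) {..<q} x x))"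
  proof (rule integral_Re[symmetric])
    show "integrable \<sigma> (\<lambda>\<zeta>. indicator B \<zeta> *\<^sub>R sform (H \<zeta>) {..<q} x x)"
      unfolding expand by (intro Bochner_Integration.integrable_sum i)
  qed
  also have "0 \<le> \<dots>"
    using psd_on_nonneg[OF psd_H] by (intro Bochner_Integration.integral_nonneg) (simp add: space_\<sigma>)
  finally show "0 \<le> Re (sform (\<lambda>r s. \<mu> B $$ (r, s)) {..<q} x x)" .
qed simp

lemma sums_\<mu>:
  assumes A: "range A \<subseteq> sets circle_borel" "disjoint_family (A :: nat \<Rightarrow> complex set)" and ik: "i < q" "k < q"
  shows "(\<lambda>j. \<mu> (A j) $$ (i, k)) sums \<mu> (\<Union>j. A j) $$ (i, k)"
proof -
  have U: "(\<Union>j. A j) \<in> sets circle_borel" "\<And>n. (\<Union>j<n. A j) \<in> sets circle_borel"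
    using A(1) by (auto intro!: sets.countable_UN sets.finite_UN)
  have "(\<lambda>n. LINT \<zeta>|\<sigma>. indicator (\<Union>j<n. A j) \<zeta> *\<^sub>R H \<zeta> i k) \<longlonglongrightarrow> (LINT \<zeta>|\<sigma>. indicator (\<Union>j. A j) \<zeta> *\<^sub>R H \<zeta> i k)"
  proof (rule integral_dominated_convergence[where w = "\<lambda>\<zeta>. norm (H \<zeta> i k)"])
    show "AE \<zeta> in \<sigma>. (\<lambda>n. indicator (\<Union>j<n. A j) \<zeta> *\<^sub>R H \<zeta> i k) \<longlonglongrightarrow> indicator (\<Union>j. A j) \<zeta> *\<^sub>R H \<zeta> i k"
      by (intro AE_I2 tendsto_scaleR tendsto_const LIMSEQ_indicator_UN)
    show "(\<lambda>\<zeta>. indicator (\<Union>j. A j) \<zeta> *\<^sub>R H \<zeta> i k) \<in> borel_measurable \<sigma>"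
      "(\<lambda>\<zeta>. indicator (\<Union>j<n. A j) \<zeta> *\<^sub>R H \<zeta> i k) \<in> borel_measurable \<sigma>" for n
      using U borel_measurable_integrable[OF integrable_H[OF ik]]
      by (auto intro!: borel_measurable_scaleR borel_measurable_indicator simp: sets_\<sigma>)
  qed (use integrable_H[OF ik] in \<open>auto simp: indicator_def\<close>)
  moreover have "(LINT \<zeta>|\<sigma>. indicator (\<Union>j<n. A j) \<zeta> *\<^sub>R H \<zeta> i k) = (\<Sum>j<n. \<mu> (A j) $$ (i, k))" for n
  proof -
    have "(LINT \<zeta>:(\<Union>j<n. A j)|\<sigma>. H \<zeta> i k) = (\<Sum>j<n. LINT \<zeta>:A j|\<sigma>. H \<zeta> i k)"
      using A ik by (intro set_integral_finite_Union)
         (auto intro!: set_integrable_H simp: disjoint_family_on_def sets_\<sigma>)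
    also have "\<dots> = (\<Sum>j<n. \<mu> (A j) $$ (i, k))"
      using A ik by (intro sum.cong refl) (subst \<mu>_index, auto)
    finally show ?thesis by (simp add: set_lebesgue_integral_def)
  qed
  ultimately show ?thesis
    using U ik by (simp add: sums_def \<mu>_index set_lebesgue_integral_def)
qed

lemma nonneg_hermitian_measure_\<mu>: "nonneg_hermitian_measure q \<mu>"
  unfolding nonneg_hermitian_measure_def
proof (intro conjI ballI allI impI nonneg_hermitian_\<mu> sums_\<mu>)
  show "\<mu> B = 0\<^sub>m q q" if "B \<notin> sets circle_borel" for B
    using that by (simp add: \<mu>_def)
qed

lemma trace_measure_\<mu>: "trace_measure q \<mu> = density \<sigma> (\<lambda>\<zeta>. ennreal (tr \<zeta>))"
proof -
  let ?D = "density \<sigma> (\<lambda>\<zeta>. ennreal (tr \<zeta>))"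
  have int: "integrable \<sigma> tr"
    unfolding tr_def by (intro Bochner_Integration.integrable_sum integrable_Re integrable_H) auto
  have "emeasure ?D B = ennreal (Re (\<Sum>i<q. \<mu> B $$ (i, i)))" if B: "B \<in> sets circle_borel" for B
  proof -
    have "emeasure ?D B = (\<integral>\<^sup>+ \<zeta>. ennreal (tr \<zeta>) * indicator B \<zeta> \<partial>\<sigma>)"
      using int B by (intro emeasure_density) (auto simp: sets_\<sigma>)
    also have "\<dots> = (\<integral>\<^sup>+ \<zeta>. ennreal (indicator B \<zeta> *\<^sub>R tr \<zeta>) \<partial>\<sigma>)"
      by (intro nn_integral_cong) (auto simp: indicator_def)
    also have "\<dots> = ennreal (LINT \<zeta>|\<sigma>. indicator B \<zeta> *\<^sub>R tr \<zeta>)"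
      using int B tr_nonneg
      by (intro nn_integral_eq_integral AE_I2 integrable_mult_indicator) (auto simp: sets_\<sigma> space_\<sigma>)
    also have "(LINT \<zeta>|\<sigma>. indicator B \<zeta> *\<^sub>R tr \<zeta>) = (LINT \<zeta>|\<sigma>. (\<Sum>i<q. Re (indicator B \<zeta> *\<^sub>R H \<zeta> i i)))"
      by (simp add: tr_def sum_distrib_left)
    also have "\<dots> = (\<Sum>i<q. LINT \<zeta>|\<sigma>. Re (indicator B \<zeta> *\<^sub>R H \<zeta> i i))"
      using set_integrable_H B unfolding set_integrable_def
      by (intro Bochner_Integration.integral_sum integrable_Re) auto
    also have "\<dots> = (\<Sum>i<q. Re (LINT \<zeta>|\<sigma>. indicator B \<zeta> *\<^sub>R H \<zeta> i i))"
      using set_integrable_H B unfolding set_integrable_def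
      by (intro sum.cong refl integral_Re) auto
    also have "\<dots> = Re (\<Sum>i<q. \<mu> B $$ (i, i))"
      using B by (simp add: \<mu>_index set_lebesgue_integral_def)
    finally show ?thesis .
  qed
  moreover have "sigma_sets unit_circle (sets circle_borel) = sets circle_borel"
    using sets.sigma_sets_eq[of circle_borel] by (simp add: space_restrict_space)
  moreover have "sets circle_borel \<subseteq> Pow unit_circle"
    using sets.space_closed[of circle_borel] by (simp add: space_restrict_space)
  ultimately have "trace_measure q \<mu> = measure_of unit_circle (sets circle_borel) (emeasure ?D)"
    unfolding trace_measure_def by (intro measure_of_eq) (simp_all only:)
  also have "\<dots> = ?D"
    using measure_of_of_measure[of ?D] by (simp add: sets_\<sigma> space_\<sigma>)
  finally show ?thesis .
qed

text \<open>Where \<open>tr\<close> is 0, division yields 0, and \<open>H\<close> vanishes there too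
  by \<open>H_eq_0\<close>; hence \<open>tr_D\<close> holds at every point of the circle and not
  just almost everywhere.\<close>

definition D :: "complex \<Rightarrow> complex mat" where
  "D \<zeta> = mat q q (\<lambda>(i, k). H \<zeta> i k / tr \<zeta>)"

lemma tr_D:
  assumes "\<zeta> \<in> unit_circle" "i < q" "k < q"
  shows "tr \<zeta> *\<^sub>R D \<zeta> $$ (i, k) = H \<zeta> i k"
  using assms H_eq_0[of \<zeta> i k] by (cases "tr \<zeta> = 0") (auto simp: D_def scaleR_conv_of_real)

lemma borel_measurable_H: "i < q \<Longrightarrow> k < q \<Longrightarrow> (\<lambda>\<zeta>. H \<zeta> i k) \<in> borel_measurable \<sigma>"
  by (intro borel_measurable_integrable integrable_H)

lemma borel_measurable_tr: "tr \<in> borel_measurable \<sigma>"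
  unfolding tr_def using borel_measurable_H by (intro borel_measurable_sum) auto

lemma borel_measurable_D: "i < q \<Longrightarrow> k < q \<Longrightarrow> (\<lambda>\<zeta>. D \<zeta> $$ (i, k)) \<in> borel_measurable \<sigma>"
  unfolding D_def using borel_measurable_H borel_measurable_tr
  by (simp add: borel_measurable_divide)

lemma integral_D:
  assumes f: "f \<in> borel_measurable \<sigma>" and ik: "i < q" "k < q"
  shows "(LINT \<zeta>|trace_measure q \<mu>. f \<zeta> * D \<zeta> $$ (i, k)) = (LINT \<zeta>|\<sigma>. f \<zeta> * H \<zeta> i k)"
    and "integrable (trace_measure q \<mu>) (\<lambda>\<zeta>. f \<zeta> * D \<zeta> $$ (i, k)) \<longleftrightarrow> integrable \<sigma> (\<lambda>\<zeta>. f \<zeta> * H \<zeta> i k)"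
proof -
  have m: "(\<lambda>\<zeta>. f \<zeta> * D \<zeta> $$ (i, k)) \<in> borel_measurable \<sigma>"
    using f borel_measurable_D[OF ik] by (rule borel_measurable_times)
  have ae: "AE \<zeta> in \<sigma>. 0 \<le> tr \<zeta>" using tr_nonneg by (intro AE_I2) (simp add: space_\<sigma>)
  have eq: "tr \<zeta> *\<^sub>R (f \<zeta> * D \<zeta> $$ (i, k)) = f \<zeta> * H \<zeta> i k" if "\<zeta> \<in> space \<sigma>" for \<zeta>
    using tr_D[of \<zeta>, OF _ ik] that by (simp add: space_\<sigma> flip: mult_scaleR_right)
  show "(LINT \<zeta>|trace_measure q \<mu>. f \<zeta> * D \<zeta> $$ (i, k)) = (LINT \<zeta>|\<sigma>. f \<zeta> * H \<zeta> i k)"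
    unfolding trace_measure_\<mu> integral_density[OF m borel_measurable_tr ae]
    by (rule Bochner_Integration.integral_cong[OF refl eq])
  show "integrable (trace_measure q \<mu>) (\<lambda>\<zeta>. f \<zeta> * D \<zeta> $$ (i, k)) \<longleftrightarrow> integrable \<sigma> (\<lambda>\<zeta>. f \<zeta> * H \<zeta> i k)"
    unfolding trace_measure_\<mu> integrable_density[OF m borel_measurable_tr ae]
    by (rule Bochner_Integration.integrable_cong[OF refl eq])
qed

lemma trace_density_D: "trace_density q \<mu> D"
  unfolding trace_density_def
proof (intro allI impI conjI ballI)
  fix i k assume ik: "i < q" "k < q"
  show "integrable (trace_measure q \<mu>) (\<lambda>\<zeta>. D \<zeta> $$ (i, k))"
    using integral_D(2)[OF _ ik, of "\<lambda>_. 1"] integrable_H[OF ik] by simp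
  fix B assume B: "B \<in> sets circle_borel"
  have "(LINT \<zeta>|trace_measure q \<mu>. of_real (indicator B \<zeta>) * D \<zeta> $$ (i, k)) =
      (LINT \<zeta>|\<sigma>. of_real (indicator B \<zeta>) * H \<zeta> i k)"
  proof (rule integral_D(1)[OF _ ik])
    have [measurable]: "B \<in> sets \<sigma>" using B by (simp only: sets_\<sigma>)
    show "(\<lambda>\<zeta>. complex_of_real (indicator B \<zeta>)) \<in> borel_measurable \<sigma>" by measurable
  qed
  then show "\<mu> B $$ (i, k) = (LINT \<zeta>:B|trace_measure q \<mu>. D \<zeta> $$ (i, k))"
    using B ik by (simp add: \<mu>_index set_lebesgue_integral_def scaleR_conv_of_real)
qed

lemma has_matrix_integral_\<mu>:
  assumes f: "f \<in> borel_measurable circle_borel" and b: "\<And>\<zeta>. \<zeta> \<in> unit_circle \<Longrightarrow> cmod (f \<zeta>) \<le> b"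
    and J: "J \<in> carrier_mat q q" "\<And>i k. i < q \<Longrightarrow> k < q \<Longrightarrow> J $$ (i, k) = (LINT \<zeta>|\<sigma>. f \<zeta> * H \<zeta> i k)"
  shows "has_matrix_integral q \<mu> f J"
  unfolding has_matrix_integral_def
proof (intro conjI exI[of _ D] allI impI trace_density_D J(1))
  fix i k assume ik: "i < q" "k < q"
  have f': "f \<in> borel_measurable \<sigma>" using f by (simp add: measurable_cong_sets[OF sets_\<sigma> refl])
  have "integrable \<sigma> (\<lambda>\<zeta>. f \<zeta> * H \<zeta> i k)"
    by (rule integrable_bounded_mult[OF integrable_H[OF ik] f' b]) (simp add: space_\<sigma>)
  then show "integrable (trace_measure q \<mu>) (\<lambda>\<zeta>. f \<zeta> * D \<zeta> $$ (i, k))"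
    using integral_D(2)[OF f' ik] by simp
  show "J $$ (i, k) = (LINT \<zeta>|trace_measure q \<mu>. f \<zeta> * D \<zeta> $$ (i, k))"
    using J(2)[OF ik] integral_D(1)[OF f' ik] by simp
qed

end

section \<open>Uniqueness of the Riesz--Herglotz measure\<close>

text \<open>The difference series sums to 0 on the disk, whereas a non-zero coefficient of positive
  index would keep it non-zero in a punctured neighbourhood of 0. The constant coefficient is read
  off at 0.\<close>

lemma power_series_eqD:
  fixes a b :: "nat \<Rightarrow> complex"
  assumes "\<And>z. norm z < 1 \<Longrightarrow> \<exists>s. (\<lambda>j. a j * z ^ j) sums s \<and> (\<lambda>j. b j * z ^ j) sums s"
  shows "a j = b j"
proof (rule ccontr)
  assume ne: "a j \<noteq> b j"
  have 0: "(\<lambda>j. (a j - b j) * z ^ j) sums 0" if z: "norm z < 1" for z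
  proof -
    obtain s where "(\<lambda>j. a j * z ^ j) sums s" "(\<lambda>j. b j * z ^ j) sums s" using assms[OF z] by blast
    from sums_diff[OF this] show ?thesis by (simp add: left_diff_distrib)
  qed
  have a0: "a 0 - b 0 = 0"
    using 0[of 0] powser_sums_zero_iff[of "\<lambda>j. a j - b j" 0] by simp
  with ne have "0 < j" by (cases j) auto
  show False
  proof (rule powser_0_nonzero[of 1 0 "\<lambda>j. a j - b j" "\<lambda>_. 0" j])
    fix s :: real assume "0 < s" "\<And>z :: complex. z \<in> cball 0 s - {0} \<Longrightarrow> 0 \<noteq> (0 :: complex)"
    from this(2)[of "of_real s"] this(1) show False by simp
  qed (use 0 ne \<open>0 < j\<close> in auto)
qed

text \<open>Expands the kernel as 1 + 2 z u + 2 z^2 u^2 + ... and integrates termwise under a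
  geometric majorant. With u = cnj \<zeta> this is the Herglotz kernel; with u = \<zeta> it is the
  conjugate kernel at the point cnj z.\<close>

lemma sums_integral_geometric:
  fixes g u :: "complex \<Rightarrow> complex"
  assumes M: "space M = unit_circle" "integrable M g" "u \<in> borel_measurable M"
    and u: "\<And>\<zeta>. \<zeta> \<in> unit_circle \<Longrightarrow> cmod (u \<zeta>) = 1" and z: "cmod z < 1"
  shows "(\<lambda>j. (if j = 0 then 1 else 2) * (LINT \<zeta>|M. u \<zeta> ^ j * g \<zeta>) * z ^ j) sums
    (LINT \<zeta>|M. (2 / (1 - z * u \<zeta>) - 1) * g \<zeta>)"
proof -
  define c where "c j = (if j = 0 then 1 else 2 :: complex)" for j :: nat
  define f where "f j \<zeta> = c j * z ^ j * (u \<zeta> ^ j * g \<zeta>)" for j \<zeta>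
  have norm_f: "norm (f j \<zeta>) \<le> cmod z ^ j * (2 * norm (g \<zeta>))" if "\<zeta> \<in> unit_circle" for j \<zeta>
    using u[OF that] by (auto simp: f_def c_def norm_mult norm_power mult_left_mono)
  have geo: "summable (\<lambda>j. cmod z ^ j * d)" for d
    using z by (simp add: summable_mult2 summable_geometric)
  have intf: "integrable M (f j)" for j
    unfolding f_def
    by (intro integrable_mult_right integrable_bounded_mult[OF M(2) borel_measurable_power[OF M(3)], of _ 1])
       (simp add: norm_power u M(1))
  have "(\<lambda>j. integral\<^sup>L M (f j)) sums (LINT \<zeta>|M. (\<Sum>j. f j \<zeta>))"
  proof (rule sums_integral[OF intf])
    show "AE \<zeta> in M. summable (\<lambda>j. norm (f j \<zeta>))"
    proof (rule AE_I2)
      fix \<zeta> assume "\<zeta> \<in> space M"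
      then show "summable (\<lambda>j. norm (f j \<zeta>))"
        by (intro summable_comparison_test'[OF geo[of "2 * norm (g \<zeta>)"], of 0]) (simp add: norm_f M(1))
    qed
    have "norm (LINT \<zeta>|M. norm (f j \<zeta>)) \<le> cmod z ^ j * (LINT \<zeta>|M. 2 * norm (g \<zeta>))" for j
    proof -
      have "(LINT \<zeta>|M. norm (f j \<zeta>)) \<le> (LINT \<zeta>|M. cmod z ^ j * (2 * norm (g \<zeta>)))"
        using intf M(2) by (intro integral_mono) (auto simp: norm_f M(1))
      then show ?thesis by simp
    qed
    then show "summable (\<lambda>j. LINT \<zeta>|M. norm (f j \<zeta>))"
      by (intro summable_comparison_test'[OF geo, of 0])
  qed
  moreover have "(\<Sum>j. f j \<zeta>) = (2 / (1 - z * u \<zeta>) - 1) * g \<zeta>" if "\<zeta> \<in> unit_circle" for \<zeta>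
  proof -
    have "norm (z * u \<zeta>) < 1" using z u[OF that] by (simp add: norm_mult)
    then have "(\<lambda>j. 2 * (z * u \<zeta>) ^ j - (if j = 0 then 1 else 0)) sums (2 * (1 / (1 - z * u \<zeta>)) - 1)"
      by (intro sums_diff sums_mult geometric_sums sums_single)
    from sums_mult2[OF this, of "g \<zeta>"]
    have "(\<lambda>j. (2 * (z * u \<zeta>) ^ j - (if j = 0 then 1 else 0)) * g \<zeta>) sums ((2 / (1 - z * u \<zeta>) - 1) * g \<zeta>)"
      by simp
    moreover have "(2 * (z * u \<zeta>) ^ j - (if j = 0 then 1 else 0)) * g \<zeta> = f j \<zeta>" for j
      by (simp add: f_def c_def power_mult_distrib)
    ultimately show ?thesis by (simp add: sums_iff)
  qed
  then have "(LINT \<zeta>|M. (\<Sum>j. f j \<zeta>)) = (LINT \<zeta>|M. (2 / (1 - z * u \<zeta>) - 1) * g \<zeta>)"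
    by (intro Bochner_Integration.integral_cong) (simp_all add: M(1))
  moreover have "integral\<^sup>L M (f j) = c j * (LINT \<zeta>|M. u \<zeta> ^ j * g \<zeta>) * z ^ j" for j
    unfolding f_def integral_mult_right_zero by (simp only: mult_ac)
  ultimately show ?thesis by (simp only: c_def)
qed

text \<open>The Stone-Weierstrass theorem supplies polynomials in the real coordinates. On the
  circle cnj \<zeta> inverts \<zeta>, so these are trigonometric polynomials, whose integrals are
  determined by the moments.\<close>

lemma real_polynomial_function_circle:
  fixes p :: "complex \<Rightarrow> real"
  assumes "real_polynomial_function p"
  shows "\<exists>P d. \<forall>\<zeta>\<in>unit_circle. of_real (p \<zeta>) = poly P \<zeta> * cnj \<zeta> ^ d"
  using assms
proof induction
  case (linear f)
  \<comment> \<open>By real linearity f(\<zeta>) = Re \<zeta> f(1) + Im \<zeta> f(\<i>); \<alpha>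
    and \<beta> are the resulting coefficients of \<zeta> and cnj \<zeta>.\<close>
  define \<alpha> where "\<alpha> = (of_real (f 1) - \<i> * of_real (f \<i>)) / 2"
  define \<beta> where "\<beta> = (of_real (f 1) + \<i> * of_real (f \<i>)) / 2"
  have "of_real (f \<zeta>) = \<alpha> * \<zeta> + \<beta> * cnj \<zeta>" for \<zeta>
  proof -
    interpret bounded_linear f by fact
    have "\<zeta> = Re \<zeta> *\<^sub>R 1 + Im \<zeta> *\<^sub>R \<i>" by (simp add: complex_eq_iff)
    then have "f \<zeta> = Re \<zeta> * f 1 + Im \<zeta> * f \<i>" by (metis add scaleR real_scaleR_def)
    then show ?thesis by (simp add: \<alpha>_def \<beta>_def complex_eq_iff field_simps)
  qed
  moreover have "\<alpha> * \<zeta> = \<alpha> * \<zeta> * \<zeta> * cnj \<zeta>" if "\<zeta> \<in> unit_circle" for \<zeta>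
    using circle_mult_cnj[OF that] by (simp add: mult.assoc)
  ultimately have "\<forall>\<zeta>\<in>unit_circle. of_real (f \<zeta>) = poly [:\<beta>, 0, \<alpha>:] \<zeta> * cnj \<zeta> ^ 1"
    by (simp add: algebra_simps)
  then show ?case by blast
next
  case (const c)
  have "\<forall>\<zeta>\<in>unit_circle. of_real c = poly [:of_real c:] \<zeta> * cnj \<zeta> ^ 0" by simp
  then show ?case by blast
next
  case (add f g)
  then obtain P d Q e where P: "\<forall>\<zeta>\<in>unit_circle. of_real (f \<zeta>) = poly P \<zeta> * cnj \<zeta> ^ d"
    and Q: "\<forall>\<zeta>\<in>unit_circle. of_real (g \<zeta>) = poly Q \<zeta> * cnj \<zeta> ^ e" by metis
  have "of_real (f \<zeta> + g \<zeta>) = poly (P * monom 1 e + Q * monom 1 d) \<zeta> * cnj \<zeta> ^ (d + e)"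
    if \<zeta>: "\<zeta> \<in> unit_circle" for \<zeta>
  proof -
    have c: "\<zeta> ^ j * cnj \<zeta> ^ j = 1" for j
      using circle_mult_cnj[OF \<zeta>] by (simp flip: power_mult_distrib)
    have "poly (P * monom 1 e + Q * monom 1 d) \<zeta> * cnj \<zeta> ^ (d + e) =
        poly P \<zeta> * cnj \<zeta> ^ d * (\<zeta> ^ e * cnj \<zeta> ^ e) + poly Q \<zeta> * cnj \<zeta> ^ e * (\<zeta> ^ d * cnj \<zeta> ^ d)"
      by (simp add: poly_monom power_add algebra_simps)
    then show ?thesis using P Q \<zeta> by (simp add: c)
  qed
  then show ?case by blast
next
  case (mult f g)
  then obtain P d Q e where P: "\<forall>\<zeta>\<in>unit_circle. of_real (f \<zeta>) = poly P \<zeta> * cnj \<zeta> ^ d"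
    and Q: "\<forall>\<zeta>\<in>unit_circle. of_real (g \<zeta>) = poly Q \<zeta> * cnj \<zeta> ^ e" by metis
  have "\<forall>\<zeta>\<in>unit_circle. of_real (f \<zeta> * g \<zeta>) = poly (P * Q) \<zeta> * cnj \<zeta> ^ (d + e)"
    using P Q by (simp add: power_add mult_ac)
  then show ?case by blast
qed

text \<open>The tent functions max(0, 1 - m dist) tend to the indicator of \<open>F\<close>; the
  polynomials follow them within 1 / (m + 1), hence are bounded by 2 on the circle. They are chosen
  before the measure, so that the same sequence can be integrated against two measures.\<close>

lemma set_integral_closed_limit:
  fixes F :: "complex set"
  assumes F: "closed F" "F \<noteq> {}"
  shows "\<exists>p. (\<forall>m. real_polynomial_function (p m)) \<and>
    (\<forall>M g. sets M = sets circle_borel \<longrightarrow> integrable M g \<longrightarrow>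
      (\<lambda>m. LINT \<zeta>|M. of_real (p m \<zeta>) * g \<zeta>) \<longlonglongrightarrow> (LINT \<zeta>:F \<inter> unit_circle|M. g \<zeta> :: complex))"
proof -
  define \<phi> where "\<phi> m \<zeta> = max 0 (1 - real m * infdist \<zeta> F)" for m \<zeta>
  have "\<exists>p. real_polynomial_function p \<and> (\<forall>\<zeta>\<in>unit_circle. \<bar>\<phi> m \<zeta> - p \<zeta>\<bar> < 1 / real (Suc m))" for m
  proof -
    have "continuous_on unit_circle (\<phi> m)"
      unfolding \<phi>_def by (intro continuous_intros)
    from Stone_Weierstrass_real_polynomial_function[OF compact_sphere this, of "1 / real (Suc m)"]
    show ?thesis by (metis of_nat_0_less_iff zero_less_Suc zero_less_divide_1_iff)
  qed
  then obtain p where p: "\<And>m. real_polynomial_function (p m)"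
    "\<And>m \<zeta>. \<zeta> \<in> unit_circle \<Longrightarrow> \<bar>\<phi> m \<zeta> - p m \<zeta>\<bar> < 1 / real (Suc m)"
    by metis
  have lim\<phi>: "(\<lambda>m. \<phi> m \<zeta>) \<longlonglongrightarrow> indicator F \<zeta>" for \<zeta>
  proof (cases "\<zeta> \<in> F")
    case True
    then show ?thesis using infdist_zero[OF True] by (simp add: \<phi>_def)
  next
    case False
    then have pos: "0 < infdist \<zeta> F"
      using F in_closed_iff_infdist_zero[OF F] infdist_nonneg[of \<zeta> F] by (metis le_less)
    then obtain m0 where m0: "1 < real m0 * infdist \<zeta> F"
      using reals_Archimedean3 by blast
    have "\<phi> m \<zeta> = 0" if "m \<ge> m0" for m
    proof -
      have "real m0 * infdist \<zeta> F \<le> real m * infdist \<zeta> F"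
        using that pos by (intro mult_right_mono) auto
      then show ?thesis using m0 by (simp add: \<phi>_def)
    qed
    then have "eventually (\<lambda>m. \<phi> m \<zeta> = 0) sequentially"
      by (auto simp: eventually_sequentially)
    then show ?thesis using False by (simp add: tendsto_eventually)
  qed
  have limp: "(\<lambda>m. p m \<zeta>) \<longlonglongrightarrow> indicator F \<zeta>" if \<zeta>: "\<zeta> \<in> unit_circle" for \<zeta>
  proof -
    have "(\<lambda>m. \<phi> m \<zeta> - p m \<zeta>) \<longlonglongrightarrow> 0"
      by (rule Lim_null_comparison[OF always_eventually LIMSEQ_Suc[OF lim_1_over_n]])
         (use p(2)[OF \<zeta>] less_imp_le in \<open>auto simp del: of_nat_Suc\<close>)
    from tendsto_diff[OF lim\<phi>[of \<zeta>] this] show ?thesis by simp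
  qed
  have bp: "\<bar>p m \<zeta>\<bar> \<le> 2" if "\<zeta> \<in> unit_circle" for m \<zeta>
  proof -
    have "1 / real (Suc m) \<le> 1" by simp
    moreover have "0 \<le> \<phi> m \<zeta>" "\<phi> m \<zeta> \<le> 1" by (auto simp: \<phi>_def infdist_nonneg)
    ultimately show ?thesis using p(2)[OF that, of m] by linarith
  qed
  show ?thesis
  proof (intro exI[of _ p] conjI allI impI p(1))
    fix M g assume M: "sets M = sets circle_borel" and g: "integrable M (g :: complex \<Rightarrow> complex)"
    have space: "space M = unit_circle"
      using sets_eq_imp_space_eq[OF M] by (simp add: space_restrict_space)
    have pm: "(\<lambda>\<zeta>. complex_of_real (p m \<zeta>)) \<in> borel_measurable M" for m
    proof -
      have "continuous_on unit_circle (\<lambda>\<zeta>. complex_of_real (p m \<zeta>))"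
        by (intro continuous_on_of_real continuous_on_polymonial_function)
           (rule p(1)[unfolded real_polynomial_function_eq])
      then show ?thesis
        unfolding measurable_cong_sets[OF M refl] by (rule borel_measurable_continuous_on_restrict)
    qed
    have "(\<lambda>m. LINT \<zeta>|M. of_real (p m \<zeta>) * g \<zeta>) \<longlonglongrightarrow> (LINT \<zeta>|M. indicator (F \<inter> unit_circle) \<zeta> *\<^sub>R g \<zeta>)"
    proof (rule integral_dominated_convergence[where w = "\<lambda>\<zeta>. 2 * norm (g \<zeta>)"])
      have "F \<inter> unit_circle \<in> sets M"
        unfolding M sets_restrict_space using F by (auto intro: borel_closed)
      then show "(\<lambda>\<zeta>. indicator (F \<inter> unit_circle) \<zeta> *\<^sub>R g \<zeta>) \<in> borel_measurable M"
        using borel_measurable_integrable[OF g] by (intro borel_measurable_scaleR borel_measurable_indicator)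
      show "(\<lambda>\<zeta>. of_real (p m \<zeta>) * g \<zeta>) \<in> borel_measurable M" for m
        using pm borel_measurable_integrable[OF g] by (rule borel_measurable_times)
      show "integrable M (\<lambda>\<zeta>. 2 * norm (g \<zeta>))" using g by simp
      show "AE \<zeta> in M. (\<lambda>m. of_real (p m \<zeta>) * g \<zeta>) \<longlonglongrightarrow> indicator (F \<inter> unit_circle) \<zeta> *\<^sub>R g \<zeta>"
      proof (rule AE_I2)
        fix \<zeta> assume "\<zeta> \<in> space M"
        then have \<zeta>: "\<zeta> \<in> unit_circle" by (simp add: space)
        have "(\<lambda>m. of_real (p m \<zeta>) * g \<zeta>) \<longlonglongrightarrow> of_real (indicator F \<zeta>) * g \<zeta>"
          by (intro tendsto_mult tendsto_of_real limp \<zeta> tendsto_const)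
        moreover have "of_real (indicator F \<zeta>) * g \<zeta> = indicator (F \<inter> unit_circle) \<zeta> *\<^sub>R g \<zeta>"
          using \<zeta> by (simp add: indicator_def)
        ultimately show "(\<lambda>m. of_real (p m \<zeta>) * g \<zeta>) \<longlonglongrightarrow> indicator (F \<inter> unit_circle) \<zeta> *\<^sub>R g \<zeta>"
          by simp
      qed
      show "AE \<zeta> in M. norm (of_real (p m \<zeta>) * g \<zeta>) \<le> 2 * norm (g \<zeta>)" for m
        by (rule AE_I2) (auto simp: norm_mult space intro!: mult_right_mono bp)
    qed
    then show "(\<lambda>m. LINT \<zeta>|M. of_real (p m \<zeta>) * g \<zeta>) \<longlonglongrightarrow> (LINT \<zeta>:F \<inter> unit_circle|M. g \<zeta>)"
      by (simp add: set_lebesgue_integral_def)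
  qed
qed

lemma sets_circle_borel_closed:
  "sets circle_borel = sigma_sets unit_circle {F \<inter> unit_circle |F. closed F}"
proof -
  have "sets circle_borel = (\<inter>) unit_circle ` sigma_sets UNIV (Collect closed)"
    unfolding sets_restrict_space borel_eq_closed by simp
  also have "\<dots> = sigma_sets unit_circle ((\<inter>) unit_circle ` Collect closed)"
    by (rule sigma_sets_Int) (auto intro: sigma_sets.Basic)
  also have "(\<inter>) unit_circle ` Collect closed = {F \<inter> unit_circle |F. closed F}"
    by (auto simp: Int_commute image_iff)
  finally show ?thesis .
qed

lemma herglotz_kernel_eq:
  assumes z: "cmod z < 1" and \<zeta>: "\<zeta> \<in> unit_circle"
  shows "(\<zeta> + z) / (\<zeta> - z) = 2 / (1 - z * cnj \<zeta>) - 1"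
proof -
  have 0: "\<zeta> \<noteq> 0" "\<zeta> - z \<noteq> 0" using assms by auto
  have *: "1 - z * cnj \<zeta> = (\<zeta> - z) / \<zeta>" using 0(1) by (simp add: diff_divide_distrib cnj_circle[OF \<zeta>])
  show ?thesis using 0 by (simp add: * divide_simps)
qed

text \<open>
  Both kernels are needed: the first only sees the moments of non-negative order, its conjugate
  those of non-positive order.
\<close>
locale same_herglotz_integrals =
  fixes M1 M2 :: "complex measure" and g1 g2 :: "complex \<Rightarrow> complex"
  assumes M1: "sets M1 = sets circle_borel" "integrable M1 g1"
    and M2: "sets M2 = sets circle_borel" "integrable M2 g2"
    and eq1: "\<And>z. cmod z < 1 \<Longrightarrow> (LINT \<zeta>|M1. (\<zeta> + z) / (\<zeta> - z) * g1 \<zeta>) = (LINT \<zeta>|M2. (\<zeta> + z) / (\<zeta> - z) * g2 \<zeta>)"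
    and eq2: "\<And>z. cmod z < 1 \<Longrightarrow> (LINT \<zeta>|M1. cnj ((\<zeta> + z) / (\<zeta> - z)) * g1 \<zeta>) = (LINT \<zeta>|M2. cnj ((\<zeta> + z) / (\<zeta> - z)) * g2 \<zeta>)"
begin

lemma space_M12: "space M1 = unit_circle" "space M2 = unit_circle"
  using sets_eq_imp_space_eq[OF M1(1)] sets_eq_imp_space_eq[OF M2(1)]
  by (simp_all add: space_restrict_space)

lemma integral_cong_circle:
  fixes \<alpha> \<beta> :: "complex \<Rightarrow> complex"
  assumes "(LINT \<zeta>|M1. \<alpha> \<zeta> * g1 \<zeta>) = (LINT \<zeta>|M2. \<alpha> \<zeta> * g2 \<zeta>)" "\<And>\<zeta>. \<zeta> \<in> unit_circle \<Longrightarrow> \<beta> \<zeta> = \<alpha> \<zeta>"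
  shows "(LINT \<zeta>|M1. \<beta> \<zeta> * g1 \<zeta>) = (LINT \<zeta>|M2. \<beta> \<zeta> * g2 \<zeta>)"
proof -
  have "(LINT \<zeta>|M. \<beta> \<zeta> * g \<zeta>) = (LINT \<zeta>|M. \<alpha> \<zeta> * g \<zeta>)" if "space M = unit_circle" for M g
    by (rule Bochner_Integration.integral_cong) (simp_all add: that assms(2))
  from this[OF space_M12(1)] this[OF space_M12(2)] show ?thesis using assms(1) by simp
qed

lemma moments:
  assumes u: "u \<in> borel_measurable circle_borel" "\<And>\<zeta>. \<zeta> \<in> unit_circle \<Longrightarrow> cmod (u \<zeta>) = 1"
    and eq: "\<And>z. cmod z < 1 \<Longrightarrow> (LINT \<zeta>|M1. (2 / (1 - z * u \<zeta>) - 1) * g1 \<zeta>) = (LINT \<zeta>|M2. (2 / (1 - z * u \<zeta>) - 1) * g2 \<zeta>)"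
  shows "(LINT \<zeta>|M1. u \<zeta> ^ j * g1 \<zeta>) = (LINT \<zeta>|M2. u \<zeta> ^ j * g2 \<zeta>)"
proof -
  have u': "u \<in> borel_measurable M1" "u \<in> borel_measurable M2"
    using u(1) by (simp_all add: measurable_cong_sets[OF M1(1) refl] measurable_cong_sets[OF M2(1) refl])
  define a where "a M g = (\<lambda>j. (if j = 0 then 1 else 2) * (LINT \<zeta>|M. u \<zeta> ^ j * g \<zeta>))"
    for M and g :: "complex \<Rightarrow> complex"
  have "\<exists>s. (\<lambda>j. a M1 g1 j * z ^ j) sums s \<and> (\<lambda>j. a M2 g2 j * z ^ j) sums s" if z: "norm z < 1" for z
    using sums_integral_geometric[OF space_M12(1) M1(2) u'(1) u(2) z]
      sums_integral_geometric[OF space_M12(2) M2(2) u'(2) u(2) z] unfolding a_def eq[OF z] by blast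
  then have "a M1 g1 j = a M2 g2 j" by (rule power_series_eqD)
  then show ?thesis by (simp add: a_def split: if_splits)
qed

lemma integral_cnj_power_eq: "(LINT \<zeta>|M1. cnj \<zeta> ^ j * g1 \<zeta>) = (LINT \<zeta>|M2. cnj \<zeta> ^ j * g2 \<zeta>)"
proof (rule moments)
  show "cnj \<in> borel_measurable circle_borel"
    by (intro borel_measurable_continuous_on_restrict continuous_intros)
  fix z :: complex assume z: "cmod z < 1"
  show "(LINT \<zeta>|M1. (2 / (1 - z * cnj \<zeta>) - 1) * g1 \<zeta>) = (LINT \<zeta>|M2. (2 / (1 - z * cnj \<zeta>) - 1) * g2 \<zeta>)"
    by (rule integral_cong_circle[OF eq1[OF z]]) (simp only: herglotz_kernel_eq[OF z])
qed simp

lemma integral_power_eq: "(LINT \<zeta>|M1. \<zeta> ^ j * g1 \<zeta>) = (LINT \<zeta>|M2. \<zeta> ^ j * g2 \<zeta>)"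
proof (rule moments)
  show "(\<lambda>\<zeta>. \<zeta>) \<in> borel_measurable circle_borel"
    by (intro borel_measurable_continuous_on_restrict continuous_intros)
  fix z :: complex assume "cmod z < 1"
  then have z: "cmod (cnj z) < 1" by simp
  show "(LINT \<zeta>|M1. (2 / (1 - z * \<zeta>) - 1) * g1 \<zeta>) = (LINT \<zeta>|M2. (2 / (1 - z * \<zeta>) - 1) * g2 \<zeta>)"
    by (rule integral_cong_circle[OF eq2[OF z]]) (simp only: herglotz_kernel_eq[OF z], simp)
qed simp

lemma integral_mixed_power_eq:
  "(LINT \<zeta>|M1. \<zeta> ^ j * cnj \<zeta> ^ d * g1 \<zeta>) = (LINT \<zeta>|M2. \<zeta> ^ j * cnj \<zeta> ^ d * g2 \<zeta>)"
proof -
  have c: "\<zeta> ^ i * cnj \<zeta> ^ i = 1" if "\<zeta> \<in> unit_circle" for i \<zeta>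
    using circle_mult_cnj[OF that] by (simp flip: power_mult_distrib)
  show ?thesis
  proof (cases "d \<le> j")
    case True
    have "\<zeta> ^ j * cnj \<zeta> ^ d = \<zeta> ^ (j - d)" if "\<zeta> \<in> unit_circle" for \<zeta>
    proof -
      have "\<zeta> ^ j = \<zeta> ^ (j - d) * \<zeta> ^ d" using True by (simp flip: power_add)
      then show ?thesis using c[OF that, of d] by (simp add: mult.assoc)
    qed
    then show ?thesis by (rule integral_cong_circle[OF integral_power_eq])
  next
    case False
    have "\<zeta> ^ j * cnj \<zeta> ^ d = cnj \<zeta> ^ (d - j)" if "\<zeta> \<in> unit_circle" for \<zeta>
    proof -
      have "cnj \<zeta> ^ d = cnj \<zeta> ^ j * cnj \<zeta> ^ (d - j)" using False by (simp flip: power_add)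
      then show ?thesis using c[OF that, of j] by (simp flip: mult.assoc)
    qed
    then show ?thesis by (rule integral_cong_circle[OF integral_cnj_power_eq])
  qed
qed

lemma integral_polynomial_eq:
  assumes p: "real_polynomial_function p"
  shows "(LINT \<zeta>|M1. of_real (p \<zeta>) * g1 \<zeta>) = (LINT \<zeta>|M2. of_real (p \<zeta>) * g2 \<zeta>)"
proof -
  obtain P d where Pd: "\<And>\<zeta>. \<zeta> \<in> unit_circle \<Longrightarrow> of_real (p \<zeta>) = poly P \<zeta> * cnj \<zeta> ^ d"
    using real_polynomial_function_circle[OF p] by blast
  have "(LINT \<zeta>|M. of_real (p \<zeta>) * g \<zeta>) = (\<Sum>j\<le>degree P. coeff P j * (LINT \<zeta>|M. \<zeta> ^ j * cnj \<zeta> ^ d * g \<zeta>))"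
    if M: "sets M = sets circle_borel" "space M = unit_circle" "integrable M g" for M g
  proof -
    have int: "integrable M (\<lambda>\<zeta>. \<zeta> ^ j * cnj \<zeta> ^ d * g \<zeta>)" for j
    proof (rule integrable_bounded_mult[OF M(3), where b = 1])
      show "(\<lambda>\<zeta>. \<zeta> ^ j * cnj \<zeta> ^ d) \<in> borel_measurable M"
        unfolding measurable_cong_sets[OF M(1) refl]
        by (intro borel_measurable_continuous_on_restrict continuous_intros)
    qed (simp add: norm_mult norm_power M(2))
    have "(LINT \<zeta>|M. of_real (p \<zeta>) * g \<zeta>) = (LINT \<zeta>|M. (\<Sum>j\<le>degree P. coeff P j * (\<zeta> ^ j * cnj \<zeta> ^ d * g \<zeta>)))"
      by (rule Bochner_Integration.integral_cong)
         (simp_all add: M(2) Pd poly_altdef sum_distrib_left sum_distrib_right mult_ac)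
    also have "\<dots> = (\<Sum>j\<le>degree P. LINT \<zeta>|M. coeff P j * (\<zeta> ^ j * cnj \<zeta> ^ d * g \<zeta>))"
      by (intro Bochner_Integration.integral_sum integrable_mult_right) (rule int)
    finally show ?thesis by simp
  qed
  from this[OF M1(1) space_M12(1) M1(2)] this[OF M2(1) space_M12(2) M2(2)] show ?thesis
    by (simp only: integral_mixed_power_eq)
qed

lemma set_integral_closed_eq:
  assumes F: "closed F"
  shows "(LINT \<zeta>:F \<inter> unit_circle|M1. g1 \<zeta>) = (LINT \<zeta>:F \<inter> unit_circle|M2. g2 \<zeta>)"
proof (cases "F = {}")
  case False
  obtain p where p: "\<And>m. real_polynomial_function (p m)"
    and lim: "\<And>M g. sets M = sets circle_borel \<Longrightarrow> integrable M g \<Longrightarrow>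
      (\<lambda>m. LINT \<zeta>|M. of_real (p m \<zeta>) * g \<zeta>) \<longlonglongrightarrow> (LINT \<zeta>:F \<inter> unit_circle|M. g \<zeta> :: complex)"
    using set_integral_closed_limit[OF F False] by blast
  from lim[OF M1] lim[OF M2] show ?thesis
    unfolding integral_polynomial_eq[OF p] by (rule LIMSEQ_unique)
qed (simp add: set_lebesgue_integral_def)

text \<open>Dynkin's argument: the traces of closed sets form an intersection-stable generator on
  which the integrals agree. The case F = UNIV gives equal total integrals, which the complement
  step uses.\<close>

lemma set_integral_eq:
  assumes B: "B \<in> sets circle_borel"
  shows "(LINT \<zeta>:B|M1. g1 \<zeta>) = (LINT \<zeta>:B|M2. g2 \<zeta>)"
proof -
  have si: "set_integrable M1 A g1" "set_integrable M2 A g2" if "A \<in> sets circle_borel" for A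
    using M1 M2 that unfolding set_integrable_def by (auto intro: integrable_mult_indicator)
  have stable: "Int_stable {F \<inter> unit_circle |F. closed F}"
  proof (rule Int_stableI, clarsimp)
    fix F G :: "complex set" assume "closed F" "closed G"
    then show "\<exists>E. F \<inter> unit_circle \<inter> (G \<inter> unit_circle) = E \<inter> unit_circle \<and> closed E"
      by (intro exI[of _ "F \<inter> G"]) auto
  qed
  have sub: "{F \<inter> unit_circle |F. closed F} \<subseteq> Pow unit_circle" by auto
  have "B \<in> sigma_sets unit_circle {F \<inter> unit_circle |F. closed F}"
    using B by (simp only: sets_circle_borel_closed)
  from stable sub this show ?thesis
  proof (induction rule: sigma_sets_induct_disjoint)
    case (basic A)
    then show ?case using set_integral_closed_eq by auto
  next
    case empty
    then show ?case by (simp add: set_lebesgue_integral_def)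
  next
    case (compl A)
    then have A: "A \<in> sets circle_borel" by (simp only: sets_circle_borel_closed)
    have C: "unit_circle - A \<in> sets circle_borel"
      using sets.compl_sets[OF A] by (simp add: space_restrict_space)
    have *: "(LINT \<zeta>:unit_circle - A|M. g \<zeta>) = (LINT \<zeta>:UNIV \<inter> unit_circle|M. g \<zeta>) - (LINT \<zeta>:A|M. g \<zeta>)"
      if M: "set_integrable M A g" "set_integrable M (unit_circle - A) g" for M and g :: "complex \<Rightarrow> complex"
    proof -
      have "A \<union> (unit_circle - A) = UNIV \<inter> unit_circle"
        using sets.sets_into_space[OF A] by (auto simp: space_restrict_space)
      then have "(LINT \<zeta>:UNIV \<inter> unit_circle|M. g \<zeta>) = (LINT \<zeta>:A|M. g \<zeta>) + (LINT \<zeta>:unit_circle - A|M. g \<zeta>)"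
        using set_integral_Un[OF _ M] by auto
      then show ?thesis by simp
    qed
    show ?case
      using *[OF si(1)[OF A] si(1)[OF C]] *[OF si(2)[OF A] si(2)[OF C]] compl.IH set_integral_closed_eq[of UNIV] by simp
  next
    case (union A)
    then have A: "range A \<subseteq> sets circle_borel" by (simp only: sets_circle_borel_closed)
    then have U: "(\<Union>i. A i) \<in> sets circle_borel" by (intro sets.countable_UN) auto
    have "(LINT \<zeta>:(\<Union>i. A i)|M1. g1 \<zeta>) = (\<Sum>i. LINT \<zeta>:A i|M1. g1 \<zeta>)"
      using A union.hyps si(1)[OF U] M1(1)
      by (intro lebesgue_integral_countable_add) (auto simp: disjoint_family_on_def)
    moreover have "(LINT \<zeta>:(\<Union>i. A i)|M2. g2 \<zeta>) = (\<Sum>i. LINT \<zeta>:A i|M2. g2 \<zeta>)"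
      using A union.hyps si(2)[OF U] M2(1)
      by (intro lebesgue_integral_countable_add) (auto simp: disjoint_family_on_def)
    ultimately show ?case using union.IH by simp
  qed
qed

end

section \<open>From equal Herglotz integrals to equal matrix measures\<close>

lemma trace_density_AE_unique:
  assumes "trace_density q \<mu> D" and ik: "i < q" "k < q" and g: "integrable (trace_measure q \<mu>) g"
    and eq: "\<And>B. B \<in> sets circle_borel \<Longrightarrow> (LINT \<zeta>:B|trace_measure q \<mu>. g \<zeta>) = \<mu> B $$ (i, k)"
  shows "AE \<zeta> in trace_measure q \<mu>. D \<zeta> $$ (i, k) = g \<zeta>"
proof (rule sigma_finite_measure.density_unique_banach)
  show "sigma_finite_measure (trace_measure q \<mu>)"
    using finite_measure_trace_measure by (rule finite_measure.axioms)
  show "integrable (trace_measure q \<mu>) (\<lambda>\<zeta>. D \<zeta> $$ (i, k))"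
    using assms by (simp add: trace_density_def)
  show "(LINT \<zeta>:B|trace_measure q \<mu>. D \<zeta> $$ (i, k)) = (LINT \<zeta>:B|trace_measure q \<mu>. g \<zeta>)"
    if "B \<in> sets (trace_measure q \<mu>)" for B
    using assms(1) ik that by (simp add: trace_density_def trace_measure_sets eq)
qed (rule g)

text \<open>\<open>has_matrix_integral\<close> provides some density, possibly a different one for
  each \<open>f\<close>. Since densities agree almost everywhere, one fixed \<open>D\<close> can be
  used for all points \<open>z\<close>.\<close>

lemma has_matrix_integral_density:
  assumes J: "has_matrix_integral q \<mu> f J" and D: "trace_density q \<mu> D" and ik: "i < q" "k < q"
    and f: "f \<in> borel_measurable circle_borel"
  shows "J $$ (i, k) = (LINT \<zeta>|trace_measure q \<mu>. f \<zeta> * D \<zeta> $$ (i, k))"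
proof -
  obtain E where E: "trace_density q \<mu> E"
    and "J $$ (i, k) = (LINT \<zeta>|trace_measure q \<mu>. f \<zeta> * E \<zeta> $$ (i, k))"
    using J ik by (auto simp: has_matrix_integral_def)
  moreover have intE: "integrable (trace_measure q \<mu>) (\<lambda>\<zeta>. E \<zeta> $$ (i, k))"
    and intD: "integrable (trace_measure q \<mu>) (\<lambda>\<zeta>. D \<zeta> $$ (i, k))"
    using D E ik by (simp_all add: trace_density_def)
  have "AE \<zeta> in trace_measure q \<mu>. D \<zeta> $$ (i, k) = E \<zeta> $$ (i, k)"
    by (rule trace_density_AE_unique[OF D ik intE]) (use E ik in \<open>simp add: trace_density_def\<close>)
  then have "(LINT \<zeta>|trace_measure q \<mu>. f \<zeta> * D \<zeta> $$ (i, k)) = (LINT \<zeta>|trace_measure q \<mu>. f \<zeta> * E \<zeta> $$ (i, k))"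
    using f borel_measurable_integrable[OF intD] borel_measurable_integrable[OF intE]
    by (intro integral_cong_AE) (auto simp: borel_measurable_trace_measure intro!: borel_measurable_times)
  ultimately show ?thesis by simp
qed

lemma borel_measurable_herglotz_kernel:
  assumes "cmod z < 1"
  shows "(\<lambda>\<zeta>. (\<zeta> + z) / (\<zeta> - z)) \<in> borel_measurable circle_borel"
  using assms by (intro borel_measurable_continuous_on_restrict continuous_intros) auto

text \<open>Entry (i, k) of J gives the integral of the Herglotz kernel. The integral of the
  conjugate kernel comes from entry (k, i), because a density of a Hermitian measure is Hermitian
  almost everywhere.\<close>

lemma herglotz_measure_unique:
  assumes \<mu>: "nonneg_hermitian_measure q \<mu>"
      "\<And>z. z \<in> ball 0 1 \<Longrightarrow> has_matrix_integral q \<mu> (\<lambda>\<zeta>. (\<zeta> + z) / (\<zeta> - z)) (J z)"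
    and \<nu>: "nonneg_hermitian_measure q \<nu>"
      "\<And>z. z \<in> ball 0 1 \<Longrightarrow> has_matrix_integral q \<nu> (\<lambda>\<zeta>. (\<zeta> + z) / (\<zeta> - z)) (J z)"
  shows "\<mu> = \<nu>"
proof
  fix B
  show "\<mu> B = \<nu> B"
  proof (cases "B \<in> sets circle_borel")
    case False
    then show ?thesis using \<mu>(1) \<nu>(1) by (simp add: nonneg_hermitian_measure_def)
  next
    case B: True
    have conj: "cnj (J z $$ (k, i)) = (LINT \<zeta>|trace_measure q \<kappa>. cnj ((\<zeta> + z) / (\<zeta> - z)) * D \<zeta> $$ (i, k))"
      if \<kappa>: "nonneg_hermitian_measure q \<kappa>" "\<And>z. z \<in> ball 0 1 \<Longrightarrow> has_matrix_integral q \<kappa> (\<lambda>\<zeta>. (\<zeta> + z) / (\<zeta> - z)) (J z)"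
        and D: "trace_density q \<kappa> D" and ik: "i < q" "k < q" and z: "cmod z < 1" for \<kappa> D i k z
    proof -
      have int: "integrable (trace_measure q \<kappa>) (\<lambda>\<zeta>. D \<zeta> $$ (i, k))"
        if "i < q" "k < q" for i k using D that by (simp add: trace_density_def)
      have AE: "AE \<zeta> in trace_measure q \<kappa>. D \<zeta> $$ (k, i) = cnj (D \<zeta> $$ (i, k))"
      proof (rule trace_density_AE_unique[OF D ik(2,1)])
        show "integrable (trace_measure q \<kappa>) (\<lambda>\<zeta>. cnj (D \<zeta> $$ (i, k)))" using int[OF ik] by simp
        fix A assume A: "A \<in> sets circle_borel"
        then have "nonneg_hermitian q (\<kappa> A)" using \<kappa>(1) by (simp add: nonneg_hermitian_measure_def)
        then have "psd_on (\<lambda>r s. \<kappa> A $$ (r, s)) {..<q}"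
          using nonneg_hermitian_iff_psd_on by (auto simp: nonneg_hermitian_def)
        then have "\<kappa> A $$ (k, i) = cnj (\<kappa> A $$ (i, k))"
          by (rule psd_on_hermitian) (use ik in auto)
        also have "\<dots> = cnj (LINT \<zeta>|trace_measure q \<kappa>. indicator A \<zeta> *\<^sub>R D \<zeta> $$ (i, k))"
          using D ik A by (simp add: trace_density_def set_lebesgue_integral_def)
        also have "\<dots> = (LINT \<zeta>|trace_measure q \<kappa>. cnj (indicator A \<zeta> *\<^sub>R D \<zeta> $$ (i, k)))"
          by (rule Bochner_Integration.integral_cnj[symmetric])
        finally show "(LINT \<zeta>:A|trace_measure q \<kappa>. cnj (D \<zeta> $$ (i, k))) = \<kappa> A $$ (k, i)"
          by (simp add: set_lebesgue_integral_def)
      qed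
      have h: "(\<lambda>\<zeta>. (\<zeta> + z) / (\<zeta> - z)) \<in> borel_measurable (trace_measure q \<kappa>)"
        using borel_measurable_herglotz_kernel[OF z] by (simp add: borel_measurable_trace_measure)
      have "J z $$ (k, i) = (LINT \<zeta>|trace_measure q \<kappa>. (\<zeta> + z) / (\<zeta> - z) * D \<zeta> $$ (k, i))"
        by (rule has_matrix_integral_density[OF \<kappa>(2) D ik(2,1) borel_measurable_herglotz_kernel[OF z]])
           (use z in simp)
      also have "\<dots> = (LINT \<zeta>|trace_measure q \<kappa>. (\<zeta> + z) / (\<zeta> - z) * cnj (D \<zeta> $$ (i, k)))"
      proof (rule integral_cong_AE)
        show "(\<lambda>\<zeta>. (\<zeta> + z) / (\<zeta> - z) * D \<zeta> $$ (k, i)) \<in> borel_measurable (trace_measure q \<kappa>)"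
          using h borel_measurable_integrable[OF int[OF ik(2,1)]] by (rule borel_measurable_times)
        have "(\<lambda>\<zeta>. cnj (D \<zeta> $$ (i, k))) \<in> borel_measurable (trace_measure q \<kappa>)"
          using int[OF ik] by (intro borel_measurable_integrable) simp
        with h show "(\<lambda>\<zeta>. (\<zeta> + z) / (\<zeta> - z) * cnj (D \<zeta> $$ (i, k))) \<in> borel_measurable (trace_measure q \<kappa>)"
          by (rule borel_measurable_times)
      qed (use AE in auto)
      finally have "cnj (J z $$ (k, i)) = (LINT \<zeta>|trace_measure q \<kappa>. cnj ((\<zeta> + z) / (\<zeta> - z) * cnj (D \<zeta> $$ (i, k))))"
        by (simp only: Bochner_Integration.integral_cnj)
      then show ?thesis by simp
    qed
    obtain D E where D: "trace_density q \<mu> D" and E: "trace_density q \<nu> E"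
      using \<mu>(2)[of 0] \<nu>(2)[of 0] by (auto simp: has_matrix_integral_def)
    have eq: "\<mu> B $$ (i, k) = \<nu> B $$ (i, k)" if ik: "i < q" "k < q" for i k
    proof -
      have "(LINT \<zeta>:B|trace_measure q \<mu>. D \<zeta> $$ (i, k)) = (LINT \<zeta>:B|trace_measure q \<nu>. E \<zeta> $$ (i, k))"
      proof (rule same_herglotz_integrals.set_integral_eq[OF same_herglotz_integrals.intro B];
          (rule trace_measure_sets)?)
        show "integrable (trace_measure q \<mu>) (\<lambda>\<zeta>. D \<zeta> $$ (i, k))"
          "integrable (trace_measure q \<nu>) (\<lambda>\<zeta>. E \<zeta> $$ (i, k))"
          using D E ik by (simp_all add: trace_density_def)
        fix z :: complex assume z: "cmod z < 1"
        then have z': "z \<in> ball 0 1" by simp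
        show "(LINT \<zeta>|trace_measure q \<mu>. (\<zeta> + z) / (\<zeta> - z) * D \<zeta> $$ (i, k)) =
            (LINT \<zeta>|trace_measure q \<nu>. (\<zeta> + z) / (\<zeta> - z) * E \<zeta> $$ (i, k))"
          using has_matrix_integral_density[OF \<mu>(2)[OF z'] D ik borel_measurable_herglotz_kernel[OF z]]
            has_matrix_integral_density[OF \<nu>(2)[OF z'] E ik borel_measurable_herglotz_kernel[OF z]]
          by (simp only:)
        show "(LINT \<zeta>|trace_measure q \<mu>. cnj ((\<zeta> + z) / (\<zeta> - z)) * D \<zeta> $$ (i, k)) =
            (LINT \<zeta>|trace_measure q \<nu>. cnj ((\<zeta> + z) / (\<zeta> - z)) * E \<zeta> $$ (i, k))"
          using conj[OF \<mu> D ik z] conj[OF \<nu> E ik z] by (simp only:)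
      qed
      then show ?thesis using D E ik B by (simp add: trace_density_def)
    qed
    have "\<mu> B \<in> carrier_mat q q" "\<nu> B \<in> carrier_mat q q"
      using \<mu>(1) \<nu>(1) B by (simp_all add: nonneg_hermitian_measure_def nonneg_hermitian_def)
    then show ?thesis by (intro eq_matI) (auto simp: eq)
  qed
qed

section \<open>Arc length and the Schwarz integral\<close>

lemma sets_arc_length [simp, measurable_cong]: "sets arc_length = sets circle_borel"
  by (simp add: arc_length_def)

lemma space_circle_borel [simp]: "space circle_borel = unit_circle"
  by (simp add: space_restrict_space)

lemma space_arc_length [simp]: "space arc_length = unit_circle"
  using sets_eq_imp_space_eq[OF sets_arc_length] by simp

lemma measurable_cis: "cis \<in> restrict_space lborel {0..<2 * pi} \<rightarrow>\<^sub>M circle_borel"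
proof (rule measurable_restrict_space2)
  have "cis \<in> borel_measurable borel"
    by (intro borel_measurable_continuous_onI continuous_intros)
  then show "cis \<in> restrict_space lborel {0..<2 * pi} \<rightarrow>\<^sub>M borel"
    by (intro measurable_restrict_space1) simp
qed auto

lemma finite_measure_arc_length: "finite_measure arc_length"
proof
  have "emeasure arc_length (space arc_length) = emeasure (restrict_space lborel {0..<2 * pi}) (cis -` unit_circle \<inter> space (restrict_space lborel {0..<2 * pi}))"
    unfolding space_arc_length unfolding arc_length_def
    by (rule emeasure_distr[OF measurable_cis]) (metis sets.top space_circle_borel)
  also have "cis -` unit_circle \<inter> space (restrict_space lborel {0..<2 * pi}) = {0..<2 * pi}"
    by (auto simp: space_restrict_space)
  also have "emeasure (restrict_space lborel {0..<2 * pi}) {0..<2 * pi} = emeasure lborel {0..<2 * pi}"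
    by (rule emeasure_restrict_space) auto
  also have "\<dots> < \<infinity>" by simp
  finally show "emeasure arc_length (space arc_length) \<noteq> \<infinity>" by simp
qed

lemma emeasure_arc_length_finite:
  assumes "finite N" "N \<subseteq> unit_circle"
  shows "emeasure arc_length N = 0"
proof -
  have N: "N \<in> sets circle_borel"
    using assms by (subst sets_restrict_space_iff) (auto intro: finite_imp_closed borel_closed)
  have "inj_on cis {0..<2 * pi}"
  proof (rule inj_onI)
    fix s t assume st: "s \<in> {0..<2 * pi}" "t \<in> {0..<2 * pi}" "cis s = cis t"
    have "Arg2pi (cis x) = x" if "0 \<le> x" "x < 2 * pi" for x
      by (rule Arg2pi_unique[of 1]) (use that in \<open>simp_all add: cis_conv_exp\<close>)
    from this[of s] this[of t] st show "s = t" by (metis atLeastLessThan_iff)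
  qed
  then have fin: "finite (cis -` N \<inter> {0..<2 * pi})"
    using assms by (metis finite_vimage_IntI)
  have "emeasure arc_length N = emeasure (restrict_space lborel {0..<2 * pi}) (cis -` N \<inter> space (restrict_space lborel {0..<2 * pi}))"
    unfolding arc_length_def by (rule emeasure_distr[OF measurable_cis N])
  also have "\<dots> = emeasure lborel (cis -` N \<inter> {0..<2 * pi})"
    by (subst emeasure_restrict_space) (auto simp: space_restrict_space)
  also have "\<dots> = 0"
    using fin by (intro emeasure_lborel_countable countable_finite)
  finally show ?thesis .
qed

lemma borel_measurable_circle:
  fixes g :: "complex \<Rightarrow> 'b::topological_space"
  assumes "continuous_on unit_circle g"
  shows "g \<in> borel_measurable circle_borel"
  using assms by (rule borel_measurable_continuous_on_restrict)

lemma integral_arc_length: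
  fixes g :: "complex \<Rightarrow> complex"
  assumes g: "continuous_on unit_circle g"
  shows "integral\<^sup>L arc_length g = integral {0..2 * pi} (\<lambda>t. g (cis t))"
proof -
  have cont: "continuous_on {0..2 * pi} (\<lambda>t. g (cis t))"
    by (rule continuous_on_compose2[OF g]) (auto intro!: continuous_intros)
  then have si: "set_integrable lborel {0..2 * pi} (\<lambda>t. g (cis t))"
    unfolding set_integrable_def by (intro borel_integrable_compact) auto
  then have si': "set_integrable lborel {0..<2 * pi} (\<lambda>t. g (cis t))"
    by (rule set_integrable_subset) auto
  have "integral\<^sup>L arc_length g = (LINT t|restrict_space lborel {0..<2 * pi}. g (cis t))"
    unfolding arc_length_def by (rule integral_distr[OF measurable_cis borel_measurable_circle[OF g]])
  also have "\<dots> = (LINT t:{0..<2 * pi}|lborel. g (cis t))"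
    unfolding set_lebesgue_integral_def by (rule integral_restrict_space) auto
  also have "\<dots> = integral {0..<2 * pi} (\<lambda>t. g (cis t))"
    by (rule set_borel_integral_eq_integral(2)[OF si'])
  also have "\<dots> = integral {0..2 * pi} (\<lambda>t. g (cis t))"
    by (rule integral_subset_negligible) (auto intro: negligible_subset[of "{2 * pi}"])
  finally show ?thesis .
qed

lemma integrable_arc_length:
  fixes g :: "complex \<Rightarrow> complex"
  assumes g: "continuous_on unit_circle g"
  shows "integrable arc_length g"
proof -
  have "compact (g ` unit_circle)" by (rule compact_continuous_image[OF g]) simp
  then obtain b where "\<forall>x\<in>unit_circle. norm (g x) \<le> b"
    unfolding image_iff using compact_imp_bounded[of "g ` unit_circle"] by (auto simp: bounded_iff)
  then show ?thesis
    by (intro finite_measure.integrable_const_bound[OF finite_measure_arc_length, of _ b])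
       (auto simp: measurable_cong_sets[OF sets_arc_length refl] intro!: borel_measurable_circle[OF g])
qed

text \<open>On the unit circle d\<zeta> equals \<i> \<zeta> times arc length, hence the factor
  between \<open>g\<close> and \<open>f\<close>.\<close>

lemma has_contour_integral_arc_length:
  assumes g: "continuous_on unit_circle g"
    and f: "(f has_contour_integral c) (circlepath 0 1)"
    and fg: "\<And>\<zeta>. \<zeta> \<in> unit_circle \<Longrightarrow> g \<zeta> = f \<zeta> * \<i> * \<zeta>"
  shows "integral\<^sup>L arc_length g = c"
proof -
  have "c = contour_integral (part_circlepath 0 1 0 (2 * pi)) f"
    using contour_integral_unique[OF f] by (simp add: circlepath_def)
  also have "\<dots> = integral {0..2 * pi} (\<lambda>t. f (cis t) * \<i> * cis t)"
    by (subst contour_integral_part_circlepath_eq) auto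
  also have "\<dots> = integral {0..2 * pi} (\<lambda>t. g (cis t))"
    by (intro integral_cong) (simp add: fg)
  finally show ?thesis by (simp add: integral_arc_length[OF g])
qed

text \<open>After division by \<i> \<zeta> the first kernel is (2 / (\<zeta> - z) - 1 / \<zeta>) /
  \<i>, and Cauchy's formula applies at z and at 0. On the circle the conjugate kernel equals (1 +
  cnj z \<zeta>) / (1 - cnj z \<zeta>), which is holomorphic in the disk with value 1 at 0, so the
  mean value property applies.\<close>

lemma schwarz_integral:
  assumes F: "continuous_on (cball 0 1) F" "F holomorphic_on ball 0 1" and z: "z \<in> ball 0 1"
  shows "(LINT \<zeta>|arc_length. (\<zeta> + z) / (\<zeta> - z) * F \<zeta>) = 2 * complex_of_real pi * (2 * F z - F 0)"
    and "(LINT \<zeta>|arc_length. cnj ((\<zeta> + z) / (\<zeta> - z)) * F \<zeta>) = 2 * complex_of_real pi * F 0"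
proof -
  have ne: "\<zeta> \<noteq> 0" "\<zeta> - z \<noteq> 0" "1 - cnj z * \<zeta> \<noteq> 0" if "\<zeta> \<in> unit_circle" for \<zeta>
  proof -
    show "\<zeta> \<noteq> 0" "\<zeta> - z \<noteq> 0" using that z by auto
    have "cmod (cnj z * \<zeta>) < 1" using that z by (simp add: norm_mult)
    then show "1 - cnj z * \<zeta> \<noteq> 0" by auto
  qed
  have cF: "continuous_on unit_circle F" by (rule continuous_on_subset[OF F(1)]) auto
  have c: "((\<lambda>u. F u / (u - a)) has_contour_integral 2 * of_real pi * \<i> * F a) (circlepath 0 1)"
    if "a \<in> ball 0 1" for a
    by (rule Cauchy_integral_circlepath) (use F that in auto)
  show "(LINT \<zeta>|arc_length. (\<zeta> + z) / (\<zeta> - z) * F \<zeta>) = 2 * complex_of_real pi * (2 * F z - F 0)"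
  proof (rule has_contour_integral_arc_length
        [where f = "\<lambda>u. (2 * (F u / (u - z)) - F u / (u - 0)) / \<i>"])
    show "continuous_on unit_circle (\<lambda>\<zeta>. (\<zeta> + z) / (\<zeta> - z) * F \<zeta>)"
      using ne by (intro continuous_intros cF) auto
    show "((\<lambda>u. (2 * (F u / (u - z)) - F u / (u - 0)) / \<i>) has_contour_integral 2 * complex_of_real pi * (2 * F z - F 0)) (circlepath 0 1)"
      using has_contour_integral_div[OF has_contour_integral_diff[OF has_contour_integral_lmul[OF c[OF z], of 2] c[of 0]], of \<i>]
      by (simp add: algebra_simps)
    show "(\<zeta> + z) / (\<zeta> - z) * F \<zeta> = (2 * (F \<zeta> / (\<zeta> - z)) - F \<zeta> / (\<zeta> - 0)) / \<i> * \<i> * \<zeta>"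
      if "\<zeta> \<in> unit_circle" for \<zeta>
      using ne[OF that] by (simp add: field_simps)
  qed
  define G where "G = (\<lambda>\<zeta>. (1 + cnj z * \<zeta>) / (1 - cnj z * \<zeta>) * F \<zeta>)"
  have ne': "1 - cnj z * \<zeta> \<noteq> 0" if "\<zeta> \<in> cball 0 1" for \<zeta>
  proof -
    have "cmod (cnj z * \<zeta>) \<le> cmod z" using that z by (simp add: norm_mult mult_left_le)
    then show ?thesis using z by auto
  qed
  have G: "continuous_on (cball 0 1) G" "G holomorphic_on ball 0 1"
    unfolding G_def using ne' by (intro continuous_intros holomorphic_intros F; force)+
  have cG: "continuous_on unit_circle G" by (rule continuous_on_subset[OF G(1)]) auto
  have "((\<lambda>u. G u / (u - 0) / \<i>) has_contour_integral 2 * of_real pi * \<i> * G 0 / \<i>) (circlepath 0 1)"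
    by (intro has_contour_integral_div Cauchy_integral_circlepath) (use G in auto)
  moreover have "2 * of_real pi * \<i> * G 0 / \<i> = 2 * complex_of_real pi * G 0" by simp
  ultimately have "((\<lambda>u. G u / (u - 0) / \<i>) has_contour_integral 2 * complex_of_real pi * G 0) (circlepath 0 1)"
    by (simp only:)
  then have "integral\<^sup>L arc_length G = 2 * complex_of_real pi * G 0"
    by (rule has_contour_integral_arc_length[OF cG]) (use ne in \<open>simp add: mult_ac\<close>)
  moreover have "cnj ((\<zeta> + z) / (\<zeta> - z)) * F \<zeta> = G \<zeta>" if "\<zeta> \<in> unit_circle" for \<zeta>
  proof -
    have "cnj ((\<zeta> + z) / (\<zeta> - z)) = (1 / \<zeta> + cnj z) / (1 / \<zeta> - cnj z)"
      by (simp add: cnj_circle[OF that])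
    also have "\<dots> = (1 + cnj z * \<zeta>) / (1 - cnj z * \<zeta>)"
      using ne[OF that] by (simp add: divide_simps)
    finally show ?thesis by (simp add: G_def)
  qed
  then have "(LINT \<zeta>|arc_length. cnj ((\<zeta> + z) / (\<zeta> - z)) * F \<zeta>) = integral\<^sup>L arc_length G"
    by (intro Bochner_Integration.integral_cong) auto
  ultimately show "(LINT \<zeta>|arc_length. cnj ((\<zeta> + z) / (\<zeta> - z)) * F \<zeta>) = 2 * complex_of_real pi * F 0"
    by (simp add: G_def)
qed

section \<open>The Riesz--Herglotz measure of the central function\<close>

lemma remove_sings_local:
  assumes F': "F' analytic_on {z}" and ev: "\<forall>\<^sub>F w in at z. F w = F' w"
  shows "remove_sings F analytic_on {z}" and "remove_sings F z = F' z"
proof -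
  have "isCont F' z" using F' by (rule analytic_at_imp_isCont)
  then have "F' \<midarrow>z\<rightarrow> F' z" by (simp add: isCont_def)
  then have lim: "F \<midarrow>z\<rightarrow> F' z" using tendsto_cong[OF ev] by simp
  have "isolated_singularity_at F' z" using F' by (rule isolated_singularity_at_analytic)
  then have "isolated_singularity_at F z" using isolated_singularity_at_cong[OF ev refl] by simp
  then show "remove_sings F analytic_on {z}" using lim by (rule remove_sings_analytic_at)
  show "remove_sings F z = F' z" using lim by (rule remove_sings_eqI)
qed

lemma herglotz_kernel_pole:
  fixes z w x :: complex
  assumes "w \<noteq> z"
  shows "(z + w) / (z - w) * x = - 2 * z * x / (w - z) - x"
proof -
  have "(z + w) / (z - w) = - ((z + w) / (w - z))"
    by (metis minus_diff_eq minus_divide_right)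
  also have "(z + w) / (w - z) = (2 * z + (w - z)) / (w - z)" by simp
  also have "\<dots> = 2 * z / (w - z) + 1"
    unfolding add_divide_distrib using assms by simp
  finally show ?thesis by (simp add: left_diff_distrib)
qed

text \<open>Conjugation inverts both points and thereby changes the sign of the quotient. For v =
  \<zeta> the quotient is 0 by the convention on division.\<close>

lemma Re_herglotz_kernel_circle:
  assumes "v \<in> unit_circle" "\<zeta> \<in> unit_circle"
  shows "Re ((v + \<zeta>) / (v - \<zeta>)) = 0"
proof -
  have 0: "v \<noteq> 0" "\<zeta> \<noteq> 0" using assms by auto
  show ?thesis
  proof (cases "v = \<zeta>")
    case False
    then have "cnj ((v + \<zeta>) / (v - \<zeta>)) = - ((v + \<zeta>) / (v - \<zeta>))"
      using 0 by (simp add: cnj_circle[OF assms(1)] cnj_circle[OF assms(2)] divide_simps) (simp add: algebra_simps)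
    moreover have "Re w = 0" if "cnj w = - w" for w :: complex
      using that by (simp add: complex_eq_iff)
    ultimately show ?thesis by blast
  qed simp
qed

context central
begin

section \<open>Cramer's rule, the poles on the circle and their removal\<close>

definition f :: "complex \<Rightarrow> complex" where
  "f z = det (b_fun q n \<Gamma> z)"

definition g :: "nat \<Rightarrow> nat \<Rightarrow> complex \<Rightarrow> complex" where
  "g i k z = (a_fun q n \<Gamma> z * adj_mat (b_fun q n \<Gamma> z)) $$ (i, k)"

abbreviation N :: "complex set" where
  "N \<equiv> N_set q n \<Gamma>"

abbreviation X :: "complex \<Rightarrow> complex mat" where
  "X \<equiv> X_mat q n \<Gamma>"

definition \<Delta> :: "nat \<Rightarrow> nat \<Rightarrow> complex \<Rightarrow> complex" where
  "\<Delta> i k z = (\<Sum>v\<in>N. (v + z) / (v - z) * X v $$ (i, k))"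

abbreviation \<Lambda> :: "nat \<Rightarrow> nat \<Rightarrow> complex \<Rightarrow> complex" where
  "\<Lambda> i k z \<equiv> Lambda_fun q n \<Gamma> z $$ (i, k)"

lemma holomorphic_b: "k < q \<Longrightarrow> a < q \<Longrightarrow> (\<lambda>z. b_fun q n \<Gamma> z $$ (k, a)) holomorphic_on S"
  by (simp only: b_index) (intro holomorphic_intros)

lemma holomorphic_a: "i < q \<Longrightarrow> a < q \<Longrightarrow> (\<lambda>z. a_fun q n \<Gamma> z $$ (i, a)) holomorphic_on S"
  by (simp only: a_index) (intro holomorphic_intros)

lemma holomorphic_f: "f holomorphic_on S"
  unfolding f_def[abs_def] by (rule holomorphic_on_det[OF b_carrier holomorphic_b])

lemma g_eq: "i < q \<Longrightarrow> k < q \<Longrightarrow> g i k z = (\<Sum>j<q. a_fun q n \<Gamma> z $$ (i, j) * adj_mat (b_fun q n \<Gamma> z) $$ (j, k))"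
  unfolding g_def by (rule mat_mult_index[OF a_carrier adj_mat(1)[OF b_carrier]])

lemma holomorphic_g: "i < q \<Longrightarrow> k < q \<Longrightarrow> g i k holomorphic_on S"
proof -
  assume ik: "i < q" "k < q"
  have "g i k = (\<lambda>z. \<Sum>j<q. a_fun q n \<Gamma> z $$ (i, j) * adj_mat (b_fun q n \<Gamma> z) $$ (j, k))"
    using g_eq[OF ik] by (rule ext)
  moreover have "\<dots> holomorphic_on S"
    by (intro holomorphic_intros holomorphic_a holomorphic_on_adj_mat[OF b_carrier holomorphic_b])
       (use ik in auto)
  ultimately show ?thesis by (simp only:)
qed

lemma f_0: "f 0 = 1"
proof -
  have "b_fun q n \<Gamma> 0 = 1\<^sub>m q"
    by (rule eq_matI) (use b_carrier[of 0] in \<open>auto simp: b_index\<close>)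
  then show ?thesis by (simp add: f_def)
qed

lemma eventually_f_neq_0: "\<forall>\<^sub>F w in at z. f w \<noteq> 0"
proof -
  have "\<forall>\<^sub>F w in at z. f w \<noteq> 0 \<and> w \<in> UNIV"
    by (rule non_zero_neighbour_alt[OF holomorphic_f open_UNIV connected_UNIV UNIV_I, of 0]) (simp_all add: f_0)
  then show ?thesis by simp
qed

lemma N_eq: "N = {v \<in> unit_circle. f v = 0}"
  by (simp add: N_set_def f_def)

lemma finite_N: "finite N"
proof (cases "f constant_on UNIV")
  case True
  then have "f v = 1" for v using f_0 by (auto simp: constant_on_def)
  then show ?thesis by (simp add: N_eq)
next
  case False
  then show ?thesis unfolding N_eq
    by (intro holomorphic_compact_finite_zeros[OF holomorphic_f open_UNIV connected_UNIV]) auto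
qed

lemma N_subset: "N \<subseteq> unit_circle"
  by (auto simp: N_eq)

lemma \<Phi>_mult_f:
  assumes z: "cmod z < 1" and ik: "i < q" "k < q"
  shows "\<Phi> z $$ (i, k) * f z = g i k z"
proof -
  let ?b = "b_fun q n \<Gamma> z"
  have "a_fun q n \<Gamma> z * adj_mat ?b = \<Phi> z * (?b * adj_mat ?b)"
    unfolding \<Phi>_mult_b[OF z, symmetric]
    by (rule assoc_mult_mat[OF \<Phi>_carrier b_carrier adj_mat(1)[OF b_carrier]])
  also have "\<dots> = f z \<cdot>\<^sub>m \<Phi> z"
    unfolding adj_mat(2)[OF b_carrier] f_def
    using mult_smult_distrib[OF \<Phi>_carrier one_carrier_mat] right_mult_one_mat[OF \<Phi>_carrier] by metis
  finally show ?thesis using ik \<Phi>_carrier[of z] by (simp add: g_def mult.commute)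
qed

lemma \<Phi>_eq: "cmod z < 1 \<Longrightarrow> i < q \<Longrightarrow> k < q \<Longrightarrow> f z \<noteq> 0 \<Longrightarrow> g i k z / f z = \<Phi> z $$ (i, k)"
  by (simp flip: \<Phi>_mult_f)

lemma a_mult_inverse_b:
  assumes f: "f z \<noteq> 0" and ik: "i < q" "k < q"
  shows "a_fun q n \<Gamma> z * the (mat_inverse (b_fun q n \<Gamma> z)) \<in> carrier_mat q q"
    and "(a_fun q n \<Gamma> z * the (mat_inverse (b_fun q n \<Gamma> z))) $$ (i, k) = g i k z / f z"
proof -
  let ?a = "a_fun q n \<Gamma> z" and ?b = "b_fun q n \<Gamma> z"
  have "?b \<in> Units (ring_mat TYPE(complex) q ())"
    using f by (intro det_non_zero_imp_unit[OF b_carrier]) (simp add: f_def)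
  then obtain B where B: "mat_inverse ?b = Some B"
    using mat_inverse(1)[OF b_carrier, where b = "()"] by (cases "mat_inverse ?b") blast+
  have bB: "?b * B = 1\<^sub>m q" and Bc: "B \<in> carrier_mat q q"
    using mat_inverse(2)[OF b_carrier B] by auto
  show c: "?a * the (mat_inverse ?b) \<in> carrier_mat q q"
    unfolding B option.sel by (rule mult_carrier_mat[OF a_carrier Bc])
  have adj: "adj_mat ?b \<in> carrier_mat q q" by (rule adj_mat(1)[OF b_carrier])
  have "adj_mat ?b = adj_mat ?b * (?b * B)" unfolding bB using right_mult_one_mat[OF adj] by simp
  also have "\<dots> = (adj_mat ?b * ?b) * B" by (rule assoc_mult_mat[OF adj b_carrier Bc, symmetric])
  also have "\<dots> = f z \<cdot>\<^sub>m B"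
    unfolding adj_mat(3)[OF b_carrier] f_def
    using mult_smult_assoc_mat[OF one_carrier_mat Bc] left_mult_one_mat[OF Bc] by metis
  finally have "?a * adj_mat ?b = f z \<cdot>\<^sub>m (?a * B)"
    using mult_smult_distrib[OF a_carrier Bc] by metis
  then have "g i k z = f z * (?a * B) $$ (i, k)"
    using ik a_carrier[of z] Bc by (simp add: g_def)
  then show "(?a * the (mat_inverse ?b)) $$ (i, k) = g i k z / f z"
    using f by (simp add: B)
qed

lemma pole_at_N:
  assumes v: "v \<in> N" and ik: "i < q" "k < q"
  shows "\<exists>h. h analytic_on {v} \<and> (\<forall>\<^sub>F z in at v. f z \<noteq> 0 \<and> g i k z / f z = - 2 * v * X v $$ (i, k) / (z - v) + h z)"
proof (rule simple_pole_on_circle[OF holomorphic_f _ holomorphic_g[OF ik]])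
  show "f 0 \<noteq> 0" by (simp add: f_0)
  show "cmod v = 1" "f v = 0" using v by (auto simp: N_eq)
  show "\<Phi> z $$ (i, k) * f z = g i k z" "cmod (\<Phi> z $$ (i, k)) \<le> bound / (1 - cmod z)" if "cmod z < 1" for z
    using \<Phi>_mult_f[OF that ik] \<Phi>_bounds(2)[OF ik that] .
  show "X v $$ (i, k) = - of_nat (nat (zorder f v)) / (2 * v * (deriv ^^ nat (zorder f v)) f v) *
      (deriv ^^ (nat (zorder f v) - 1)) (g i k) v"
    using ik by (simp add: X_mat_def Let_def zero_mult_def f_def[abs_def] g_def[abs_def])
qed simp

lemma analytic_\<Delta>: "z \<notin> N \<Longrightarrow> \<Delta> i k analytic_on {z}"
  unfolding \<Delta>_def[abs_def] by (intro analytic_intros) auto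

text \<open>There are three reasons for the singularity to be removable. In the open disk \<Phi> -
  \<Delta> is itself the extension, even at a possible zero of \<open>f\<close>. On the circle off
  \<open>N\<close> the denominator does not vanish. At a point of \<open>N\<close> the simple pole
  is cancelled by its own summand of \<Delta>.\<close>

lemma \<Lambda>_local:
  assumes z: "cmod z \<le> 1" and ik: "i < q" "k < q"
  shows "\<exists>F. F analytic_on {z} \<and> (\<forall>\<^sub>F w in at z. g i k w / f w - \<Delta> i k w = F w) \<and>
    (cmod z < 1 \<longrightarrow> F z = \<Phi> z $$ (i, k) - \<Delta> i k z)"
proof -
  consider "cmod z < 1" | "cmod z = 1" "z \<notin> N" | "z \<in> N" "cmod z = 1"
    using z by fastforce
  then show ?thesis
  proof cases
    case 1
    let ?F = "\<lambda>w. \<Phi> w $$ (i, k) - \<Delta> i k w"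
    have zN: "z \<notin> N" using 1 by (auto simp: N_eq)
    have "(\<lambda>w. \<Phi> w $$ (i, k)) analytic_on {z}"
      by (rule holomorphic_on_imp_analytic_at[OF holomorphic_\<Phi>[OF ik]]) (use 1 in auto)
    then have "?F analytic_on {z}" by (intro analytic_intros analytic_\<Delta> zN)
    moreover have "\<forall>\<^sub>F w in at z. w \<in> ball 0 1 - {z}"
      by (rule eventually_at_in_open) (use 1 in auto)
    then have "\<forall>\<^sub>F w in at z. g i k w / f w - \<Delta> i k w = ?F w"
      using eventually_f_neq_0[of z] by eventually_elim (use \<Phi>_eq ik in auto)
    ultimately show ?thesis by blast
  next
    case 2
    then have "f z \<noteq> 0" by (auto simp: N_eq)
    moreover have "f analytic_on {z}" "g i k analytic_on {z}"
      by (auto intro!: holomorphic_on_imp_analytic_at[of _ UNIV] holomorphic_f holomorphic_g ik)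
    ultimately have "(\<lambda>w. g i k w / f w - \<Delta> i k w) analytic_on {z}"
      by (intro analytic_intros analytic_\<Delta> 2) auto
    then show ?thesis using 2 by (intro exI[of _ "\<lambda>w. g i k w / f w - \<Delta> i k w"]) auto
  next
    case 3
    obtain h where h: "h analytic_on {z}"
      and ev: "\<forall>\<^sub>F w in at z. f w \<noteq> 0 \<and> g i k w / f w = - 2 * z * X z $$ (i, k) / (w - z) + h w"
      using pole_at_N[OF 3(1) ik] by blast
    let ?F = "\<lambda>w. h w + X z $$ (i, k) - (\<Sum>v\<in>N - {z}. (v + w) / (v - w) * X v $$ (i, k))"
    have "?F analytic_on {z}" by (intro analytic_intros h) auto
    moreover have "\<forall>\<^sub>F w in at z. w \<noteq> z" by (simp add: eventually_at_filter)
    with ev have "\<forall>\<^sub>F w in at z. g i k w / f w - \<Delta> i k w = ?F w"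
    proof eventually_elim
      case (elim w)
      have \<Delta>: "\<Delta> i k w = (z + w) / (z - w) * X z $$ (i, k) + (\<Sum>v\<in>N - {z}. (v + w) / (v - w) * X v $$ (i, k))"
        unfolding \<Delta>_def by (rule sum.remove[OF finite_N 3(1)])
      have arith: "G - D = h + x - s" if "G = p + h" "D = y + s" "y = p - x" for G D h x s p y :: complex
        using that by simp
      show ?case
        by (rule arith[OF _ \<Delta> herglotz_kernel_pole[OF elim(2)]]) (use elim(1) in blast)
    qed
    moreover have "\<not> cmod z < 1" using 3 by simp
    ultimately show ?thesis by (intro exI[of _ ?F] conjI impI) (assumption | erule notE)+
  qed
qed

lemma \<Lambda>_eq_remove_sings:
  assumes "i < q" "k < q"
  shows "\<Lambda> i k z = remove_sings (\<lambda>w. g i k w / f w - \<Delta> i k w) z"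
proof -
  have "\<forall>\<^sub>F w in at z. (a_fun q n \<Gamma> w * the (mat_inverse (b_fun q n \<Gamma> w)) - Delta_fun q n \<Gamma> w) $$ (i, k) = g i k w / f w - \<Delta> i k w"
    using eventually_f_neq_0[of z]
  proof eventually_elim
    case (elim w)
    then show ?case
      using a_mult_inverse_b[OF elim assms] assms by (simp add: Delta_fun_def \<Delta>_def)
  qed
  then show ?thesis
    using assms by (simp add: Lambda_fun_def remove_sings_cong[OF _ refl])
qed

lemma analytic_\<Lambda>:
  assumes "i < q" "k < q"
  shows "\<Lambda> i k analytic_on cball 0 1"
proof -
  have "\<Lambda> i k analytic_on {z}" if z: "cmod z \<le> 1" for z
  proof -
    obtain F where "F analytic_on {z}" "\<forall>\<^sub>F w in at z. g i k w / f w - \<Delta> i k w = F w"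
      using \<Lambda>_local[OF z assms] by blast
    then show ?thesis unfolding \<Lambda>_eq_remove_sings[OF assms] by (rule remove_sings_local(1))
  qed
  then show ?thesis by (subst analytic_on_analytic_at) auto
qed

lemma \<Lambda>_disk: "cmod z < 1 \<Longrightarrow> i < q \<Longrightarrow> k < q \<Longrightarrow> \<Lambda> i k z = \<Phi> z $$ (i, k) - \<Delta> i k z"
  unfolding \<Lambda>_eq_remove_sings using \<Lambda>_local[of z i k] remove_sings_local(2) by fastforce

lemma continuous_\<Lambda>: "i < q \<Longrightarrow> k < q \<Longrightarrow> continuous_on (cball 0 1) (\<Lambda> i k)"
  by (intro holomorphic_on_imp_continuous_on analytic_imp_holomorphic analytic_\<Lambda>)

lemma holomorphic_\<Lambda>: "i < q \<Longrightarrow> k < q \<Longrightarrow> \<Lambda> i k holomorphic_on ball 0 1"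
  by (rule holomorphic_on_subset[OF analytic_imp_holomorphic[OF analytic_\<Lambda>]]) auto

text \<open>For each \<open>x\<close>, \<open>residue_nonneg\<close> is applied to the form of
  \<Phi> at \<open>x\<close>: it has non-negative real part in the disk, and its polar part at
  \<open>v\<close> has coefficient -2 v times the form of X_v.\<close>

lemma psd_X:
  assumes v: "v \<in> N"
  shows "psd_on (\<lambda>i k. X v $$ (i, k)) {..<q}"
proof -
  have v1: "cmod v = 1" using v by (auto simp: N_eq)
  define h where "h i k = (SOME h. h analytic_on {v} \<and> (\<forall>\<^sub>F z in at v. f z \<noteq> 0 \<and> g i k z / f z = - 2 * v * X v $$ (i, k) / (z - v) + h z))" for i k
  have h_ev: "h i k analytic_on {v} \<and> (\<forall>\<^sub>F z in at v. f z \<noteq> 0 \<and> g i k z / f z = - 2 * v * X v $$ (i, k) / (z - v) + h i k z)"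
    if "i < q" "k < q" for i k
    unfolding h_def by (rule someI_ex[OF pole_at_N[OF v that]])
  have h: "h i k analytic_on {v}"
    and ev: "\<forall>\<^sub>F z in at v. f z \<noteq> 0 \<and> g i k z / f z = - 2 * v * X v $$ (i, k) / (z - v) + h i k z"
    if "i < q" "k < q" for i k
    using h_ev[OF that] by (rule conjunct1, rule conjunct2)
  have ev': "\<forall>\<^sub>F z in at v. \<forall>i\<in>{..<q}. \<forall>k\<in>{..<q}. f z \<noteq> 0 \<and> g i k z / f z = - 2 * v * X v $$ (i, k) / (z - v) + h i k z"
    by (intro eventually_ball_finite ballI finite_lessThan ev) auto
  have *: "0 \<le> Re (sform (\<lambda>i k. X v $$ (i, k)) {..<q} x x)" "Im (sform (\<lambda>i k. X v $$ (i, k)) {..<q} x x) = 0" for x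
  proof -
    have hc: "isCont (\<lambda>z. sform (\<lambda>i k. h i k z) {..<q} x x) v"
      unfolding sform_def by (intro continuous_intros analytic_at_imp_isCont h) auto
    have eq: "\<forall>\<^sub>F z in at v. cmod z < 1 \<longrightarrow> sform (\<lambda>i k. \<Phi> z $$ (i, k)) {..<q} x x =
        - 2 * v * sform (\<lambda>i k. X v $$ (i, k)) {..<q} x x / (z - v) + sform (\<lambda>i k. h i k z) {..<q} x x"
      using ev'
    proof eventually_elim
      case (elim z)
      show ?case
      proof
        assume z: "cmod z < 1"
        have "sform (\<lambda>i k. \<Phi> z $$ (i, k)) {..<q} x x =
            sform (\<lambda>i k. - 2 * v * X v $$ (i, k) / (z - v) + h i k z) {..<q} x x"
          by (rule sform_cong) (use elim \<Phi>_eq[OF z] in auto)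
        also have "\<dots> = - 2 * v * sform (\<lambda>i k. X v $$ (i, k)) {..<q} x x / (z - v) + sform (\<lambda>i k. h i k z) {..<q} x x"
          unfolding sform_def sum_distrib_left sum_divide_distrib sum.distrib[symmetric]
          by (intro sum.cong refl) (simp add: algebra_simps)
        finally show "sform (\<lambda>i k. \<Phi> z $$ (i, k)) {..<q} x x =
            - 2 * v * sform (\<lambda>i k. X v $$ (i, k)) {..<q} x x / (z - v) + sform (\<lambda>i k. h i k z) {..<q} x x" .
      qed
    qed
    show "0 \<le> Re (sform (\<lambda>i k. X v $$ (i, k)) {..<q} x x)" "Im (sform (\<lambda>i k. X v $$ (i, k)) {..<q} x x) = 0"
      using residue_nonneg[OF v1 Re_\<Phi>_nonneg hc eq] by auto
  qed
  then show ?thesis by (intro psd_onI_sform) auto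
qed

text \<open>Each summand is a purely imaginary kernel value times the form of X_v, which is real by
  \<open>psd_X\<close>.\<close>

lemma Re_\<Delta>_circle:
  assumes \<zeta>: "\<zeta> \<in> unit_circle"
  shows "Re (sform (\<lambda>i k. \<Delta> i k \<zeta>) {..<q} x x) = 0"
proof -
  have "sform (\<lambda>i k. \<Delta> i k \<zeta>) {..<q} x x = (\<Sum>i<q. \<Sum>k<q. \<Sum>v\<in>N. (v + \<zeta>) / (v - \<zeta>) * (cnj (x i) * X v $$ (i, k) * x k))"
    unfolding sform_def \<Delta>_def sum_distrib_left sum_distrib_right
    by (intro sum.cong refl) (simp add: mult_ac)
  also have "\<dots> = (\<Sum>i<q. \<Sum>v\<in>N. \<Sum>k<q. (v + \<zeta>) / (v - \<zeta>) * (cnj (x i) * X v $$ (i, k) * x k))"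
    by (rule sum.cong[OF refl]) (rule sum.swap)
  also have "\<dots> = (\<Sum>v\<in>N. \<Sum>i<q. \<Sum>k<q. (v + \<zeta>) / (v - \<zeta>) * (cnj (x i) * X v $$ (i, k) * x k))"
    by (rule sum.swap)
  also have "\<dots> = (\<Sum>v\<in>N. (v + \<zeta>) / (v - \<zeta>) * sform (\<lambda>i k. X v $$ (i, k)) {..<q} x x)"
    by (simp add: sform_def sum_distrib_left mult.assoc)
  finally have eq: "sform (\<lambda>i k. \<Delta> i k \<zeta>) {..<q} x x = (\<Sum>v\<in>N. (v + \<zeta>) / (v - \<zeta>) * sform (\<lambda>i k. X v $$ (i, k)) {..<q} x x)" .
  have "Re ((v + \<zeta>) / (v - \<zeta>) * sform (\<lambda>i k. X v $$ (i, k)) {..<q} x x) = 0" if v: "v \<in> N" for v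
  proof -
    let ?s = "sform (\<lambda>i k. X v $$ (i, k)) {..<q} x x"
    have "Im ?s = 0" by (rule psd_on_Im[OF psd_X[OF v]])
    moreover have "Re ((v + \<zeta>) / (v - \<zeta>)) = 0"
      using v N_subset \<zeta> by (intro Re_herglotz_kernel_circle) auto
    ultimately show ?thesis by (simp only: times_complex.sel mult_zero_left mult_zero_right diff_self)
  qed
  then show ?thesis unfolding eq Re_sum by (intro sum.neutral) blast
qed

section \<open>Boundary values of the real part and the representing density\<close>

lemma Lambda_carrier: "Lambda_fun q n \<Gamma> z \<in> carrier_mat q q"
  by (simp add: Lambda_fun_def)

lemma re_Lambda_index: "i < q \<Longrightarrow> k < q \<Longrightarrow> re_mat (Lambda_fun q n \<Gamma> z) $$ (i, k) = (\<Lambda> i k z + cnj (\<Lambda> k i z)) / 2"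
  by (rule re_mat_index[OF Lambda_carrier])

text \<open>Along the radius to \<zeta> the real parts of \<Lambda> and \<Delta> add up to that of
  \<Phi>, which is non-negative. Both are continuous at \<zeta> outside \<open>N\<close>, and in the
  limit the contribution of \<Delta> disappears.\<close>

lemma psd_re_Lambda:
  assumes \<zeta>: "\<zeta> \<in> unit_circle" "\<zeta> \<notin> N"
  shows "psd_on (\<lambda>i k. re_mat (Lambda_fun q n \<Gamma> \<zeta>) $$ (i, k)) {..<q}"
proof -
  have Re: "0 \<le> Re (sform (\<lambda>i k. \<Lambda> i k \<zeta>) {..<q} x x)" for x
  proof -
    let ?G = "\<lambda>z. Re (sform (\<lambda>i k. \<Lambda> i k z) {..<q} x x) + Re (sform (\<lambda>i k. \<Delta> i k z) {..<q} x x)"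
    have c\<Lambda>: "isCont (\<Lambda> i k) \<zeta>" if "i < q" "k < q" for i k
      by (rule analytic_at_imp_isCont, rule analytic_on_subset[OF analytic_\<Lambda>[OF that]]) (use \<zeta> in auto)
    have c\<Delta>: "isCont (\<Delta> i k) \<zeta>" for i k
      by (rule analytic_at_imp_isCont[OF analytic_\<Delta>[OF \<zeta>(2)]])
    have "isCont (\<lambda>z. sform (\<lambda>i k. \<Lambda> i k z) {..<q} x x) \<zeta>" "isCont (\<lambda>z. sform (\<lambda>i k. \<Delta> i k z) {..<q} x x) \<zeta>"
      unfolding sform_def by (intro continuous_intros c\<Lambda> c\<Delta>; simp)+
    then have cont: "isCont ?G \<zeta>"
      unfolding isCont_def by (intro tendsto_intros)
    have "((\<lambda>r. of_real r * \<zeta>) \<longlongrightarrow> of_real 1 * \<zeta>) (at_left (1::real))"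
      by (intro tendsto_intros)
    then have lim: "((\<lambda>r. of_real r * \<zeta>) \<longlongrightarrow> \<zeta>) (at_left (1::real))" by simp
    have "\<forall>\<^sub>F r in at_left (1::real). r \<in> {0<..<1}"
      by (rule eventually_at_left_real) simp
    then have "\<forall>\<^sub>F r in at_left (1::real). 0 \<le> ?G (of_real r * \<zeta>)"
    proof eventually_elim
      case (elim r)
      then have z: "cmod (of_real r * \<zeta>) < 1" using \<zeta> by (simp add: norm_mult)
      have "sform (\<lambda>i k. \<Lambda> i k (of_real r * \<zeta>)) {..<q} x x + sform (\<lambda>i k. \<Delta> i k (of_real r * \<zeta>)) {..<q} x x
          = sform (\<lambda>i k. \<Lambda> i k (of_real r * \<zeta>) + \<Delta> i k (of_real r * \<zeta>)) {..<q} x x"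
        by (simp add: sform_def distrib_left distrib_right sum.distrib)
      also have "\<dots> = sform (\<lambda>i k. \<Phi> (of_real r * \<zeta>) $$ (i, k)) {..<q} x x"
        by (rule sform_cong) (use \<Lambda>_disk[OF z] in auto)
      finally show ?case using Re_\<Phi>_nonneg[OF z, of x] by (metis plus_complex.sel(1))
    qed
    from tendsto_lowerbound[OF isCont_tendsto_compose[OF cont lim] this]
    have "0 \<le> ?G \<zeta>" by simp
    then show ?thesis using Re_\<Delta>_circle[OF \<zeta>(1), of x] by simp
  qed
  have "sform (\<lambda>i k. re_mat (Lambda_fun q n \<Gamma> \<zeta>) $$ (i, k)) {..<q} x x = of_real (Re (sform (\<lambda>i k. \<Lambda> i k \<zeta>) {..<q} x x))" for x
    unfolding sform_hermitian_part[symmetric] by (rule sform_cong) (auto simp: re_Lambda_index)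
  then show ?thesis by (intro psd_onI_sform) (auto simp: Re)
qed

definition \<sigma> :: "complex measure" where
  "\<sigma> = add_measure arc_length (counting_on N)"

text \<open>The two cases do not interfere: counting measure gives mass 1 to each point of
  \<open>N\<close> and none elsewhere, while \<open>N\<close> is a null set for arc length. The
  factor 1 / (2 pi) is already included.\<close>

definition H :: "complex \<Rightarrow> nat \<Rightarrow> nat \<Rightarrow> complex" where
  "H \<zeta> i k = (if \<zeta> \<in> N then X \<zeta> $$ (i, k) else re_mat (Lambda_fun q n \<Gamma> \<zeta>) $$ (i, k) / (2 * pi))"

lemma continuous_re_Lambda:
  assumes "i < q" "k < q"
  shows "continuous_on unit_circle (\<lambda>\<zeta>. re_mat (Lambda_fun q n \<Gamma> \<zeta>) $$ (i, k))"
  unfolding re_Lambda_index[OF assms] using assms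
  by (intro continuous_intros continuous_on_subset[OF continuous_\<Lambda>]) auto

lemma N_sets: "N \<in> sets circle_borel" "v \<in> unit_circle \<Longrightarrow> {v} \<in> sets circle_borel"
  using finite_N N_subset
  by (subst sets_restrict_space_iff; auto intro!: borel_closed finite_imp_closed)+

lemma sets_\<sigma>: "sets \<sigma> = sets circle_borel"
  by (simp add: \<sigma>_def)

lemma finite_measure_\<sigma>: "finite_measure \<sigma>"
  unfolding \<sigma>_def
  by (intro finite_measure_add_measure finite_measure_arc_length counting_on(1) finite_N N_subset) simp

lemma borel_measurable_H:
  assumes "i < q" "k < q"
  shows "(\<lambda>\<zeta>. H \<zeta> i k) \<in> borel_measurable circle_borel"
proof -
  let ?R = "\<lambda>\<zeta>. re_mat (Lambda_fun q n \<Gamma> \<zeta>) $$ (i, k) / (2 * pi)"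
  have R: "?R \<in> borel_measurable circle_borel"
    by (intro borel_measurable_divide borel_measurable_const borel_measurable_circle continuous_re_Lambda assms)
  have "(\<lambda>\<zeta>. (\<Sum>v\<in>N. indicator {v} \<zeta> *\<^sub>R X v $$ (i, k)) + indicator (unit_circle - N) \<zeta> *\<^sub>R ?R \<zeta>) \<in> borel_measurable circle_borel"
  proof (intro borel_measurable_add borel_measurable_sum borel_measurable_scaleR R borel_measurable_const borel_measurable_indicator)
    show "{v} \<in> sets circle_borel" if "v \<in> N" for v
      using that N_subset by (intro N_sets) auto
    show "unit_circle - N \<in> sets circle_borel"
      using sets.compl_sets[OF N_sets(1)] by simp
  qed
  also have "?this \<longleftrightarrow> (\<lambda>\<zeta>. H \<zeta> i k) \<in> borel_measurable circle_borel"
  proof (rule measurable_cong)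
    fix \<zeta> assume "\<zeta> \<in> space circle_borel"
    then have \<zeta>: "\<zeta> \<in> unit_circle" by simp
    show "(\<Sum>v\<in>N. indicator {v} \<zeta> *\<^sub>R X v $$ (i, k)) + indicator (unit_circle - N) \<zeta> *\<^sub>R ?R \<zeta> = H \<zeta> i k"
    proof (cases "\<zeta> \<in> N")
      case True
      have "(\<Sum>v\<in>N. indicator {v} \<zeta> *\<^sub>R X v $$ (i, k)) = (\<Sum>v\<in>N. if v = \<zeta> then X v $$ (i, k) else 0)"
        by (intro sum.cong) (auto simp: indicator_def)
      then show ?thesis using True finite_N by (simp add: H_def)
    next
      case False
      then have "(\<Sum>v\<in>N. indicator {v} \<zeta> *\<^sub>R X v $$ (i, k)) = 0"
        by (intro sum.neutral) (auto simp: indicator_def)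
      then show ?thesis using False \<zeta> by (simp add: H_def)
    qed
  qed
  finally show ?thesis .
qed

lemma integrable_H:
  assumes ik: "i < q" "k < q"
  shows "integrable \<sigma> (\<lambda>\<zeta>. H \<zeta> i k)"
proof -
  have "compact ((\<lambda>\<zeta>. re_mat (Lambda_fun q n \<Gamma> \<zeta>) $$ (i, k) / (2 * pi)) ` unit_circle)"
    using ik by (intro compact_continuous_image continuous_intros continuous_re_Lambda) auto
  moreover have "finite ((\<lambda>\<zeta>. X \<zeta> $$ (i, k)) ` N)" using finite_N by simp
  ultimately have "bounded ((\<lambda>\<zeta>. re_mat (Lambda_fun q n \<Gamma> \<zeta>) $$ (i, k) / (2 * pi)) ` unit_circle \<union> (\<lambda>\<zeta>. X \<zeta> $$ (i, k)) ` N)"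
    by (simp add: compact_imp_bounded finite_imp_bounded)
  then obtain b where b: "\<And>y. y \<in> (\<lambda>\<zeta>. re_mat (Lambda_fun q n \<Gamma> \<zeta>) $$ (i, k) / (2 * pi)) ` unit_circle \<union> (\<lambda>\<zeta>. X \<zeta> $$ (i, k)) ` N \<Longrightarrow> norm y \<le> b"
    by (auto simp: bounded_iff)
  show ?thesis
  proof (rule finite_measure.integrable_const_bound[OF finite_measure_\<sigma>, of _ b])
    have "norm (H \<zeta> i k) \<le> b" if "\<zeta> \<in> unit_circle" for \<zeta>
      by (rule b) (use that in \<open>auto simp: H_def\<close>)
    then show "AE \<zeta> in \<sigma>. norm (H \<zeta> i k) \<le> b"
      by (intro AE_I2) (simp add: \<sigma>_def)
    show "(\<lambda>\<zeta>. H \<zeta> i k) \<in> borel_measurable \<sigma>"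
      unfolding measurable_cong_sets[OF sets_\<sigma> refl] by (rule borel_measurable_H[OF ik])
  qed
qed

lemma psd_H:
  assumes \<zeta>: "\<zeta> \<in> unit_circle"
  shows "psd_on (H \<zeta>) {..<q}"
proof (cases "\<zeta> \<in> N")
  case True
  then show ?thesis using psd_X psd_on_cong[of "{..<q}" "H \<zeta>" "\<lambda>i k. X \<zeta> $$ (i, k)"] by (simp add: H_def)
next
  case False
  let ?R = "\<lambda>i k. re_mat (Lambda_fun q n \<Gamma> \<zeta>) $$ (i, k)"
  have R: "psd_on ?R {..<q}" by (rule psd_re_Lambda[OF \<zeta> False])
  have s: "sform (H \<zeta>) {..<q} x x = sform ?R {..<q} x x / of_real (2 * pi)" for x
    using False by (simp add: sform_def H_def sum_distrib_left sum_divide_distrib mult_ac)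
  show ?thesis
    by (intro psd_onI_sform finite_lessThan)
       (simp_all only: s Re_divide_of_real Im_divide_of_real, simp_all add: psd_on_Im[OF R] psd_on_nonneg[OF R])
qed

sublocale density: psd_density \<sigma> q H
  using finite_measure_\<sigma>
  by (intro psd_density.intro psd_density_axioms.intro sets_\<sigma> integrable_H psd_H)

lemma integral_H:
  assumes u: "u \<in> borel_measurable circle_borel" and b: "\<And>\<zeta>. \<zeta> \<in> unit_circle \<Longrightarrow> cmod (u \<zeta>) \<le> b"
    and ik: "i < q" "k < q"
  shows "(LINT \<zeta>|\<sigma>. u \<zeta> * H \<zeta> i k) = (LINT \<zeta>|arc_length. u \<zeta> * re_mat (Lambda_fun q n \<Gamma> \<zeta>) $$ (i, k)) / (2 * pi)
    + (\<Sum>v\<in>N. u v * X v $$ (i, k))"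
proof -
  let ?R = "\<lambda>\<zeta>. re_mat (Lambda_fun q n \<Gamma> \<zeta>) $$ (i, k)"
  have m: "(\<lambda>\<zeta>. u \<zeta> * H \<zeta> i k) \<in> borel_measurable circle_borel"
    using u borel_measurable_H[OF ik] by (rule borel_measurable_times)
  have "integrable \<sigma> (\<lambda>\<zeta>. u \<zeta> * H \<zeta> i k)"
    by (rule integrable_bounded_mult[OF integrable_H[OF ik] _ b])
       (use u in \<open>simp_all add: measurable_cong_sets[OF sets_\<sigma> refl] density.space_\<sigma>\<close>)
  then have int: "integrable (add_measure arc_length (counting_on N)) (\<lambda>\<zeta>. u \<zeta> * H \<zeta> i k)"
    by (simp only: \<sigma>_def)
  have "(LINT \<zeta>|\<sigma>. u \<zeta> * H \<zeta> i k) = (LINT \<zeta>|arc_length. u \<zeta> * H \<zeta> i k) + (LINT \<zeta>|counting_on N. u \<zeta> * H \<zeta> i k)"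
    unfolding \<sigma>_def by (rule integral_add_measure(3)[OF _ int]) simp
  also have "(LINT \<zeta>|counting_on N. u \<zeta> * H \<zeta> i k) = (\<Sum>v\<in>N. u v * X v $$ (i, k))"
    by (subst counting_on(2)[OF finite_N N_subset m]) (simp add: H_def)
  also have "(LINT \<zeta>|arc_length. u \<zeta> * H \<zeta> i k) = (LINT \<zeta>|arc_length. u \<zeta> * ?R \<zeta> / (2 * pi))"
  proof (rule integral_cong_AE)
    have "N \<in> null_sets arc_length"
      using emeasure_arc_length_finite[OF finite_N N_subset] N_sets(1) by (auto simp: null_sets_def)
    then have "AE \<zeta> in arc_length. \<zeta> \<notin> N" by (rule AE_not_in)
    then show "AE \<zeta> in arc_length. u \<zeta> * H \<zeta> i k = u \<zeta> * ?R \<zeta> / (2 * pi)"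
      by eventually_elim (simp add: H_def)
    have "(\<lambda>\<zeta>. u \<zeta> * ?R \<zeta> / (2 * pi)) \<in> borel_measurable circle_borel"
      by (intro borel_measurable_divide borel_measurable_times u borel_measurable_const borel_measurable_circle continuous_re_Lambda ik)
    then show "(\<lambda>\<zeta>. u \<zeta> * H \<zeta> i k) \<in> borel_measurable arc_length"
      "(\<lambda>\<zeta>. u \<zeta> * ?R \<zeta> / (2 * pi)) \<in> borel_measurable arc_length"
      using m by (simp_all add: measurable_cong_sets[OF sets_arc_length refl])
  qed
  finally show ?thesis by simp
qed

text \<open>The Schwarz formulas for \<Lambda> and for the conjugate of its transpose turn the arc
  length part into \<Lambda>(z) minus the skew-Hermitian part of \<Lambda>(0). The point masses
  integrate to \<Delta>(z), and \<Lambda> + \<Delta> = \<Phi> in the disk.\<close>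

lemma herglotz_representation:
  assumes z: "cmod z < 1"
  shows "has_matrix_integral q density.\<mu> (\<lambda>\<zeta>. (\<zeta> + z) / (\<zeta> - z)) (\<Phi> z - \<i> \<cdot>\<^sub>m im_mat (\<Phi> 0))"
proof (rule density.has_matrix_integral_\<mu>)
  let ?h = "\<lambda>\<zeta>. (\<zeta> + z) / (\<zeta> - z)"
  have hc: "continuous_on unit_circle ?h" using z by (intro continuous_intros) auto
  show h: "?h \<in> borel_measurable circle_borel" by (rule borel_measurable_herglotz_kernel[OF z])
  show b: "cmod (?h \<zeta>) \<le> 2 / (1 - cmod z)" if "\<zeta> \<in> unit_circle" for \<zeta>
  proof -
    have "cmod (\<zeta> + z) \<le> 2" using norm_triangle_ineq[of \<zeta> z] that z by simp
    moreover have "1 - cmod z \<le> cmod (\<zeta> - z)" using norm_triangle_ineq2[of \<zeta> z] that by simp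
    ultimately show ?thesis unfolding norm_divide using z by (intro frac_le) auto
  qed
  show "\<Phi> z - \<i> \<cdot>\<^sub>m im_mat (\<Phi> 0) \<in> carrier_mat q q"
    using \<Phi>_carrier[of 0] \<Phi>_carrier[of z] by (intro carrier_matI) (auto simp: im_mat_def)
  fix i k assume ik: "i < q" "k < q"
  have cL: "continuous_on unit_circle (\<Lambda> i k)" if "i < q" "k < q" for i k
    by (rule continuous_on_subset[OF continuous_\<Lambda>[OF that]]) auto
  have int1: "integrable arc_length (\<lambda>\<zeta>. ?h \<zeta> * \<Lambda> i k \<zeta>)" and int2: "integrable arc_length (\<lambda>\<zeta>. ?h \<zeta> * cnj (\<Lambda> k i \<zeta>))"
    using ik by (intro integrable_arc_length continuous_intros hc cL; simp)+
  have "(LINT \<zeta>|arc_length. ?h \<zeta> * cnj (\<Lambda> k i \<zeta>)) = (LINT \<zeta>|arc_length. cnj (cnj (?h \<zeta>) * \<Lambda> k i \<zeta>))"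
    by simp
  also have "\<dots> = cnj (LINT \<zeta>|arc_length. cnj (?h \<zeta>) * \<Lambda> k i \<zeta>)"
    by (rule Bochner_Integration.integral_cnj)
  also have "\<dots> = 2 * pi * cnj (\<Lambda> k i 0)"
    using schwarz_integral(2)[OF continuous_\<Lambda>[OF ik(2,1)] holomorphic_\<Lambda>[OF ik(2,1)], of z] z by simp
  finally have I2: "(LINT \<zeta>|arc_length. ?h \<zeta> * cnj (\<Lambda> k i \<zeta>)) = 2 * pi * cnj (\<Lambda> k i 0)" .
  have I1: "(LINT \<zeta>|arc_length. ?h \<zeta> * \<Lambda> i k \<zeta>) = 2 * pi * (2 * \<Lambda> i k z - \<Lambda> i k 0)"
    using schwarz_integral(1)[OF continuous_\<Lambda>[OF ik] holomorphic_\<Lambda>[OF ik], of z] z by simp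
  have "(LINT \<zeta>|arc_length. ?h \<zeta> * re_mat (Lambda_fun q n \<Gamma> \<zeta>) $$ (i, k)) =
      (LINT \<zeta>|arc_length. (?h \<zeta> * \<Lambda> i k \<zeta> + ?h \<zeta> * cnj (\<Lambda> k i \<zeta>)) / 2)"
    unfolding re_Lambda_index[OF ik] by (simp add: distrib_left)
  also have "\<dots> = (2 * pi * (2 * \<Lambda> i k z - \<Lambda> i k 0) + 2 * pi * cnj (\<Lambda> k i 0)) / 2"
    using int1 int2 by (simp only: integral_divide_zero Bochner_Integration.integral_add I1 I2)
  finally have I: "(LINT \<zeta>|arc_length. ?h \<zeta> * re_mat (Lambda_fun q n \<Gamma> \<zeta>) $$ (i, k)) =
      (2 * pi * (2 * \<Lambda> i k z - \<Lambda> i k 0) + 2 * pi * cnj (\<Lambda> k i 0)) / 2" .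
  have arith: "(2 * pi * (2 * a - b) + 2 * pi * c) / 2 / (2 * pi) = a - (b - c) / 2" for a b c :: complex
    by (simp add: field_simps)
  have arc: "(LINT \<zeta>|arc_length. ?h \<zeta> * re_mat (Lambda_fun q n \<Gamma> \<zeta>) $$ (i, k)) / (2 * pi) =
      \<Lambda> i k z - (\<Lambda> i k 0 - cnj (\<Lambda> k i 0)) / 2"
    unfolding I by (rule arith)
  have \<Delta>0: "\<Delta> i k 0 = (\<Sum>v\<in>N. X v $$ (i, k))" if "i < q" "k < q" for i k
    unfolding \<Delta>_def by (intro sum.cong refl) (use N_subset in auto)
  \<comment> \<open>\<Delta>(0) is the sum of the Hermitian matrices X_v, so \<Lambda>(0) and
    \<Phi>(0) have the same skew-Hermitian part.\<close>
  have "cnj (\<Delta> k i 0) = (\<Sum>v\<in>N. cnj (X v $$ (k, i)))" by (simp add: \<Delta>0[OF ik(2,1)])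
  also have "\<dots> = \<Delta> i k 0"
    unfolding \<Delta>0[OF ik] using psd_on_hermitian[OF psd_X, of _ k i] ik by (intro sum.cong refl) auto
  finally have \<Delta>_herm: "cnj (\<Delta> k i 0) = \<Delta> i k 0" .
  have "(LINT \<zeta>|\<sigma>. ?h \<zeta> * H \<zeta> i k) = \<Lambda> i k z - (\<Lambda> i k 0 - cnj (\<Lambda> k i 0)) / 2 + \<Delta> i k z"
    using integral_H[OF h b ik] by (simp only: arc \<Delta>_def)
  also have "\<dots> = \<Phi> z $$ (i, k) - (\<Phi> 0 $$ (i, k) - cnj (\<Phi> 0 $$ (k, i))) / 2"
    using z ik by (simp add: \<Lambda>_disk \<Delta>_herm)
  also have "\<dots> = (\<Phi> z - \<i> \<cdot>\<^sub>m im_mat (\<Phi> 0)) $$ (i, k)"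
  proof -
    have "mat_adjoint (\<Phi> 0) $$ (i, k) = cnj (\<Phi> 0 $$ (k, i))"
      using ik \<Phi>_carrier[of 0] by (intro mat_adjoint_index) auto
    then show ?thesis
      using ik \<Phi>_carrier[of 0] \<Phi>_carrier[of z] by (simp add: im_mat_def diff_divide_distrib)
  qed
  finally show "(\<Phi> z - \<i> \<cdot>\<^sub>m im_mat (\<Phi> 0)) $$ (i, k) = (LINT \<zeta>|\<sigma>. ?h \<zeta> * H \<zeta> i k)" by simp
qed

lemma riesz_herglotz_measure_eq: "riesz_herglotz_measure q \<Phi> = density.\<mu>"
  unfolding riesz_herglotz_measure_def
proof (rule the_equality)
  show *: "nonneg_hermitian_measure q density.\<mu> \<and>
      (\<forall>z\<in>ball 0 1. has_matrix_integral q density.\<mu> (\<lambda>\<zeta>. (\<zeta> + z) / (\<zeta> - z)) (\<Phi> z - \<i> \<cdot>\<^sub>m im_mat (\<Phi> 0)))"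
    using density.nonneg_hermitian_measure_\<mu> herglotz_representation by simp
  fix \<nu> assume "nonneg_hermitian_measure q \<nu> \<and>
      (\<forall>z\<in>ball 0 1. has_matrix_integral q \<nu> (\<lambda>\<zeta>. (\<zeta> + z) / (\<zeta> - z)) (\<Phi> z - \<i> \<cdot>\<^sub>m im_mat (\<Phi> 0)))"
  with * show "\<nu> = density.\<mu>"
    by (intro herglotz_measure_unique[where J = "\<lambda>z. \<Phi> z - \<i> \<cdot>\<^sub>m im_mat (\<Phi> 0)"]) auto
qed

end

theorem theorem5p10:
  fixes n q :: nat and \<Gamma> :: "nat \<Rightarrow> complex mat"
  assumes "n \<ge> 1" and "q \<ge> 1"
    and "caratheodory_sequence q n \<Gamma>"
  shows "\<forall>B\<in>sets circle_borel.
    riesz_herglotz_measure q (central_caratheodory_function q n \<Gamma>) B =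
      mat q q (\<lambda>(i, k).
        1 / (2 * pi) * (LINT \<zeta>:B|arc_length. re_mat (Lambda_fun q n \<Gamma> \<zeta>) $$ (i, k)) +
        (\<Sum>v\<in>N_set q n \<Gamma>. X_mat q n \<Gamma> v $$ (i, k) * measure (return circle_borel v) B))"
proof
  interpret central n q \<Gamma> using assms by unfold_locales
  fix B assume B: "B \<in> sets circle_borel"
  show "riesz_herglotz_measure q \<Phi> B =
      mat q q (\<lambda>(i, k).
        1 / (2 * pi) * (LINT \<zeta>:B|arc_length. re_mat (Lambda_fun q n \<Gamma> \<zeta>) $$ (i, k)) +
        (\<Sum>v\<in>N. X v $$ (i, k) * measure (return circle_borel v) B))" (is "_ = ?M")
  proof (rule eq_matI)
    fix i k assume "i < dim_row ?M" "k < dim_col ?M"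
    then have ik: "i < q" "k < q" by auto
    \<comment> \<open>The value of the measure at \<open>B\<close> is the integral of the indicator
      of \<open>B\<close>, to which \<open>integral_H\<close> applies with bound 1.\<close>
    have u: "(\<lambda>\<zeta>. complex_of_real (indicator B \<zeta>)) \<in> borel_measurable circle_borel"
      using B by measurable
    have "riesz_herglotz_measure q \<Phi> B $$ (i, k) = (LINT \<zeta>:B|\<sigma>. H \<zeta> i k)"
      unfolding riesz_herglotz_measure_eq by (rule density.\<mu>_index[OF B ik])
    also have "\<dots> = (LINT \<zeta>|\<sigma>. of_real (indicator B \<zeta>) * H \<zeta> i k)"
      by (simp add: set_lebesgue_integral_def scaleR_conv_of_real)
    also have "\<dots> = (LINT \<zeta>|arc_length. of_real (indicator B \<zeta>) * re_mat (Lambda_fun q n \<Gamma> \<zeta>) $$ (i, k)) / (2 * pi)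
        + (\<Sum>v\<in>N. of_real (indicator B v) * X v $$ (i, k))"
      by (rule integral_H[OF u _ ik, of 1]) (simp add: indicator_def)
    also have "\<dots> = ?M $$ (i, k)"
      using B ik by (simp add: set_lebesgue_integral_def scaleR_conv_of_real measure_return mult.commute)
    finally show "riesz_herglotz_measure q \<Phi> B $$ (i, k) = ?M $$ (i, k)" .
  qed (use density.\<mu>_carrier[of B] in \<open>auto simp: riesz_herglotz_measure_eq\<close>)
qed

end
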